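(* The following identity holds: \[ \frac{520}{\pi} = \sum_{n = 0}^{\infty} \frac{1054 n + 233}{480^n} \binom{2n}{n} \sum_{k = 0}^n \binom{n}{k}^2 \binom{2k}{n} (-1)^k 8^{2k - n}. \]
   Context: Here $\binom{2k}{n}=0$ when $n>2k$. *)

theory Defs
  imports "HOL-Analysis.Analysis"
begin

end

theory Submission
  imports Defs
begin

text \<open>
  Put \<open>n = 2m + s\<close>, \<open>k = m + s\<close>: the sum becomes a double power series \<open>G(p, q)\<close> in 
  \<open>p = z\<close>, \<open>q = z\<^sup>2 y\<close>, at \<open>z = -1/60\<close>, \<open>y = -1/64\<close>. It satisfies two second-order partial
  differential equations, and in suitable coordinates \<open>u = tan (\<alpha>/2)\<close>, \<open>v = tan (\<beta>/2)\<close> these imply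
  the Legendre equation in each variable, so that
  \<open>G = cos ((\<alpha> + \<beta>)/2) H(cos \<alpha>) H(cos \<beta>)\<close> with \<open>H\<close> the Legendre function of degree \<open>-1/2\<close> 
  (a complete elliptic integral).

  At the point in question \<open>cos \<alpha>\<close> and \<open>cos \<beta>\<close> are the values of \<open>1 - 2k\<^sup>2\<close> at the
  singular moduli with \<open>K'/K = 3/\<surd>5\<close> and \<open>3\<surd>5\<close>. The cubic transformation carries both to the modulus
  with \<open>K'/K = \<surd>5\<close>, where the fixed point of the quintic transformation relates \<open>H(-s)\<close> to \<open>H(s)\<close>, 
  and Legendre's relation then produces \<open>1/\<pi>\<close>. The transformations are proved by comparing solutions 
  of a differential equation that agree at a singular endpoint.
\<close>

section \<open>Legendre functions of degree minus one half\<close>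

text \<open>The Legendre equation is carried throughout as a first-order system for a function and
  its flux; for \<open>legH\<close> the flux is \<open>legK s\<close> = (1 - s^2) H'(s). The flux
  stays regular at the singular point s = 1, where the second solution is logarithmic, so a
  vanishing flux there singles out one solution up to scale. This one principle
  (\<open>flux_unique\<close>) proves both modular transformations and the separation of the double
  series. The constant in Legendre's relation comes from Wallis' product. With H0 =
  \<open>legH (2 * r^3)\<close> and K0 = \<open>legK (2 * r^3)\<close>, the transformations turn the
  sum of the series into A H0^2 + B H0 K0 with algebraic A and B; there is no K0^2 because only one
  derivative is taken. Legendre's relation at the fixed point has the same shape. The part 1054 n of
  the weight is the operator z d/dz, and 233 is the multiple of the underived series for which A : B
  agrees with Legendre's relation.\<close>

definition cbsq :: "nat \<Rightarrow> real" where
  "cbsq n = (real ((2*n) choose n) / 4 ^ n)\<^sup>2"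

lemma cbsq_0 [simp]: "cbsq 0 = 1"
  by (simp add: cbsq_def)

lemma central_binomial_Suc:
  "(n + 1) * ((2 * Suc n) choose Suc n) = 2 * (2 * n + 1) * ((2 * n) choose n)"
proof -
  have "(2 * Suc n) choose Suc n = 2 * ((2 * n + 1) choose n)"
    using binomial_symmetric[of n "2 * n + 1"] by (simp add: choose_reduce_nat)
  moreover have "(n + 1) * ((2 * n + 1) choose n) = (2 * n + 1) * ((2 * n) choose n)"
    using Suc_times_binomial_eq[of "2*n" n] binomial_symmetric[of n "2 * n + 1"] by simp
  ultimately show ?thesis by (metis mult.assoc mult.left_commute)
qed

lemma cbsq_Suc: "4 * (real n + 1)\<^sup>2 * cbsq (Suc n) = (2 * real n + 1)\<^sup>2 * cbsq n"
proof -
  have "(real n + 1) * real ((2 * Suc n) choose Suc n) = 2 * (2 * real n + 1) * real ((2 * n) choose n)"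
    using arg_cong[OF central_binomial_Suc[of n], of real] by (simp add: algebra_simps)
  hence "((real n + 1) * real ((2 * Suc n) choose Suc n))\<^sup>2 
       = (2 * (2 * real n + 1) * real ((2 * n) choose n))\<^sup>2" by simp
  hence "(real n + 1)\<^sup>2 * (real ((2 * Suc n) choose Suc n))\<^sup>2 
       = 4 * (2 * real n + 1)\<^sup>2 * (real ((2 * n) choose n))\<^sup>2" 
    by (simp only: power_mult_distrib) simp
  moreover have "((4::real) ^ Suc n)\<^sup>2 = 16 * (4 ^ n)\<^sup>2" by (simp add: power2_eq_square)
  ultimately show ?thesis unfolding cbsq_def power_divide by (simp add: divide_simps del: binomial_Suc_Suc mult_Suc_right power_Suc)
qed

lemma cbsq_pos: "cbsq n > 0"
  by (simp add: cbsq_def)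

lemma cbsq_Suc_le: "cbsq (Suc n) \<le> cbsq n"
proof -
  have "4 * (real n + 1)\<^sup>2 * cbsq (Suc n) \<le> 4 * (real n + 1)\<^sup>2 * cbsq n"
    unfolding cbsq_Suc using cbsq_pos[of n] 
    by (intro mult_right_mono) (auto simp: power2_eq_square algebra_simps)
  thus ?thesis by (auto simp: mult_le_cancel_left)
qed

lemma cbsq_le_1: "cbsq n \<le> 1"
  by (induction n) (use cbsq_Suc_le order_trans in \<open>auto simp del: One_nat_def\<close>)

text \<open>The partial Wallis products are exactly 1 / ((2 n + 1) \<open>cbsq n\<close>).\<close>

lemma tendsto_n_cbsq: "(\<lambda>n. real n * cbsq n) \<longlonglongrightarrow> 1 / pi"
proof -
  have w: "(\<Prod>k=1..n. (4 * real k ^ 2) / (4 * real k ^ 2 - 1)) = 1 / ((2 * real n + 1) * cbsq n)" for n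
  proof (induction n)
    case (Suc n)
    have "4 * (real n + 1)\<^sup>2 / (4 * (real n + 1)\<^sup>2 - 1) / ((2 * real n + 1) * cbsq n)
       = 1 / ((2 * real (Suc n) + 1) * cbsq (Suc n))"
    proof -
      have 1: "cbsq (Suc n) = (2 * real n + 1)\<^sup>2 * cbsq n / (4 * (real n + 1)\<^sup>2)"
        using cbsq_Suc[of n] by (simp add: field_simps add_pos_nonneg del: of_nat_Suc) 
      have 2: "4 * (real n + 1)\<^sup>2 - 1 = (2 * real n + 1) * (2 * real n + 3)"
        by (simp add: power2_eq_square algebra_simps)
      have nz: "2 * real n + 1 \<noteq> 0" "2 * real n + 3 \<noteq> 0" "real n + 1 \<noteq> 0" by linarith+
      show ?thesis using cbsq_pos[of n] nz unfolding 1 2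
        by (simp add: divide_simps) (simp add: power2_eq_square algebra_simps)
    qed
    moreover have "(\<Prod>k=1..Suc n. (4 * real k ^ 2) / (4 * real k ^ 2 - 1)) 
       = (\<Prod>k=1..n. (4 * real k ^ 2) / (4 * real k ^ 2 - 1)) * (4 * (real n + 1)\<^sup>2 / (4 * (real n + 1)\<^sup>2 - 1))"
      by (simp add: add.commute)
    ultimately show ?case unfolding Suc by (simp add: mult.commute)
  qed simp
  have "(\<lambda>n. 1 / ((2 * real n + 1) * cbsq n)) \<longlonglongrightarrow> pi / 2"
    using wallis unfolding w by simp
  hence "(\<lambda>n. inverse (1 / ((2 * real n + 1) * cbsq n))) \<longlonglongrightarrow> inverse (pi / 2)"
    by (intro tendsto_inverse) auto
  hence *: "(\<lambda>n. (2 * real n + 1) * cbsq n) \<longlonglongrightarrow> 2 / pi" by simp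
  have "(\<lambda>n. real n / (2 * real n + 1)) \<longlonglongrightarrow> 1 / 2" by real_asymp
  from tendsto_mult[OF * this]
  have "(\<lambda>n. (2 * real n + 1) * cbsq n * (real n / (2 * real n + 1))) \<longlonglongrightarrow> 1 / pi" by simp
  moreover have "(\<lambda>n. (2 * real n + 1) * cbsq n * (real n / (2 * real n + 1))) = (\<lambda>n. real n * cbsq n)"
    by (rule ext) (simp add: field_simps add_pos_nonneg)
  ultimately show ?thesis by simp
qed

lemma tendsto_cbsq: "cbsq \<longlonglongrightarrow> 0"
proof -
  have "(\<lambda>n. real n * cbsq n * (1 / real n)) \<longlonglongrightarrow> 1 / pi * 0"
    by (intro tendsto_mult tendsto_n_cbsq lim_1_over_n)
  moreover have "eventually (\<lambda>n. real n * cbsq n * (1 / real n) = cbsq n) sequentially"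
    using eventually_gt_at_top[of 0] by eventually_elim simp
  ultimately show ?thesis by (simp add: tendsto_cong)
qed

text \<open>The weights (1 - x) x^n sum to 1 and drift to infinity as x tends to 1, so the left side
  is an average that sees only the tail of \<open>a\<close>. It turns coefficient asymptotics into
  the behaviour of \<open>cbP\<close> and \<open>cbQ\<close> at m = 1.\<close>

lemma Abel_mean_tendsto:
  fixes a :: "nat \<Rightarrow> real"
  assumes "a \<longlonglongrightarrow> L"
  shows "((\<lambda>x. (1 - x) * (\<Sum>n. a n * x ^ n)) \<longlongrightarrow> L) (at_left 1)"
proof (rule tendstoI)
  fix e :: real assume e: "e > 0"
  obtain B where B: "\<And>n. \<bar>a n\<bar> \<le> B" using convergent_imp_Bseq[OF convergentI[OF assms]] 
    by (auto simp: Bseq_def)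
  obtain N where N: "\<And>n. n \<ge> N \<Longrightarrow> \<bar>a n - L\<bar> < e / 2"
    using assms e unfolding LIMSEQ_def dist_real_def by (meson half_gt_zero)
  define M where "M = (\<Sum>n<N. \<bar>a n - L\<bar>)"
  have M: "M \<ge> 0" unfolding M_def by (auto intro: sum_nonneg)
  have "((\<lambda>x. (1 - x) * M + e / 2) \<longlongrightarrow> (1 - 1) * M + e / 2) (at_left 1)"
    by (intro tendsto_intros)
  hence ev: "eventually (\<lambda>x. (1 - x) * M + e / 2 < e) (at_left 1)"
    by (rule order_tendstoD) (use e in auto)
  moreover have "eventually (\<lambda>x::real. x > 0) (at_left 1)"
    by (rule eventually_at_leftI[of 0]) auto
  moreover have "eventually (\<lambda>x::real. x < 1) (at_left 1)"
    by (simp add: eventually_at_filter)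
  ultimately show "eventually (\<lambda>x. dist ((1 - x) * (\<Sum>n. a n * x ^ n)) L < e) (at_left 1)"
  proof eventually_elim
    case (elim x)
    have geo: "summable (\<lambda>n. x ^ n)" "(\<Sum>n. x ^ n) = 1 / (1 - x)"
      using elim by (auto intro: summable_geometric suminf_geometric)
    have smb: "summable (\<lambda>n. c n * x ^ n)" if "\<And>n. \<bar>c n\<bar> \<le> C" for c :: "nat \<Rightarrow> real" and C
    proof (rule summable_comparison_test[OF _ summable_mult[OF geo(1), of C]])
      show "\<exists>N. \<forall>n\<ge>N. norm (c n * x ^ n) \<le> C * x ^ n" 
        using that elim by (auto simp: abs_mult intro!: mult_right_mono)
    qed
    have bL: "\<bar>a n - L\<bar> \<le> B + \<bar>L\<bar>" for n using B[of n] by linarith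
    have sm: "summable (\<lambda>n. a n * x ^ n)" "summable (\<lambda>n. \<bar>a n - L\<bar> * x ^ n)" "summable (\<lambda>n. (a n - L) * x ^ n)"
      using smb[of a B] B smb[of "\<lambda>n. \<bar>a n - L\<bar>"] smb[of "\<lambda>n. a n - L"] bL by auto
    have "(1 - x) * (\<Sum>n. a n * x ^ n) - L = (1 - x) * ((\<Sum>n. a n * x ^ n) - (\<Sum>n. L * x ^ n))"
      unfolding suminf_mult[OF geo(1)] geo(2) using elim by (simp add: field_simps)
    also have "(\<Sum>n. a n * x ^ n) - (\<Sum>n. L * x ^ n) = (\<Sum>n. (a n - L) * x ^ n)"
      by (subst suminf_diff) (use sm geo in \<open>auto simp: algebra_simps intro: summable_mult\<close>)
    finally have eq: "(1 - x) * (\<Sum>n. a n * x ^ n) - L = (1 - x) * (\<Sum>n. (a n - L) * x ^ n)" .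
    have smN: "summable (\<lambda>n. if n < N then \<bar>a n - L\<bar> else 0)"
      by (rule summable_finite[of "{..<N}"]) auto
    have "\<bar>\<Sum>n. (a n - L) * x ^ n\<bar> \<le> (\<Sum>n. \<bar>a n - L\<bar> * x ^ n)"
      using summable_rabs[of "\<lambda>n. (a n - L) * x ^ n"] sm(2) elim by (simp add: abs_mult)
    also have "\<dots> \<le> (\<Sum>n. (if n < N then \<bar>a n - L\<bar> else 0) + e / 2 * x ^ n)"
    proof (rule suminf_le)
      fix n show "\<bar>a n - L\<bar> * x ^ n \<le> (if n < N then \<bar>a n - L\<bar> else 0) + e / 2 * x ^ n"
      proof (cases "n < N")
        case True
        have "\<bar>a n - L\<bar> * x ^ n \<le> \<bar>a n - L\<bar> * 1" using elim by (intro mult_left_mono power_le_one) auto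
        thus ?thesis using True e elim by (simp add: add_increasing2)
      next
        case False
        thus ?thesis using N[of n] elim by (simp add: mult_right_mono)
      qed
    qed (intro sm summable_add smN summable_mult geo(1))+
    also have "\<dots> = (\<Sum>n. (if n < N then \<bar>a n - L\<bar> else 0)) + (\<Sum>n. e / 2 * x ^ n)"
      by (rule suminf_add[symmetric]) (intro smN summable_mult geo(1))+
    also have "(\<Sum>n. (if n < N then \<bar>a n - L\<bar> else 0)) = M"
      unfolding M_def by (subst suminf_finite[of "{..<N}"]) auto
    also have "(\<Sum>n. e / 2 * x ^ n) = e / 2 / (1 - x)"
      using geo by (subst suminf_mult) auto
    finally have "\<bar>\<Sum>n. (a n - L) * x ^ n\<bar> \<le> M + e / 2 / (1 - x)" .
    hence "(1 - x) * \<bar>\<Sum>n. (a n - L) * x ^ n\<bar> \<le> (1 - x) * (M + e / 2 / (1 - x))"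
      using elim by (intro mult_left_mono) auto
    also have "\<dots> = (1 - x) * M + e / 2" using elim by (simp add: field_simps)
    also have "\<dots> < e" using elim by simp
    finally show ?case unfolding dist_real_def eq using elim by (simp add: abs_mult)
  qed
qed

section \<open>The hypergeometric function F(1/2, 1/2; 1; m) = (2/pi) K(m) and its flux\<close>

definition cbP :: "real \<Rightarrow> real" where
  "cbP m = (\<Sum>n. cbsq n * m ^ n)"

text \<open>The flux m (1 - m) P'(m) of P = \<open>cbP\<close>, since \<open>real n * cbsq n\<close>
  are the coefficients of m P'(m).\<close>

definition cbQ :: "real \<Rightarrow> real" where
  "cbQ m = (1 - m) * (\<Sum>n. (real n * cbsq n) * m ^ n)"

text \<open>Coefficient form of the hypergeometric equation (m (1 - m) P')' = P/4: the factor 1 - m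
  turns coefficients into differences, and differentiation multiplies by n + 1.\<close>

lemma n_cbsq_Suc_minus:
  "real (Suc n) * (real (Suc n) * cbsq (Suc n) - real n * cbsq n) = cbsq n / 4"
  using cbsq_Suc[of n] by (simp add: algebra_simps power2_eq_square)

lemma n_cbsq_le: "real n * cbsq n \<le> 1"
proof (cases n)
  case (Suc k)
  have "real n * cbsq n \<le> 1 / pi"
  proof (rule incseq_le[OF _ tendsto_n_cbsq])
    show "incseq (\<lambda>n. real n * cbsq n)"
    proof (rule incseq_SucI)
      fix n
      have "real (Suc n) * (real (Suc n) * cbsq (Suc n) - real n * cbsq n) \<ge> 0"
        unfolding n_cbsq_Suc_minus using cbsq_pos[of n] by simp
      thus "real n * cbsq n \<le> real (Suc n) * cbsq (Suc n)" 
        by (simp add: zero_le_mult_iff)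
    qed
  qed
  also have "1 / pi \<le> 1" using pi_ge_two by simp
  finally show ?thesis .
qed simp

lemma summable_bounded_powser:
  fixes a :: "nat \<Rightarrow> real"
  assumes "\<And>n. \<bar>a n\<bar> \<le> C" "\<bar>x\<bar> < 1"
  shows "summable (\<lambda>n. a n * x ^ n)"
proof (rule summable_comparison_test[OF _ summable_mult[OF summable_geometric, of "\<bar>x\<bar>" C]])
  show "\<exists>N. \<forall>n\<ge>N. norm (a n * x ^ n) \<le> C * \<bar>x\<bar> ^ n" 
    using assms by (auto simp: abs_mult power_abs intro!: mult_right_mono)
qed (use assms in auto)

lemma DERIV_bounded_powser:
  fixes a :: "nat \<Rightarrow> real"
  assumes "\<And>n. \<bar>a n\<bar> \<le> C" "\<bar>x\<bar> < 1"
  shows "((\<lambda>x. \<Sum>n. a n * x ^ n) has_field_derivative (\<Sum>n. diffs a n * x ^ n)) (at x)"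
proof -
  obtain K where K: "\<bar>x\<bar> < K" "K < 1" using dense assms by blast
  show ?thesis
    by (rule termdiffs_strong[of _ K]) (use K in \<open>auto intro!: summable_bounded_powser[OF assms(1)]\<close>)
qed

lemma cbQ_altdef:
  assumes "\<bar>m\<bar> < 1"
  shows "cbQ m = (\<Sum>n. (real n * cbsq n - real (n - 1) * cbsq (n - 1)) * m ^ n)"
proof -
  let ?a = "\<lambda>n. real n * cbsq n"
  have b: "\<bar>?a n\<bar> \<le> 1" for n using n_cbsq_le[of n] cbsq_pos[of n] by simp
  have s: "summable (\<lambda>n. ?a n * m ^ n)" by (rule summable_bounded_powser[OF b assms])
  have s2: "(\<lambda>n. ?a n * m ^ Suc n) sums ((\<Sum>n. ?a n * m ^ n) * m)"
    using sums_mult2[OF summable_sums[OF s], of m] by (simp add: mult_ac)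
  \<comment> \<open>At n = 0 the truncated n - 1 gives \<open>?a 0\<close>, which is 0, so the
    shifted series starts with a zero term.\<close>
  have s3: "(\<lambda>n. ?a (n - 1) * m ^ n) sums ((\<Sum>n. ?a n * m ^ n) * m)"
    using sums_Suc[where f = "\<lambda>n. ?a (n - 1) * m ^ n" and l = "(\<Sum>n. ?a n * m ^ n) * m"] s2 by simp
  have "(\<lambda>n. ?a n * m ^ n - ?a (n - 1) * m ^ n) sums ((\<Sum>n. ?a n * m ^ n) - (\<Sum>n. ?a n * m ^ n) * m)"
    by (intro sums_diff s3 summable_sums s)
  thus ?thesis unfolding cbQ_def by (simp add: sums_iff algebra_simps)
qed

lemma DERIV_cbQ:
  assumes "\<bar>m\<bar> < 1"
  shows "(cbQ has_field_derivative cbP m / 4) (at m)"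
proof -
  let ?d = "\<lambda>n. real n * cbsq n - real (n - 1) * cbsq (n - 1)"
  have b: "\<bar>?d n\<bar> \<le> 1" for n 
    using n_cbsq_le[of n] cbsq_pos[of n] n_cbsq_le[of "n-1"] cbsq_pos[of "n-1"]
    by (smt (verit, ccfv_threshold) mult_nonneg_nonneg of_nat_0_le_iff)
  have d: "diffs ?d = (\<lambda>n. cbsq n / 4)"
    unfolding diffs_def using n_cbsq_Suc_minus by auto
  have "((\<lambda>m. \<Sum>n. ?d n * m ^ n) has_field_derivative (\<Sum>n. cbsq n / 4 * m ^ n)) (at m)"
    using DERIV_bounded_powser[of ?d 1, OF b assms] unfolding d .
  also have "(\<Sum>n. cbsq n / 4 * m ^ n) = cbP m / 4"
    unfolding cbP_def using suminf_divide[OF summable_bounded_powser[of cbsq 1 m], of 4] assms cbsq_le_1 cbsq_pos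
    by (simp add: less_imp_le)
  finally have "((\<lambda>m. \<Sum>n. ?d n * m ^ n) has_field_derivative cbP m / 4) (at m)" .
  thus ?thesis
    by (rule DERIV_cong_ev[THEN iffD1, rotated 3])
       (use assms cbQ_altdef in \<open>auto intro!: eventually_nhds_in_open[THEN eventually_mono, of "{-1<..<1}"]\<close>)
qed

text \<open>The product form is kept because m (1 - m) vanishes at m = 0, where differentiability is
  still wanted.\<close>

lemma DERIV_cbP:
  assumes "\<bar>m\<bar> < 1"
  shows "\<exists>D. (cbP has_field_derivative D) (at m) \<and> m * (1 - m) * D = cbQ m"
proof (intro exI conjI)
  have b: "\<bar>cbsq n\<bar> \<le> 1" for n using cbsq_pos[of n] cbsq_le_1[of n] by simp
  show "(cbP has_field_derivative (\<Sum>n. diffs cbsq n * m ^ n)) (at m)"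
    unfolding cbP_def using DERIV_bounded_powser[OF b assms] .
  have "summable (\<lambda>n. diffs cbsq n * m ^ n)"
  proof -
    obtain K where K: "\<bar>m\<bar> < K" "K < 1" using dense assms by blast
    show ?thesis
      by (rule termdiff_converges[of _ K]) (use K in \<open>auto intro!: summable_bounded_powser[OF b]\<close>)
  qed
  hence "(\<lambda>n. m * (diffs cbsq n * m ^ n)) sums (m * (\<Sum>n. diffs cbsq n * m ^ n))"
    by (intro sums_mult summable_sums)
  hence "(\<lambda>n. (real (Suc n) * cbsq (Suc n)) * m ^ Suc n) sums (m * (\<Sum>n. diffs cbsq n * m ^ n))"
    by (simp add: diffs_def mult_ac)
  hence "(\<lambda>n. (real n * cbsq n) * m ^ n) sums (m * (\<Sum>n. diffs cbsq n * m ^ n))"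
    by (subst (asm) sums_Suc_iff) simp
  thus "m * (1 - m) * (\<Sum>n. diffs cbsq n * m ^ n) = cbQ m"
    unfolding cbQ_def by (simp add: sums_iff)
qed

lemma cbP_0 [simp]: "cbP 0 = 1" and cbQ_0 [simp]: "cbQ 0 = 0"
  unfolding cbP_def cbQ_def by (subst powser_zero, simp)+

lemma cbP_pos:
  assumes "0 \<le> m" "m < 1" shows "cbP m > 0"
proof -
  have "summable (\<lambda>n. cbsq n * m ^ n)" 
    by (rule summable_bounded_powser[of _ 1]) (use assms cbsq_le_1 cbsq_pos in \<open>auto simp: less_imp_le\<close>)
  hence "(\<Sum>n. cbsq n * m ^ n) \<ge> (\<Sum>n<1. cbsq n * m ^ n)"
    by (intro sum_le_suminf) (use assms cbsq_pos in \<open>auto simp: less_imp_le\<close>)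
  thus ?thesis by (simp add: cbP_def)
qed

section \<open>The Legendre function in the variable s = 1 - 2m\<close>

definition legH :: "real \<Rightarrow> real" where "legH s = cbP ((1 - s) / 2)"
text \<open>The flux (1 - s^2) H'(s): for m = (1 - s)/2 one has 1 - s^2 = 4 m (1 - m) and d/ds =
  -(1/2) d/dm, hence the factor -2.\<close>

definition legK :: "real \<Rightarrow> real" where "legK s = - 2 * cbQ ((1 - s) / 2)"

lemma legH_1 [simp]: "legH 1 = 1" and legK_1 [simp]: "legK 1 = 0"
  by (simp_all add: legH_def legK_def)

lemma legH_pos: "-1 < s \<Longrightarrow> s \<le> 1 \<Longrightarrow> legH s > 0"
  unfolding legH_def by (rule cbP_pos) auto

lemma DERIV_legK:
  assumes "-1 < s" "s < 3"
  shows "(legK has_field_derivative legH s / 4) (at s)"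
proof -
  have "\<bar>(1 - s) / 2\<bar> < 1" using assms by auto
  from DERIV_cbQ[OF this] show ?thesis unfolding legK_def legH_def
    by (auto intro!: derivative_eq_intros DERIV_chain2[of cbQ])
qed

text \<open>The range up to 3 is |m| < 1; it makes the singular point s = 1 an interior point, which
  yields continuity of H and its flux there.\<close>

lemma DERIV_legH_ex:
  assumes "-1 < s" "s < 3"
  shows "\<exists>D. (legH has_field_derivative D) (at s) \<and> (1 - s\<^sup>2) * D = legK s"
proof -
  have "\<bar>(1 - s) / 2\<bar> < 1" using assms by auto
  from DERIV_cbP[OF this] obtain D where D: "(cbP has_field_derivative D) (at ((1 - s) / 2))"
    "(1 - s) / 2 * (1 - (1 - s) / 2) * D = cbQ ((1 - s) / 2)" by auto
  have "(legH has_field_derivative (D * (-1/2))) (at s)" unfolding legH_def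
    by (rule DERIV_chain2[where f = cbP and g = "\<lambda>s. (1 - s) / 2", OF D(1)]) (auto intro!: derivative_eq_intros)
  moreover have "(1 - s\<^sup>2) * (D * (-1/2)) = legK s"
    unfolding legK_def D(2)[symmetric] by (simp add: field_simps power2_eq_square)
  ultimately show ?thesis by blast
qed

lemma DERIV_legH:
  assumes "-1 < s" "s < 1"
  shows "(legH has_field_derivative legK s / (1 - s\<^sup>2)) (at s)"
proof -
  obtain D where D: "(legH has_field_derivative D) (at s)" "(1 - s\<^sup>2) * D = legK s"
    using DERIV_legH_ex[of s] assms by auto
  have "1 - s\<^sup>2 \<noteq> 0" using assms by (auto simp: power2_eq_1_iff)
  hence "D = legK s / (1 - s\<^sup>2)" using D(2) by (simp add: field_simps)
  thus ?thesis using D by simp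
qed

lemma isCont_legH: "-1 < s \<Longrightarrow> s < 3 \<Longrightarrow> isCont legH s"
  using DERIV_legH_ex[of s] DERIV_isCont by blast

lemma isCont_legK: "-1 < s \<Longrightarrow> s < 3 \<Longrightarrow> isCont legK s"
  using DERIV_legK[of s] DERIV_isCont by blast

text \<open>The left side is, up to sign, the Wronskian of the solutions H(s) and H(-s) times 1 -
  s^2, hence constant. Its value is the limit as s tends to 1, taken with s = 2x - 1.\<close>

lemma Legendre_relation:
  assumes "-1 < s" "s < 1"
  shows "legH s * legK (-s) + legK s * legH (-s) = - 2 / pi"
proof -
  define W where "W = (\<lambda>s. legH s * legK (-s) + legK s * legH (-s))"
  have dW: "(W has_field_derivative 0) (at s)" if "-1 < s" "s < 1" for s
  proof -
    have nz: "1 - s\<^sup>2 \<noteq> 0" using that by (auto simp: power2_eq_1_iff)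
    have [derivative_intros]: "((\<lambda>s. legK (-s)) has_field_derivative legH (-s) / 4 * (-1)) (at s)"
      by (rule DERIV_chain2[OF DERIV_legK]) (use that in \<open>auto intro!: derivative_eq_intros\<close>)
    have [derivative_intros]: "((\<lambda>s. legH (-s)) has_field_derivative legK (-s) / (1 - (-s)\<^sup>2) * (-1)) (at s)"
      by (rule DERIV_chain2[OF DERIV_legH]) (use that in \<open>auto intro!: derivative_eq_intros\<close>)
    note [derivative_intros] = DERIV_legH[OF that] DERIV_legK[of s]
    show ?thesis unfolding W_def
      by (rule derivative_eq_intros refl | use that in simp)+ 
  qed
  have const: "W t = W s" if "-1 < t" "t < 1" for t
  proof (rule DERIV_isconst3[where f = W and a = "-1" and b = 1])
    fix x :: real assume "x \<in> {-1<..<1}" thus "(W has_real_derivative 0) (at x)" using dW by auto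
  qed (use assms that in auto)
  have sub: "filterlim (\<lambda>x. 1 - x) (at_right 0) (at_left (1::real))"
    by real_asymp
  have sub': "filterlim (\<lambda>x. 1 - x) (nhds 0) (at_left (1::real))"
    using filterlim_mono[OF sub, of "nhds 0" "at_left 1"] at_within_le_nhds by blast
  have "isCont cbP 0" "isCont cbQ 0"
    using DERIV_cbP[of 0] DERIV_cbQ[of 0] DERIV_isCont by auto
  hence P0: "((\<lambda>x. cbP (1 - x)) \<longlongrightarrow> 1) (at_left 1)"
    using isCont_tendsto_compose[of 0 cbP "\<lambda>x. 1 - x"] sub' by auto
  obtain D where D: "(cbP has_field_derivative D) (at 0)" using DERIV_cbP[of 0] by auto
  have "((\<lambda>m. cbQ m / m) \<longlongrightarrow> 1 / 4) (at 0)"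
    using DERIV_cbQ[of 0] by (simp add: has_field_derivative_iff)
  hence "((\<lambda>x. cbQ (1 - x) / (1 - x)) \<longlongrightarrow> 1 / 4) (at_left 1)"
    by (rule filterlim_compose) (rule filterlim_mono[OF sub], auto simp: at_le)
  \<comment> \<open>H(-s) is unbounded as s tends to 1. Its coefficients tend to 0, so it grows more
    slowly than 1/(1 - x) and the simple zero of \<open>cbQ\<close> at 0 kills the product K(s)
    H(-s).\<close>
  moreover have "((\<lambda>x. (1 - x) * cbP x) \<longlongrightarrow> 0) (at_left 1)"
    unfolding cbP_def by (rule Abel_mean_tendsto[OF tendsto_cbsq])
  ultimately have "((\<lambda>x. cbQ (1 - x) / (1 - x) * ((1 - x) * cbP x)) \<longlongrightarrow> 1 / 4 * 0) (at_left 1)"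
    by (rule tendsto_mult)
  moreover have "((\<lambda>x. cbP (1 - x) * cbQ x) \<longlongrightarrow> 1 * (1 / pi)) (at_left 1)"
    unfolding cbQ_def by (intro tendsto_mult P0 Abel_mean_tendsto[OF tendsto_n_cbsq])
  ultimately have "((\<lambda>x. -2 * (cbP (1 - x) * cbQ x) + -2 * (cbQ (1 - x) / (1 - x) * ((1 - x) * cbP x))) 
      \<longlongrightarrow> -2 * (1 * (1 / pi)) + -2 * (1 / 4 * 0)) (at_left 1)"
    by (intro tendsto_add tendsto_mult_left)
  moreover have "eventually (\<lambda>x. -2 * (cbP (1 - x) * cbQ x) + -2 * (cbQ (1 - x) / (1 - x) * ((1 - x) * cbP x)) = W s) (at_left 1)"
  proof (rule eventually_at_leftI[of 0])
    fix x :: real assume x: "x \<in> {0<..<1}"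
    have *: "(1 - (2 * x - 1)) / 2 = 1 - x" "(1 - - (2 * x - 1)) / 2 = x" by (simp_all add: field_simps)
    have "W s = W (2 * x - 1)" using const[of "2 * x - 1"] x by simp
    also have "\<dots> = -2 * (cbP (1 - x) * cbQ x) + -2 * (cbQ (1 - x) / (1 - x) * ((1 - x) * cbP x))"
      unfolding W_def legH_def legK_def * using x by (simp add: field_simps)
    finally show "-2 * (cbP (1 - x) * cbQ x) + -2 * (cbQ (1 - x) / (1 - x) * ((1 - x) * cbP x)) = W s" ..
  qed auto
  ultimately have "((\<lambda>x::real. W s) \<longlongrightarrow> -2 / pi) (at_left 1)"
    by (simp add: tendsto_cong)
  hence "W s = -2 / pi" 
    using tendsto_unique[of "at_left (1::real)" "\<lambda>x. W s" "W s" "- 2 / pi"] by (simp add: trivial_limit_at_left_real)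
  thus ?thesis by (simp add: W_def)
qed

section \<open>Modular transformations of degrees 3 and 5\<close>

text \<open>In the applications \<open>a\<close> vanishes at \<open>e\<close>, so only continuity is
  asked there. The Wronskian f G - F g is constant away from \<open>e\<close> and vanishes at
  \<open>e\<close> because both fluxes do; hence it is zero and g / f is constant.\<close>

lemma flux_unique:
  fixes f F g G a b :: "real \<Rightarrow> real"
  assumes S: "convex S" "e \<in> S" "x \<in> S"
    and cont: "continuous_on S f" "continuous_on S F" "continuous_on S g" "continuous_on S G"
    and f: "\<And>x. x \<in> S - {e} \<Longrightarrow> (f has_real_derivative F x / a x) (at x)"
    and F: "\<And>x. x \<in> S - {e} \<Longrightarrow> (F has_real_derivative b x * f x) (at x)"
    and g: "\<And>x. x \<in> S - {e} \<Longrightarrow> (g has_real_derivative G x / a x) (at x)"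
    and G: "\<And>x. x \<in> S - {e} \<Longrightarrow> (G has_real_derivative b x * g x) (at x)"
    and e: "F e = 0" "G e = 0" and nz: "\<And>x. x \<in> S \<Longrightarrow> f x \<noteq> 0"
  shows "g x = g e / f e * f x" "G x = g e / f e * F x"
proof -
  define W where "W = (\<lambda>x. f x * G x - F x * g x)"
  have W: "W x = 0" if "x \<in> S" for x
  proof (rule has_derivative_zero_unique_strong_convex[OF S(1), of "{e}" W])
    fix x assume x: "x \<in> S - {e}"
    have "(W has_real_derivative 0) (at x)"
      unfolding W_def by (rule derivative_eq_intros f[OF x] F[OF x] g[OF x] G[OF x] refl)+ simp
    thus "(W has_derivative (\<lambda>h. 0)) (at x within S)"
      by (simp add: has_field_derivative_def has_derivative_at_withinI lambda_zero)
  qed (use S that e in \<open>auto simp: W_def intro!: continuous_intros cont\<close>)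
  have "g x / f x = g e / f e"
  proof (rule has_derivative_zero_unique_strong_convex[OF S(1), of "{e}" "\<lambda>x. g x / f x"])
    fix x assume x: "x \<in> S - {e}"
    have "((\<lambda>x. g x / f x) has_real_derivative 0) (at x)"
      by (rule derivative_eq_intros f[OF x] g[OF x] refl)+ 
         (use nz[of x] W[of x] x in \<open>auto simp: W_def mult_ac diff_divide_distrib[symmetric]\<close>)
    thus "((\<lambda>x. g x / f x) has_derivative (\<lambda>h. 0)) (at x within S)"
      by (simp add: has_field_derivative_def has_derivative_at_withinI lambda_zero)
  qed (use S nz in \<open>auto intro!: continuous_intros cont\<close>)
  thus *: "g x = g e / f e * f x" using nz[OF S(3)] by (simp add: field_simps)
  have "f x * G x = F x * g x" using W[OF S(3)] by (simp add: W_def)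
  hence "f x * G x = f x * (g e / f e * F x)" unfolding * by (simp add: mult_ac)
  thus "G x = g e / f e * F x" using nz[OF S(3)] by (metis mult_left_cancel)
qed

text \<open>Both sides solve one system in the parameter x, with s = t = 1 at \<open>e\<close>. Here
  \<open>a\<close> is (1 - s^2)/s', assumption \<open>1\<close> is the relation \<mu>^2 dt/(1 - t^2)
  = c ds/(1 - s^2) between multiplier and degree c, and assumption \<open>2\<close> is what makes
  the flux of the right side satisfy the second equation of the system.\<close>

lemma legH_transformation:
  fixes s t \<mu> \<nu> s' t' \<mu>' \<nu>' a :: "real \<Rightarrow> real"
  assumes S: "convex S" "e \<in> S" "x \<in> S"
    and cont: "continuous_on S s" "continuous_on S t" "continuous_on S \<mu>" "continuous_on S \<nu>"
    and e: "s e = 1" "t e = 1" "\<mu> e = 1" "\<nu> e = 0"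
    and bd: "\<And>x. x \<in> S - {e} \<Longrightarrow> \<bar>s x\<bar> < 1" "\<And>x. x \<in> S - {e} \<Longrightarrow> \<bar>t x\<bar> < 1"
    and s: "\<And>x. x \<in> S - {e} \<Longrightarrow> (s has_real_derivative s' x) (at x)"
    and t: "\<And>x. x \<in> S - {e} \<Longrightarrow> (t has_real_derivative t' x) (at x)"
    and \<mu>: "\<And>x. x \<in> S - {e} \<Longrightarrow> (\<mu> has_real_derivative \<mu>' x) (at x)"
    and \<nu>: "\<And>x. x \<in> S - {e} \<Longrightarrow> (\<nu> has_real_derivative \<nu>' x) (at x)"
    and nz: "\<And>x. x \<in> S \<Longrightarrow> \<mu> x \<noteq> 0" 
    and a: "\<And>x. x \<in> S - {e} \<Longrightarrow> s' x * a x = 1 - (s x)\<^sup>2"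
    and \<nu>_eq: "\<And>x. x \<in> S - {e} \<Longrightarrow> \<nu> x = a x * \<mu>' x"
    and 1: "\<And>x. x \<in> S - {e} \<Longrightarrow> t' x * a x * (\<mu> x)\<^sup>2 = c * (1 - (t x)\<^sup>2)"
    and 2: "\<And>x. x \<in> S - {e} \<Longrightarrow> 4 * \<mu> x * \<nu>' x = s' x * (\<mu> x)\<^sup>2 - c * t' x"
  shows "legH (s x) = \<mu> x * legH (t x) \<and> legK (s x) = \<nu> x * legH (t x) + c / \<mu> x * legK (t x)"
proof -
  define f F g G where "f = (\<lambda>x. legH (s x))" and "F = (\<lambda>x. legK (s x))" 
    and "g = (\<lambda>x. \<mu> x * legH (t x))" and "G = (\<lambda>x. \<nu> x * legH (t x) + c / \<mu> x * legK (t x))"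
  have bd': "s x > -1" "s x \<le> 1" "t x > -1" "t x \<le> 1" if "x \<in> S" for x
    using bd[of x] that e by (cases "x = e"; force)+
  have cHK: "continuous_on {-1<..1} legH" "continuous_on {-1<..1} legK"
    by (auto intro!: continuous_at_imp_continuous_on isCont_legH isCont_legK)
  have c4: "continuous_on S (\<lambda>x. legH (s x))" "continuous_on S (\<lambda>x. legH (t x))"
      "continuous_on S (\<lambda>x. legK (s x))" "continuous_on S (\<lambda>x. legK (t x))"
    by (rule continuous_on_compose2[OF cHK(1)] continuous_on_compose2[OF cHK(2)]; 
        use bd' cont in auto)+
  have main: "(f has_real_derivative F x / a x) (at x)" "(F has_real_derivative (s' x / 4) * f x) (at x)"
    "(g has_real_derivative G x / a x) (at x)" "(G has_real_derivative (s' x / 4) * g x) (at x)"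
    if x: "x \<in> S - {e}" for x
  proof -
    have b: "-1 < s x" "s x < 1" "-1 < t x" "t x < 1" using bd[OF x] by auto
    have nzs: "1 - (s x)\<^sup>2 \<noteq> 0" "1 - (t x)\<^sup>2 \<noteq> 0" using b by (auto simp: power2_eq_1_iff)
    have a0: "a x \<noteq> 0" "s' x \<noteq> 0" using a[OF x] nzs by auto
    have m0: "\<mu> x \<noteq> 0" using nz x by auto
    have s'_eq: "s' x = (1 - (s x)\<^sup>2) / a x" using a[OF x] a0 by (simp add: field_simps)
    have t'_eq: "t' x = c * (1 - (t x)\<^sup>2) / (a x * (\<mu> x)\<^sup>2)" using 1[OF x] a0 m0 by (simp add: field_simps)
    have Hs: "((\<lambda>x. legH (s x)) has_real_derivative legK (s x) / (1 - (s x)\<^sup>2) * s' x) (at x)"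
      by (rule DERIV_chain2[OF DERIV_legH s[OF x]]) (use b in auto)
    have Ht: "((\<lambda>x. legH (t x)) has_real_derivative legK (t x) / (1 - (t x)\<^sup>2) * t' x) (at x)"
      by (rule DERIV_chain2[OF DERIV_legH t[OF x]]) (use b in auto)
    have Ks: "((\<lambda>x. legK (s x)) has_real_derivative legH (s x) / 4 * s' x) (at x)"
      by (rule DERIV_chain2[OF DERIV_legK s[OF x]]) (use b in auto)
    have Kt: "((\<lambda>x. legK (t x)) has_real_derivative legH (t x) / 4 * t' x) (at x)"
      by (rule DERIV_chain2[OF DERIV_legK t[OF x]]) (use b in auto)
    show "(f has_real_derivative F x / a x) (at x)"
      using Hs nzs unfolding f_def F_def s'_eq by simp
    show "(F has_real_derivative (s' x / 4) * f x) (at x)"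
      using Ks unfolding f_def F_def by (simp add: mult_ac)
    have H': "legK (t x) / (1 - (t x)\<^sup>2) * t' x = c * legK (t x) / (a x * (\<mu> x)\<^sup>2)"
      unfolding t'_eq using nzs by simp
    show "(g has_real_derivative G x / a x) (at x)"
      unfolding g_def G_def \<nu>_eq[OF x]
      by (rule derivative_eq_intros \<mu>[OF x] Ht refl)+ 
         (unfold H', use a0 m0 in \<open>simp add: field_simps power2_eq_square\<close>)
    have \<nu>': "\<nu>' x = (s' x * (\<mu> x)\<^sup>2 - c * t' x) / (4 * \<mu> x)" using 2[OF x] m0 by (simp add: field_simps)
    show "(G has_real_derivative (s' x / 4) * g x) (at x)"
      unfolding g_def G_def
      by (rule derivative_eq_intros \<mu>[OF x] \<nu>[OF x] Ht Kt refl m0)+ 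
         (unfold H' \<nu>' \<nu>_eq[OF x], use a0 m0 in \<open>simp add: field_simps power2_eq_square\<close>)
  qed
  have cont': "continuous_on S f" "continuous_on S F" "continuous_on S g" "continuous_on S G"
    unfolding f_def F_def g_def G_def using nz by (auto intro!: continuous_intros c4 cont)
  have e': "F e = 0" "G e = 0" "f e = 1" "g e = 1" by (simp_all add: f_def F_def g_def G_def e)
  have pos: "f x \<noteq> 0" if "x \<in> S" for x using legH_pos[of "s x"] bd'[OF that] by (simp add: f_def)
  have "g x = g e / f e * f x" "G x = g e / f e * F x"
    by (rule flux_unique[OF S cont' main e'(1,2) pos]; assumption)+
  thus ?thesis using e' by (auto simp: f_def F_def g_def G_def)
qed

lemma abs_less_1_of_square: "1 - s\<^sup>2 > 0 \<Longrightarrow> \<bar>s\<bar> < (1::real)"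
  by (simp add: abs_square_less_1)

text \<open>\<open>k\<close> parametrises the pairs (s, t) rationally: k = 3 is the common singular
  point s = t = 1, and k tending to 1 gives s = t = -1. Since k -> 3/k turns s into -t, applying the
  formula at both parameters shows that t has three times the K'/K of s.\<close>

lemma cubic_transformation:
  fixes k :: real
  assumes "1 < k" "k \<le> 3"
  defines "s \<equiv> (k^4 - 6*k\<^sup>2 - 3) / (8*k)" and "t \<equiv> (k^4 + 18*k\<^sup>2 - 27) / (8*k^3)"
  shows "legH s = 3 / k * legH t"
    and "legK s = - ((9 - k\<^sup>2) * (k\<^sup>2 - 1) / (8*k\<^sup>2)) * legH t + k * legK t"
proof -
  let ?s = "\<lambda>k::real. (k^4 - 6*k\<^sup>2 - 3) / (8*k)" and ?t = "\<lambda>k::real. (k^4 + 18*k\<^sup>2 - 27) / (8*k^3)"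
  let ?s' = "\<lambda>k::real. 3 * (k\<^sup>2 - 1)\<^sup>2 / (8*k\<^sup>2)" and ?t' = "\<lambda>k::real. (k\<^sup>2 - 9)\<^sup>2 / (8*k^4)"
  let ?nu = "\<lambda>k::real. - ((9 - k\<^sup>2) * (k\<^sup>2 - 1) / (8*k\<^sup>2))"
  let ?nu' = "\<lambda>k::real. (k^4 - 9) / (4*k^3)"
  let ?a = "\<lambda>k::real. (9 - k\<^sup>2) * (k\<^sup>2 - 1) / 24"
  have s1: "1 - (?s k)\<^sup>2 = (9 - k\<^sup>2) * (k\<^sup>2 - 1)^3 / (64 * k\<^sup>2)" 
   and t1: "1 - (?t k)\<^sup>2 = (k\<^sup>2 - 1) * (9 - k\<^sup>2)^3 / (64 * k^6)" if "k > 1" for k :: real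
    using that by (simp add: divide_simps; simp add: algebra_simps eval_nat_numeral)+
  have pos: "9 - k\<^sup>2 > 0" "k\<^sup>2 - 1 > 0" if "k \<in> {1<..3} - {3}" for k :: real
    using that power_strict_mono[of k 3 2] by (auto simp: one_less_power)
  have k0: "k \<noteq> 0" "k > 0" if "k \<in> {1<..3} - {3}" for k :: real using that by auto
  have ds: "(?s has_real_derivative ?s' k) (at k)" if "k > 1" for k
  proof -
    have "(?s has_real_derivative ((4 * k^3 - 12 * k) * (8*k) - (k^4 - 6*k\<^sup>2 - 3) * 8) / ((8*k)*(8*k))) (at k)"
      by (rule derivative_eq_intros refl)+ (use that in \<open>auto simp: eval_nat_numeral\<close>)
    also have "((4 * k^3 - 12 * k) * (8*k) - (k^4 - 6*k\<^sup>2 - 3) * 8) / ((8*k)*(8*k)) = ?s' k"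
      using that by (simp add: divide_simps) (simp add: algebra_simps eval_nat_numeral)
    finally show ?thesis .
  qed
  have dt: "(?t has_real_derivative ?t' k) (at k)" if "k > 1" for k
  proof -
    have "(?t has_real_derivative ((4 * k^3 + 36 * k) * (8*k^3) - (k^4 + 18*k\<^sup>2 - 27) * (24 * k\<^sup>2)) / ((8*k^3)*(8*k^3))) (at k)"
      by (rule derivative_eq_intros refl)+ (use that in \<open>auto simp: eval_nat_numeral\<close>)
    also have "((4 * k^3 + 36 * k) * (8*k^3) - (k^4 + 18*k\<^sup>2 - 27) * (24 * k\<^sup>2)) / ((8*k^3)*(8*k^3)) = ?t' k"
      using that by (simp add: divide_simps) (simp add: algebra_simps eval_nat_numeral)
    finally show ?thesis .
  qed
  have dm: "((\<lambda>k. 3 / k) has_real_derivative -3/k\<^sup>2) (at k)" if "k > 1" for k :: real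
    by (rule derivative_eq_intros refl)+ (use that in \<open>auto simp: eval_nat_numeral\<close>)
  have dn: "(?nu has_real_derivative ?nu' k) (at k)" if "k > 1" for k
  proof -
    have "(?nu has_real_derivative - ((((9 - k\<^sup>2) * (2 * k) - 2 * k * (k\<^sup>2 - 1)) * (8 * k\<^sup>2) - (9 - k\<^sup>2) * (k\<^sup>2 - 1) * (16 * k)) / ((8 * k\<^sup>2) * (8 * k\<^sup>2)))) (at k)"
      by (rule derivative_eq_intros refl)+ (use that in \<open>auto simp: eval_nat_numeral\<close>)
    also have "- ((((9 - k\<^sup>2) * (2 * k) - 2 * k * (k\<^sup>2 - 1)) * (8 * k\<^sup>2) - (9 - k\<^sup>2) * (k\<^sup>2 - 1) * (16 * k)) / ((8 * k\<^sup>2) * (8 * k\<^sup>2))) = ?nu' k"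
      using that by (simp add: divide_simps) (simp add: algebra_simps eval_nat_numeral)
    finally show ?thesis .
  qed
  have "legH (?s k) = 3 / k * legH (?t k) \<and> legK (?s k) = ?nu k * legH (?t k) + 3 / (3 / k) * legK (?t k)"
  proof (rule legH_transformation[where S = "{1<..3}" and e = 3 and s = ?s and t = ?t 
      and \<mu> = "\<lambda>k. 3 / k" and \<nu> = ?nu and a = ?a and s' = ?s' and t' = ?t' and \<nu>' = ?nu' and \<mu>' = "\<lambda>k. -3/k\<^sup>2" and c = 3 and x = k])
    fix k :: real assume k: "k \<in> {1<..3} - {3}"
    note nz = k0[OF k] pos[OF k]
    have k1: "k > 1" using k by simp
    show "\<bar>?s k\<bar> < 1" by (rule abs_less_1_of_square, subst s1[OF k1]) (use nz in simp)
    show "\<bar>?t k\<bar> < 1" by (rule abs_less_1_of_square, subst t1[OF k1]) (use nz in simp)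
    show "(?s has_real_derivative ?s' k) (at k)" "(?t has_real_derivative ?t' k) (at k)"
      "((\<lambda>k. 3 / k) has_real_derivative -3/k\<^sup>2) (at k)" "(?nu has_real_derivative ?nu' k) (at k)"
      by (rule ds dt dm dn; fact)+
    show "?s' k * ?a k = 1 - (?s k)\<^sup>2" 
      unfolding s1[OF k1] using k1 by (simp add: divide_simps) (simp add: algebra_simps eval_nat_numeral)
    show "?nu k = ?a k * (-3/k\<^sup>2)" using k1 by (simp add: divide_simps)
    show "?t' k * ?a k * (3 / k)\<^sup>2 = 3 * (1 - (?t k)\<^sup>2)" 
      unfolding t1[OF k1] using k1 by (simp add: divide_simps) (simp add: algebra_simps eval_nat_numeral)
    show "4 * (3 / k) * ?nu' k = ?s' k * (3 / k)\<^sup>2 - 3 * ?t' k"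
      using k1 by (simp add: divide_simps) (simp add: algebra_simps eval_nat_numeral)
  qed (use assms in \<open>auto intro!: continuous_intros\<close>)
  thus "legH s = 3 / k * legH t"
    and "legK s = - ((9 - k\<^sup>2) * (k\<^sup>2 - 1) / (8*k\<^sup>2)) * legH t + k * legK t"
    by (simp_all add: s_def t_def)
qed

text \<open>The singular point is k = 5. Only s^2 and t^2 are rational in k, whence the radicals.
  The substitution k -> 5/k turns s into -t, so at k = sqrt 5 the formula compares H(-t) with
  H(t).\<close>

lemma quintic_transformation:
  fixes k :: real
  assumes "1 < k" "k \<le> 5"
  defines "s \<equiv> (k\<^sup>2 - 4*k - 1) * sqrt (k\<^sup>2 - 2*k + 5) / (8 * sqrt k)" 
    and "t \<equiv> (k\<^sup>2 + 20*k - 25) * sqrt (k\<^sup>2 - 2*k + 5) / (8 * k\<^sup>2 * sqrt k)"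
  shows "legH s = 5 / k * legH t"
    and "legK s = - ((5 - k) * (k - 1) * sqrt k * sqrt (k\<^sup>2 - 2*k + 5) / (4 * k\<^sup>2)) * legH t + k * legK t"
proof -
  let ?q = "\<lambda>k::real. sqrt (k\<^sup>2 - 2*k + 5)"
  let ?s = "\<lambda>k::real. (k\<^sup>2 - 4*k - 1) * ?q k / (8 * sqrt k)"
  let ?t = "\<lambda>k::real. (k\<^sup>2 + 20*k - 25) * ?q k / (8 * k\<^sup>2 * sqrt k)"
  let ?s' = "\<lambda>k::real. 5 * (k - 1)^4 / (16 * k * sqrt k * ?q k)" 
  let ?t' = "\<lambda>k::real. (5 - k)^4 / (16 * k^3 * sqrt k * ?q k)"
  let ?nu = "\<lambda>k::real. - ((5 - k) * (k - 1) * sqrt k * ?q k / (4 * k\<^sup>2))"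
  let ?nu' = "\<lambda>k::real. (k\<^sup>2 - 5) * (3*k\<^sup>2 - 10*k + 15) / (8 * k\<^sup>2 * sqrt k * ?q k)"
  let ?a = "\<lambda>k::real. (5 - k) * (k - 1) * sqrt k * ?q k / 20"
  have epos: "k\<^sup>2 - 2*k + 5 > 0" for k :: real 
    using zero_le_power2[of "k - 1"] by (simp add: power2_eq_square algebra_simps)
  have q2: "?q k * ?q k = k\<^sup>2 - 2*k + 5" "?q k > 0" for k using epos[of k] by simp_all
  have w2: "sqrt k * sqrt k = k" "sqrt k > 0" if "k > 1" for k :: real using that by simp_all
  have Dq: "(?q has_real_derivative (k - 1) / ?q k) (at k)" for k
  proof -
    have "(?q has_real_derivative inverse (?q k) / 2 * (2 * k - 2)) (at k)"
      by (rule DERIV_chain2[where f = sqrt and g = "\<lambda>k. k\<^sup>2 - 2*k + 5", OF DERIV_real_sqrt[OF epos]]) (auto intro!: derivative_eq_intros)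
    also have "inverse (?q k) / 2 * (2 * k - 2) = (k - 1) / ?q k"
      using q2(2)[of k] by (simp add: field_simps)
    finally show ?thesis .
  qed
  have Dw: "(sqrt has_real_derivative 1 / (2 * sqrt k)) (at k)" if "k > 1" for k
    using DERIV_real_sqrt[of k] that by (simp add: inverse_eq_divide mult.commute)
  have s1: "1 - (?s k)\<^sup>2 = (5 - k) * (k - 1)^5 / (64 * k)" if "k > 1" for k
  proof -
    have *: "(?s k)\<^sup>2 = (k\<^sup>2 - 4*k - 1)\<^sup>2 * (k\<^sup>2 - 2*k + 5) / (64 * k)"
    proof -
      have gen: "(a * q / (8 * w))\<^sup>2 = a\<^sup>2 * (q * q) / (64 * (w * w))" for a q w :: real
        by (simp add: power2_eq_square)
      show ?thesis unfolding gen q2(1) w2(1)[OF that] ..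
    qed
    show ?thesis unfolding * using that by (simp add: divide_simps; simp add: algebra_simps eval_nat_numeral)
  qed
  have t1: "1 - (?t k)\<^sup>2 = (k - 1) * (5 - k)^5 / (64 * k^5)" if "k > 1" for k
  proof -
    have *: "(?t k)\<^sup>2 = (k\<^sup>2 + 20*k - 25)\<^sup>2 * (k\<^sup>2 - 2*k + 5) / (64 * k^5)"
    proof -
      have gen: "(a * q / (8 * k\<^sup>2 * w))\<^sup>2 = a\<^sup>2 * (q * q) / (64 * k^4 * (w * w))" for a q w :: real
        by (simp add: eval_nat_numeral mult_ac)
      show ?thesis unfolding gen q2(1) w2(1)[OF that] by (simp add: eval_nat_numeral)
    qed
    show ?thesis unfolding * using that by (simp add: divide_simps; simp add: algebra_simps eval_nat_numeral)
  qed
  have ds: "(?s has_real_derivative ?s' k) (at k)" if "k > 1" for k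
  proof -
    \<comment> \<open>With the radicals named, \<open>q * q\<close> and \<open>k = w * w\<close>
      eliminate them, and what remains is a polynomial identity in k.\<close>
    define q w where "q = ?q k" and "w = sqrt k"
    have qw: "q * q = k\<^sup>2 - 2*k + 5" "k = w * w" "q > 0" "w > 0" using q2[of k] w2[OF that] by (simp_all add: q_def w_def)
    have "(?s has_real_derivative (((2*k - 4) * q + (k\<^sup>2 - 4*k - 1) * ((k - 1) / q)) * (8 * w) - (k\<^sup>2 - 4*k - 1) * q * (8 * (1 / (2 * w)))) / ((8 * w) * (8 * w))) (at k)"
      unfolding q_def w_def
      by (rule derivative_eq_intros Dq Dw[OF that] refl)+ (use that in auto)
    also have "(((2*k - 4) * q + (k\<^sup>2 - 4*k - 1) * ((k - 1) / q)) * (8 * w) - (k\<^sup>2 - 4*k - 1) * q * (8 * (1 / (2 * w)))) / ((8 * w) * (8 * w))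
        = (2 * k * (2*k - 4) * (q * q) + 2 * k * (k\<^sup>2 - 4*k - 1) * (k - 1) - (k\<^sup>2 - 4*k - 1) * (q * q)) / (16 * k * w * q)"
      using qw(3,4) unfolding qw(2) by (simp add: divide_simps) (simp add: algebra_simps eval_nat_numeral)
    also have "2 * k * (2*k - 4) * (q * q) + 2 * k * (k\<^sup>2 - 4*k - 1) * (k - 1) - (k\<^sup>2 - 4*k - 1) * (q * q) = 5 * (k - 1)^4"
      unfolding qw(1) by (simp add: algebra_simps eval_nat_numeral)
    finally show ?thesis by (simp add: q_def w_def)
  qed
  have dt: "(?t has_real_derivative ?t' k) (at k)" if "k > 1" for k
  proof -
    define q w where "q = ?q k" and "w = sqrt k"
    have qw: "q * q = k\<^sup>2 - 2*k + 5" "k = w * w" "q > 0" "w > 0" using q2[of k] w2[OF that] by (simp_all add: q_def w_def)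
    have "(?t has_real_derivative (((2*k + 20) * q + (k\<^sup>2 + 20*k - 25) * ((k - 1) / q)) * (8 * k\<^sup>2 * w) 
         - (k\<^sup>2 + 20*k - 25) * q * (16 * k * w + 8 * k\<^sup>2 * (1 / (2 * w)))) / ((8 * k\<^sup>2 * w) * (8 * k\<^sup>2 * w))) (at k)"
      unfolding q_def w_def
      by (rule derivative_eq_intros Dq Dw[OF that] refl)+ (use that in auto)
    also have "(((2*k + 20) * q + (k\<^sup>2 + 20*k - 25) * ((k - 1) / q)) * (8 * k\<^sup>2 * w) 
         - (k\<^sup>2 + 20*k - 25) * q * (16 * k * w + 8 * k\<^sup>2 * (1 / (2 * w)))) / ((8 * k\<^sup>2 * w) * (8 * k\<^sup>2 * w))
        = (2 * k * (2*k + 20) * (q * q) + 2 * k * (k\<^sup>2 + 20*k - 25) * (k - 1) - 5 * (k\<^sup>2 + 20*k - 25) * (q * q)) / (16 * k^3 * w * q)"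
      using qw(3,4) unfolding qw(2) by (simp add: divide_simps) (simp add: algebra_simps eval_nat_numeral)
    also have "2 * k * (2*k + 20) * (q * q) + 2 * k * (k\<^sup>2 + 20*k - 25) * (k - 1) - 5 * (k\<^sup>2 + 20*k - 25) * (q * q) = (5 - k)^4"
      unfolding qw(1) by (simp add: algebra_simps eval_nat_numeral)
    finally show ?thesis by (simp add: q_def w_def)
  qed
  have dm: "((\<lambda>k. 5 / k) has_real_derivative -5/k\<^sup>2) (at k)" if "k > 1" for k :: real
    by (rule derivative_eq_intros refl)+ (use that in \<open>auto simp: eval_nat_numeral\<close>)
  have dn: "(?nu has_real_derivative ?nu' k) (at k)" if "k > 1" for k
  proof -
    define q w where "q = ?q k" and "w = sqrt k"
    have qw: "q * q = k\<^sup>2 - 2*k + 5" "k = w * w" "q > 0" "w > 0" using q2[of k] w2[OF that] by (simp_all add: q_def w_def)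
    have "(?nu has_real_derivative - (((((6 - 2 * k) * w + (5 - k) * (k - 1) * (1 / (2 * w))) * q + (5 - k) * (k - 1) * w * ((k - 1) / q)) * (4 * k\<^sup>2) 
         - (5 - k) * (k - 1) * w * q * (8 * k)) / ((4 * k\<^sup>2) * (4 * k\<^sup>2)))) (at k)"
      unfolding q_def w_def
      by (rule derivative_eq_intros Dq Dw[OF that] refl)+ (use that in auto)
    also have "- (((((6 - 2 * k) * w + (5 - k) * (k - 1) * (1 / (2 * w))) * q + (5 - k) * (k - 1) * w * ((k - 1) / q)) * (4 * k\<^sup>2) 
         - (5 - k) * (k - 1) * w * q * (8 * k)) / ((4 * k\<^sup>2) * (4 * k\<^sup>2)))
        = ((3 * (5 - k) * (k - 1) - 2 * k * (6 - 2 * k)) * (q * q) - 2 * k * (5 - k) * (k - 1)\<^sup>2) / (8 * k\<^sup>2 * w * q)"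
      using qw(3,4) unfolding qw(2) by (simp add: divide_simps) (simp add: algebra_simps eval_nat_numeral)
    also have "(3 * (5 - k) * (k - 1) - 2 * k * (6 - 2 * k)) * (q * q) - 2 * k * (5 - k) * (k - 1)\<^sup>2 = (k\<^sup>2 - 5) * (3*k\<^sup>2 - 10*k + 15)"
      unfolding qw(1) by (simp add: algebra_simps eval_nat_numeral)
    finally show ?thesis by (simp add: q_def w_def)
  qed
  have "legH (?s k) = 5 / k * legH (?t k) \<and> legK (?s k) = ?nu k * legH (?t k) + 5 / (5 / k) * legK (?t k)"
  proof (rule legH_transformation[where S = "{1<..5}" and e = 5 and s = ?s and t = ?t 
      and \<mu> = "\<lambda>k. 5 / k" and \<nu> = ?nu and a = ?a and s' = ?s' and t' = ?t' and \<nu>' = ?nu' and \<mu>' = "\<lambda>k. -5/k\<^sup>2" and c = 5 and x = k])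
    fix k :: real assume k: "k \<in> {1<..5} - {5}"
    have k1: "k > 1" and k5: "k < 5" using k by auto
    define q w where "q = ?q k" and "w = sqrt k"
    have qw: "q > 0" "w > 0" using q2[of k] w2[OF k1] by (simp_all add: q_def w_def)
    show "\<bar>?s k\<bar> < 1" by (rule abs_less_1_of_square, subst s1[OF k1]) (use k1 k5 in simp)
    show "\<bar>?t k\<bar> < 1" by (rule abs_less_1_of_square, subst t1[OF k1]) (use k1 k5 in simp)
    show "(?s has_real_derivative ?s' k) (at k)" "(?t has_real_derivative ?t' k) (at k)"
      "((\<lambda>k. 5 / k) has_real_derivative -5/k\<^sup>2) (at k)" "(?nu has_real_derivative ?nu' k) (at k)"
      by (rule ds dt dm dn; fact)+
    show "?s' k * ?a k = 1 - (?s k)\<^sup>2" 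
      unfolding s1[OF k1] using k1 qw unfolding q_def[symmetric] w_def[symmetric] 
      by (simp add: divide_simps) (simp add: algebra_simps eval_nat_numeral)
    show "?nu k = ?a k * (-5/k\<^sup>2)" using k1 by (simp add: divide_simps)
    show "?t' k * ?a k * (5 / k)\<^sup>2 = 5 * (1 - (?t k)\<^sup>2)" 
      unfolding t1[OF k1] using k1 qw unfolding q_def[symmetric] w_def[symmetric] 
      by (simp add: divide_simps) (simp add: algebra_simps eval_nat_numeral)
    show "4 * (5 / k) * ?nu' k = ?s' k * (5 / k)\<^sup>2 - 5 * ?t' k"
      using k1 qw unfolding q_def[symmetric] w_def[symmetric] 
      by (simp add: divide_simps) (simp add: algebra_simps eval_nat_numeral)
  next
    have "sqrt 20 = 2 * sqrt 5" using real_sqrt_mult[of 4 5] by simp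
    thus "?s 5 = 1" "?t 5 = 1" by simp_all
  qed (use assms in \<open>auto intro!: continuous_intros\<close>)
  thus "legH s = 5 / k * legH t"
    and "legK s = - ((5 - k) * (k - 1) * sqrt k * sqrt (k\<^sup>2 - 2*k + 5) / (4 * k\<^sup>2)) * legH t + k * legK t"
    by (simp_all add: s_def t_def)
qed

section \<open>Double power series\<close>

definition dterm :: "(nat \<Rightarrow> nat \<Rightarrow> real) \<Rightarrow> real \<Rightarrow> real \<Rightarrow> nat \<times> nat \<Rightarrow> real" where
  "dterm d x y = (\<lambda>(s, m). d s m * x ^ s * y ^ m)"

definition dps :: "(nat \<Rightarrow> nat \<Rightarrow> real) \<Rightarrow> real \<Rightarrow> real \<Rightarrow> real" where
  "dps d x y = infsum (dterm d x y) UNIV"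

text \<open>Abel's condition: bounded terms at each positive point of the open bidisc. It gives
  absolute convergence inside and is inherited by the partial derivatives.\<close>

definition dconv :: "real \<Rightarrow> real \<Rightarrow> (nat \<Rightarrow> nat \<Rightarrow> real) \<Rightarrow> bool" where
  "dconv X Y d \<longleftrightarrow> (\<forall>x y. 0 < x \<and> x < X \<and> 0 < y \<and> y < Y \<longrightarrow> (\<exists>B. \<forall>s m. \<bar>d s m\<bar> * x ^ s * y ^ m \<le> B))"

text \<open>Coefficients of the partial derivative in the first variable; the second variable is
  handled by exchanging the indices with \<open>dswap\<close>.\<close>

definition dshift :: "(nat \<Rightarrow> nat \<Rightarrow> real) \<Rightarrow> nat \<Rightarrow> nat \<Rightarrow> real" where
  "dshift d s m = real (Suc s) * d (Suc s) m"

definition dswap :: "(nat \<Rightarrow> nat \<Rightarrow> real) \<Rightarrow> nat \<Rightarrow> nat \<Rightarrow> real" where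
  "dswap d s m = d m s"

abbreviation dshift2 where "dshift2 d \<equiv> dswap (dshift (dswap d))"

lemma dshift2_eq: "dshift2 d s m = real (Suc m) * d s (Suc m)"
  by (simp add: dswap_def dshift_def)

lemma dconv_dswap: "dconv X Y d \<Longrightarrow> dconv Y X (dswap d)"
  unfolding dconv_def dswap_def
proof (intro allI impI, elim conjE)
  fix y x assume *: "\<forall>x y. 0 < x \<and> x < X \<and> 0 < y \<and> y < Y \<longrightarrow> (\<exists>B. \<forall>s m. \<bar>d s m\<bar> * x ^ s * y ^ m \<le> B)"
    and "0 < y" "y < Y" "0 < x" "x < X"
  then obtain B where "\<bar>d s m\<bar> * x ^ s * y ^ m \<le> B" for s m by blast
  thus "\<exists>B. \<forall>s m. \<bar>d m s\<bar> * y ^ s * x ^ m \<le> B"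
    by (intro exI[of _ B] allI) (simp add: mult_ac)
qed

lemma has_sum_dterm_dswap: "(dterm (dswap d) y x has_sum S) UNIV \<longleftrightarrow> (dterm d x y has_sum S) UNIV"
  using has_sum_swap[where f = "dterm d x y" and S = S and A = UNIV and B = UNIV] 
  by (simp add: dterm_def dswap_def case_prod_unfold mult_ac)

lemma summable_on_geometric_product:
  fixes x y :: real
  assumes "0 \<le> x" "x < 1" "0 \<le> y" "y < 1"
  shows "(\<lambda>(s, m). x ^ s * y ^ m) summable_on (UNIV :: (nat \<times> nat) set)"
proof -
  have geo: "((\<lambda>m. y ^ m) has_sum (1 / (1 - y))) UNIV" "((\<lambda>m. x ^ m) has_sum (1 / (1 - x))) UNIV"
    using assms by (auto intro!: sums_nonneg_imp_has_sum geometric_sums)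
  have "(\<lambda>(s, m). x ^ s * y ^ m) summable_on (UNIV \<times> UNIV)"
  proof (rule summable_on_SigmaI)
    show "((\<lambda>m. case (s, m) of (s, m) \<Rightarrow> x ^ s * y ^ m) has_sum (x ^ s * (1 / (1 - y)))) UNIV" for s :: nat
      using has_sum_cmult_right[OF geo(1)] by simp
    show "(\<lambda>s. x ^ s * (1 / (1 - y))) summable_on (UNIV :: nat set)"
      using has_sum_cmult_left[OF geo(2)] summable_on_def by blast
  qed (use assms in auto)
  thus ?thesis by simp
qed

text \<open>The bound at a slightly larger point (x', y') dominates the terms by a product of two
  geometric series.\<close>

lemma dconv_summable:
  assumes "dconv X Y d" "\<bar>x\<bar> < X" "\<bar>y\<bar> < Y"
  shows "dterm d x y summable_on UNIV"
proof -
  obtain x' y' where x': "\<bar>x\<bar> < x'" "x' < X" and y': "\<bar>y\<bar> < y'" "y' < Y"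
    using dense[OF assms(2)] dense[OF assms(3)] by blast
  have xy: "0 < x'" "0 < y'" using x' y' by linarith+
  obtain B where B: "\<bar>d s m\<bar> * x' ^ s * y' ^ m \<le> B" for s m
    using assms(1)[unfolded dconv_def, rule_format, of x' y'] xy x' y' by auto
  have "(\<lambda>(s, m). (\<bar>x\<bar> / x') ^ s * (\<bar>y\<bar> / y') ^ m) summable_on (UNIV :: (nat \<times> nat) set)"
    by (rule summable_on_geometric_product) (use x' y' xy in \<open>auto simp: divide_simps\<close>)
  hence "(\<lambda>z. B * (case z of (s, m) \<Rightarrow> (\<bar>x\<bar> / x') ^ s * (\<bar>y\<bar> / y') ^ m)) summable_on (UNIV :: (nat \<times> nat) set)"
    by (rule summable_on_cmult_right)
  hence "(\<lambda>z. norm (dterm d x y z)) summable_on UNIV"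
  proof (rule summable_on_comparison_test)
    fix z :: "nat \<times> nat"
    obtain s m where z: "z = (s, m)" by (cases z)
    have "norm (dterm d x y z) = (\<bar>d s m\<bar> * x' ^ s * y' ^ m) * ((\<bar>x\<bar> / x') ^ s * (\<bar>y\<bar> / y') ^ m)"
      using xy by (simp add: z dterm_def abs_mult power_abs power_divide)
    also have "\<dots> \<le> B * ((\<bar>x\<bar> / x') ^ s * (\<bar>y\<bar> / y') ^ m)"
      by (intro mult_right_mono B) (use xy in auto)
    finally show "norm (dterm d x y z) \<le> B * (case z of (s, m) \<Rightarrow> (\<bar>x\<bar> / x') ^ s * (\<bar>y\<bar> / y') ^ m)"
      by (simp add: z)
  qed auto
  thus ?thesis by (rule summable_on_iff_abs_summable_on_real[THEN iffD2])
qed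

lemma dconv_has_sum:
  assumes "dconv X Y d" "\<bar>x\<bar> < X" "\<bar>y\<bar> < Y"
  shows "(dterm d x y has_sum dps d x y) UNIV"
  unfolding dps_def using dconv_summable[OF assms] by (rule has_sum_infsum)

text \<open>Enlarging x to x' absorbs the factor from differentiation, because n (x/x')^n is
  bounded.\<close>

lemma dconv_dshift:
  assumes "dconv X Y d" shows "dconv X Y (dshift d)"
  unfolding dconv_def
proof (intro allI impI, elim conjE)
  fix x y assume xy: "0 < x" "x < X" "0 < y" "y < Y"
  obtain x' where x': "x < x'" "x' < X" using dense xy by blast
  have x'0: "x' > 0" using xy x' by simp
  obtain B where B: "\<bar>d s m\<bar> * x' ^ s * y ^ m \<le> B" for s m
    using assms[unfolded dconv_def, rule_format, of x' y] xy x' x'0 by auto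
  have lim: "(\<lambda>n. real n * (x / x') ^ n) \<longlonglongrightarrow> 0"
    by (rule powser_times_n_limit_0) (use xy x' x'0 in auto)
  obtain C where C: "norm (real n * (x / x') ^ n) \<le> C" for n
    using convergent_imp_Bseq[OF convergentI[OF lim]] unfolding Bseq_def by auto
  have B0: "B \<ge> 0" "C \<ge> 0" using B[of 0 0] C[of 0] by simp_all
  show "\<exists>B. \<forall>s m. \<bar>dshift d s m\<bar> * x ^ s * y ^ m \<le> B"
  proof (intro exI allI)
    fix s m
    have "\<bar>dshift d s m\<bar> * x ^ s * y ^ m = (real (Suc s) * (x / x') ^ Suc s) * (\<bar>d (Suc s) m\<bar> * x' ^ Suc s * y ^ m) / x"
      using xy x'0 by (simp add: dshift_def abs_mult power_divide)
    also have "\<dots> \<le> C * B / x"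
      using C[of "Suc s"] B[of "Suc s" m] xy x'0 B0
      by (intro divide_right_mono mult_mono) auto
    finally show "\<bar>dshift d s m\<bar> * x ^ s * y ^ m \<le> C * B / x" .
  qed
qed

lemma dconv_dshift2: "dconv X Y d \<Longrightarrow> dconv X Y (dshift2 d)"
  by (intro dconv_dswap dconv_dshift)

text \<open>Identifies the shifted series with the termwise derivative over unshifted indices. Terms
  with s = 0 carry the factor 0, so the truncated exponent s - 1 does no harm.\<close>

lemma has_sum_dshift:
  "(dterm (dshift d) x y has_sum S) UNIV \<longleftrightarrow>
   ((\<lambda>(s, m). d s m * (real s * x ^ (s - 1)) * y ^ m) has_sum S) UNIV"
proof -
  let ?h = "\<lambda>(s, m). (Suc s, m) :: nat \<times> nat"
  let ?g = "\<lambda>(s, m). d s m * (real s * x ^ (s - 1)) * y ^ m"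
  have "(?g has_sum S) UNIV \<longleftrightarrow> (?g has_sum S) (range ?h)"
  proof (rule has_sum_cong_neutral)
    fix z :: "nat \<times> nat" assume "z \<in> UNIV - range ?h"
    hence "fst z = 0" by (cases z, cases "fst z") (auto simp: image_iff)
    thus "?g z = 0" by (simp add: case_prod_unfold)
  qed auto
  also have "\<dots> \<longleftrightarrow> ((?g \<circ> ?h) has_sum S) UNIV"
    by (rule has_sum_reindex) (auto simp: inj_on_def)
  also have "?g \<circ> ?h = dterm (dshift d) x y"
    by (auto simp: dterm_def dshift_def fun_eq_iff)
  finally show ?thesis ..
qed

lemma has_sum_dshift2:
  "(dterm (dshift2 d) x y has_sum S) UNIV \<longleftrightarrow>
   ((\<lambda>(s, m). d s m * x ^ s * (real m * y ^ (m - 1))) has_sum S) UNIV"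
proof -
  have "(dterm (dshift2 d) x y has_sum S) UNIV \<longleftrightarrow> (dterm (dshift (dswap d)) y x has_sum S) UNIV"
    by (rule has_sum_dterm_dswap)
  also have "\<dots> \<longleftrightarrow> ((\<lambda>(s, m). d m s * (real s * y ^ (s - 1)) * x ^ m) has_sum S) UNIV"
    by (subst has_sum_dshift) (simp add: dswap_def)
  also have "\<dots> \<longleftrightarrow> ((\<lambda>(s, m). d s m * x ^ s * (real m * y ^ (m - 1))) has_sum S) UNIV"
    using has_sum_swap[where f = "\<lambda>(s, m). d m s * (real s * y ^ (s - 1)) * x ^ m" and S = S and A = UNIV and B = UNIV]
    by (simp add: case_prod_unfold mult_ac)
  finally show ?thesis .
qed

lemma has_sum_imp_sums_prod_decode:
  assumes "(f has_sum S) (UNIV :: (nat \<times> nat) set)"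
  shows "(\<lambda>i. f (prod_decode i)) sums S"
  using assms by (intro has_sum_imp_sums) (simp add: has_sum_reindex_bij_betw[OF bij_prod_decode])

lemma summable_prod_decode:
  "f summable_on (UNIV :: (nat \<times> nat) set) \<Longrightarrow> summable (\<lambda>i. f (prod_decode i) :: real)"
  unfolding summable_on_def summable_def by (auto dest: has_sum_imp_sums_prod_decode)

text \<open>Termwise differentiation on a rectangle strictly inside the bidisc, after enumerating
  the pairs by \<open>prod_decode\<close>.\<close>

lemma has_derivative_dps:
  fixes d :: "nat \<Rightarrow> nat \<Rightarrow> real"
  assumes d: "dconv X Y d" and x: "\<bar>x\<bar> < X" and y: "\<bar>y\<bar> < Y"
  shows "((\<lambda>z. dps d (fst z) (snd z)) has_derivative 
            (\<lambda>h. dps (dshift d) x y * fst h + dps (dshift2 d) x y * snd h)) (at (x, y))"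
proof -
  obtain x' y' where x': "\<bar>x\<bar> < x'" "x' < X" and y': "\<bar>y\<bar> < y'" "y' < Y"
    using dense[OF assms(2)] dense[OF assms(3)] by blast
  have x'0: "0 < x'" "\<bar>x'\<bar> < X" and y'0: "0 < y'" "\<bar>y'\<bar> < Y" using x' y' by auto
  define S where "S = {-x'<..<x'} \<times> {-y'<..<y'}"
  have S: "convex S" "open S" "(x, y) \<in> S"
    using x' y' unfolding S_def by (auto intro!: convex_Times open_Times)
  define f where "f = (\<lambda>i z. dterm d (fst z) (snd z) (prod_decode i))"
  define a where "a = (\<lambda>z (s, m). d s m * (real s * fst z ^ (s - 1)) * snd z ^ m)"
  define b where "b = (\<lambda>z (s, m). d s m * fst z ^ s * (real m * snd z ^ (m - 1)))"
  define f' where "f' = (\<lambda>i z h. a z (prod_decode i) * fst h + b z (prod_decode i) * snd h)"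
  define g' where "g' = (\<lambda>z h. dps (dshift d) (fst z) (snd z) * fst h + dps (dshift2 d) (fst z) (snd z) * snd h)"
  \<comment> \<open>Weierstrass majorant: on the rectangle both partial derivatives of each term are
    largest in absolute value at the corner (x', y').\<close>
  define M where "M = (\<lambda>i. \<bar>a (x', y') (prod_decode i)\<bar> + \<bar>b (x', y') (prod_decode i)\<bar>)"
  have inS: "\<bar>fst z\<bar> < X" "\<bar>snd z\<bar> < Y" "\<bar>fst z\<bar> \<le> x'" "\<bar>snd z\<bar> \<le> y'" if "z \<in> S" for z
    using that x' y' unfolding S_def by (auto simp: mem_Times_iff)
  have sa: "(a z has_sum dps (dshift d) (fst z) (snd z)) UNIV" if "\<bar>fst z\<bar> < X" "\<bar>snd z\<bar> < Y" for z
    using dconv_has_sum[OF dconv_dshift[OF d] that] unfolding has_sum_dshift a_def .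
  have sb: "(b z has_sum dps (dshift2 d) (fst z) (snd z)) UNIV" if "\<bar>fst z\<bar> < X" "\<bar>snd z\<bar> < Y" for z
    using dconv_has_sum[OF dconv_dshift2[OF d] that] unfolding has_sum_dshift2 b_def .
  have "summable M"
  proof -
    have "a (x', y') summable_on UNIV" "b (x', y') summable_on UNIV"
      using sa[of "(x', y')"] sb[of "(x', y')"] x'0 y'0 by (auto simp: summable_on_def)
    hence "(\<lambda>i. norm (a (x', y') i)) summable_on UNIV" "(\<lambda>i. norm (b (x', y') i)) summable_on UNIV"
      by - (rule summable_on_iff_abs_summable_on_real[THEN iffD1], assumption)+
    hence "summable (\<lambda>i. norm (a (x', y') (prod_decode i)))" "summable (\<lambda>i. norm (b (x', y') (prod_decode i)))"
      by (auto dest: summable_prod_decode)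
    thus ?thesis unfolding M_def by (intro summable_add) auto
  qed
  have bound: "norm (f' i z h) \<le> M i * norm h" if z: "z \<in> S" for i z h
  proof -
    obtain s m where sm: "prod_decode i = (s, m)" by fastforce
    have "\<bar>a z (s, m)\<bar> \<le> \<bar>a (x', y') (s, m)\<bar>" "\<bar>b z (s, m)\<bar> \<le> \<bar>b (x', y') (s, m)\<bar>"
      using inS[OF z] x'0 y'0 unfolding a_def b_def
      by (auto simp: abs_mult power_abs intro!: mult_mono power_mono)
    moreover have "\<bar>fst h\<bar> \<le> norm h" "\<bar>snd h\<bar> \<le> norm h"
      using norm_fst_le[of "fst h" "snd h"] norm_snd_le[of "snd h" "fst h"] by simp_all
    ultimately have "\<bar>a z (s, m) * fst h\<bar> \<le> \<bar>a (x', y') (s, m)\<bar> * norm h" "\<bar>b z (s, m) * snd h\<bar> \<le> \<bar>b (x', y') (s, m)\<bar> * norm h"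
      unfolding abs_mult by (auto intro!: mult_mono)
    thus ?thesis unfolding f'_def M_def sm by (simp add: distrib_right)
  qed
  have f'_sums: "(\<lambda>i. f' i z h) sums g' z h" if "z \<in> S" for z h
    unfolding f'_def g'_def using inS[OF that]
    by (intro sums_add sums_mult2 has_sum_imp_sums_prod_decode sa sb) auto
  have "\<exists>g. \<forall>z\<in>S. (\<lambda>i. f i z) sums (g z) \<and> (g has_derivative g' z) (at z within S)"
  proof (rule has_derivative_series[OF S(1) _ _ S(3)])
    fix i z assume "z \<in> S"
    obtain s m where sm: "prod_decode i = (s, m)" by fastforce
    have 1: "((\<lambda>z. fst z ^ s) has_derivative (\<lambda>h. real s * fst h * fst z ^ (s - 1))) (at z within S)"
      by (rule has_derivative_power) (rule has_derivative_fst[OF has_derivative_ident])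
    have 2: "((\<lambda>z. snd z ^ m) has_derivative (\<lambda>h. real m * snd h * snd z ^ (m - 1))) (at z within S)"
      by (rule has_derivative_power) (rule has_derivative_snd[OF has_derivative_ident])
    have "((\<lambda>z. d s m * (fst z ^ s * snd z ^ m)) has_derivative 
       (\<lambda>h. d s m * (fst z ^ s * (real m * snd h * snd z ^ (m - 1)) + real s * fst h * fst z ^ (s - 1) * snd z ^ m))) (at z within S)"
      by (intro has_derivative_mult_right has_derivative_mult 1 2)
    thus "(f i has_derivative f' i z) (at z within S)"
      unfolding f_def f'_def sm dterm_def a_def b_def by (simp add: algebra_simps)
  next
    fix e :: real assume e: "e > 0"
    have tail: "(\<lambda>n. \<Sum>i. M (i + n)) \<longlonglongrightarrow> 0"
      using suminf_exist_split2[OF \<open>summable M\<close>] by simp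
    have "eventually (\<lambda>n. (\<Sum>i. M (i + n)) < e) sequentially"
      by (rule order_tendstoD(2)[OF tail e])
    thus "eventually (\<lambda>n. \<forall>z\<in>S. \<forall>h. norm (sum (\<lambda>i. f' i z h) {..<n} - g' z h) \<le> e * norm h) sequentially"
    proof eventually_elim
      case (elim n)
      show ?case
      proof (intro ballI allI)
        fix z h :: "real \<times> real" assume z: "z \<in> S"
        have sm: "summable (\<lambda>i. M (i + n) * norm h)"
          using \<open>summable M\<close> by (intro summable_mult2) (simp add: summable_iff_shift)
        have smf: "summable (\<lambda>i. norm (f' (i + n) z h))"
          by (rule summable_comparison_test[OF _ sm]) (use bound[OF z] in auto)
        have "g' z h - sum (\<lambda>i. f' i z h) {..<n} = (\<Sum>i. f' (i + n) z h)"
          using suminf_split_initial_segment[OF sums_summable[OF f'_sums[OF z, of h]], of n] 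
            sums_unique[OF f'_sums[OF z, of h]] by simp
        hence "norm (sum (\<lambda>i. f' i z h) {..<n} - g' z h) = norm (\<Sum>i. f' (i + n) z h)"
          by (metis norm_minus_commute)
        also have "\<dots> \<le> (\<Sum>i. norm (f' (i + n) z h))" by (rule summable_norm[OF smf])
        also have "\<dots> \<le> (\<Sum>i. M (i + n) * norm h)"
          by (rule suminf_le[OF _ smf sm]) (rule bound[OF z])
        also have "\<dots> = (\<Sum>i. M (i + n)) * norm h"
          using \<open>summable M\<close> by (intro suminf_mult2[symmetric]) (simp add: summable_iff_shift)
        also have "\<dots> \<le> e * norm h" using elim by (intro mult_right_mono) auto
        finally show "norm (sum (\<lambda>i. f' i z h) {..<n} - g' z h) \<le> e * norm h" .
      qed
    qed
  next
    show "(\<lambda>i. f i (x, y)) sums dps d x y"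
      unfolding f_def using has_sum_imp_sums_prod_decode[OF dconv_has_sum[OF d x y]] by simp
  qed
  then obtain g where g: "\<And>z. z \<in> S \<Longrightarrow> (\<lambda>i. f i z) sums (g z)" 
    "\<And>z. z \<in> S \<Longrightarrow> (g has_derivative g' z) (at z within S)" by blast
  have g_eq: "g z = dps d (fst z) (snd z)" if "z \<in> S" for z
  proof -
    have "(\<lambda>i. f i z) sums dps d (fst z) (snd z)"
      unfolding f_def using has_sum_imp_sums_prod_decode[OF dconv_has_sum[OF d]] inS[OF that] by simp
    with g(1)[OF that] show ?thesis by (rule sums_unique2)
  qed
  have "(g has_derivative g' (x, y)) (at (x, y))"
    using g(2)[OF S(3)] at_within_open[OF S(3,2)] by simp
  hence "((\<lambda>z. dps d (fst z) (snd z)) has_derivative g' (x, y)) (at (x, y))"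
    by (rule has_derivative_transform_within_open[OF _ S(2,3)]) (use g_eq in auto)
  thus ?thesis by (simp add: g'_def)
qed

lemma DERIV_dps_curve:
  assumes d: "dconv X Y d" and "\<bar>p u\<bar> < X" "\<bar>q u\<bar> < Y"
    and "(p has_real_derivative p') (at u)" "(q has_real_derivative q') (at u)"
  shows "((\<lambda>u. dps d (p u) (q u)) has_real_derivative 
            dps (dshift d) (p u) (q u) * p' + dps (dshift2 d) (p u) (q u) * q') (at u)"
proof -
  have pq: "((\<lambda>u. (p u, q u)) has_derivative (\<lambda>h. (p' * h, q' * h))) (at u)"
    using assms(4,5) by (intro has_derivative_Pair) (auto simp: has_field_derivative_def)
  have "((\<lambda>u. dps d (fst (p u, q u)) (snd (p u, q u))) has_derivative 
     (\<lambda>h. dps (dshift d) (p u) (q u) * fst (p' * h, q' * h) + dps (dshift2 d) (p u) (q u) * snd (p' * h, q' * h))) (at u)"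
    by (rule has_derivative_compose[OF pq has_derivative_dps[OF d assms(2,3)]])
  moreover have "(\<lambda>h. dps (dshift d) (p u) (q u) * fst (p' * h, q' * h) + dps (dshift2 d) (p u) (q u) * snd (p' * h, q' * h))
     = (*) (dps (dshift d) (p u) (q u) * p' + dps (dshift2 d) (p u) (q u) * q')"
    by (auto simp: fun_eq_iff algebra_simps)
  ultimately show ?thesis unfolding has_field_derivative_def by simp
qed

section \<open>The double series as a product of Legendre functions\<close>

lemma has_sum_dterm_up:
  assumes S: "(dterm e x y has_sum S) UNIV" and d: "\<And>m. d 0 m = 0" "\<And>s m. d (Suc s) m = e s m"
  shows "(dterm d x y has_sum x * S) UNIV"
proof -
  let ?h = "\<lambda>(s, m). (Suc s, m) :: nat \<times> nat"
  have "((\<lambda>z. x * dterm e x y z) has_sum x * S) UNIV" by (rule has_sum_cmult_right[OF S])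
  also have "(\<lambda>z. x * dterm e x y z) = dterm d x y \<circ> ?h"
    by (auto simp: dterm_def d fun_eq_iff)
  finally have "(dterm d x y has_sum x * S) (range ?h)"
    by (subst has_sum_reindex) (auto simp: inj_on_def comp_def case_prod_unfold)
  moreover have "(dterm d x y has_sum x * S) (range ?h) \<longleftrightarrow> (dterm d x y has_sum x * S) UNIV"
  proof (rule has_sum_cong_neutral)
    fix z :: "nat \<times> nat" assume "z \<in> UNIV - range ?h"
    hence "fst z = 0" by (cases z, cases "fst z") (auto simp: image_iff)
    thus "dterm d x y z = 0" by (simp add: case_prod_unfold dterm_def d)
  qed auto
  ultimately show ?thesis by simp
qed

lemma has_sum_dterm_up2:
  assumes S: "(dterm e x y has_sum S) UNIV" and d: "\<And>s. d s 0 = 0" "\<And>s m. d s (Suc m) = e s m"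
  shows "(dterm d x y has_sum y * S) UNIV"
proof -
  have "(dterm (dswap e) y x has_sum S) UNIV" using S by (simp add: has_sum_dterm_dswap)
  hence "(dterm (dswap d) y x has_sum y * S) UNIV" 
    by (rule has_sum_dterm_up) (auto simp: dswap_def d)
  thus ?thesis by (simp add: has_sum_dterm_dswap)
qed

text \<open>With n = 2m + s and k = m + s this is (2n)! (2k)! / (n! k!^2 (n - k)!^2 (2k - n)!), the
  product of the binomial factors of the summand.\<close>

definition sun_coeff :: "nat \<Rightarrow> nat \<Rightarrow> real" where
  "sun_coeff s m = fact (4*m + 2 * s) * fact (2*m + 2 * s) / (fact (2*m + s) * (fact (m + s))\<^sup>2 * (fact m)\<^sup>2 * fact s)"

lemma sun_coeff_0_0: "sun_coeff 0 0 = 1"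
  by (simp add: sun_coeff_def)

lemma sun_coeff_rec1:
  "(real m + real s + 1) * (real s + 1) * sun_coeff (Suc s) m = 4 * (4 * real m + 2 * real s + 1) * (2 * real m + 2 * real s + 1) * sun_coeff s m"
proof -
  have 1: "fact (4*m + 2*Suc s) = (4 * real m + 2 * real s + 2) * (4 * real m + 2 * real s + 1) * fact (4*m + 2 * s)"
   and 2: "fact (2*m + 2*Suc s) = (2 * real m + 2 * real s + 2) * (2 * real m + 2 * real s + 1) * fact (2*m + 2 * s)"
   and 3: "fact (2*m + Suc s) = (2 * real m + real s + 1) * fact (2*m + s)"
   and 4: "fact (m + Suc s) = (real m + real s + 1) * fact (m + s)"
   and 5: "fact (Suc s) = (real s + 1) * fact s"
    by (simp_all add: algebra_simps)
  have nz: "2 * real m + real s + 1 \<noteq> 0" "real m + real s + 1 \<noteq> 0" "real s + 1 \<noteq> 0" by linarith+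
  have gen: "(a + b + 1) * (b + 1) * ((4*a + 2*b + 2) * (4*a + 2*b + 1) * F1 * ((2*a + 2*b + 2) * (2*a + 2*b + 1) * F2) /
      ((2*a + b + 1) * F3 * ((a + b + 1) * F4)\<^sup>2 * F5\<^sup>2 * ((b + 1) * F6))) 
    = 4 * (4*a + 2*b + 1) * (2*a + 2*b + 1) * (F1 * F2 / (F3 * F4\<^sup>2 * F5\<^sup>2 * F6))"
    if "2*a + b + 1 \<noteq> 0" "a + b + 1 \<noteq> 0" "b + 1 \<noteq> 0" "F3 \<noteq> 0" "F4 \<noteq> 0" "F5 \<noteq> 0" "F6 \<noteq> 0" for a b F1 F2 F3 F4 F5 F6 :: real
  proof -
    have "4*a + 2*b + 2 = 2 * (2*a + b + 1)" "2*a + 2*b + 2 = 2 * (a + b + 1)" by simp_all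
    thus ?thesis using that by (simp only:) (simp add: divide_simps power2_eq_square, simp add: algebra_simps)
  qed
  show ?thesis unfolding sun_coeff_def 1 2 3 4 5 by (rule gen[OF nz]) auto
qed

text \<open>The step from (s + 1, m) to (s, m + 1) fixes k and raises n by one. Along it enough
  factors cancel for a second-order equation, whereas the plain step from m to m + 1 would lead to a
  third-order one.\<close>

lemma sun_coeff_rec2:
  "(real m + 1)\<^sup>2 * sun_coeff s (Suc m) = 2 * (4 * real m + 2 * real s + 3) * ((real s + 1) * sun_coeff (Suc s) m)"
proof -
  have 1: "fact (4*Suc m + 2 * s) = (4 * real m + 2 * real s + 4) * (4 * real m + 2 * real s + 3) * fact (4*m + 2*Suc s)"
   and 2: "2 * Suc m + 2 * s = 2 * m + 2 * Suc s"
   and 3: "fact (2*Suc m + s) = (2 * real m + real s + 2) * fact (2*m + Suc s)"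
   and 4: "Suc m + s = m + Suc s"
   and 5: "fact (Suc s) = (real s + 1) * fact s"
   and 6: "fact (Suc m) = (real m + 1) * fact m"
    by (simp_all add: algebra_simps numeral_eq_Suc)
  have nz: "2 * real m + real s + 2 \<noteq> 0" "real m + 1 \<noteq> 0" "real s + 1 \<noteq> 0" by linarith+
  have gen: "(a + 1)\<^sup>2 * ((4*a + 2*b + 4) * (4*a + 2*b + 3) * F1 * F2 /
      ((2*a + b + 2) * F3 * F4\<^sup>2 * ((a + 1) * F5)\<^sup>2 * F6)) 
    = 2 * (4*a + 2*b + 3) * ((b + 1) * (F1 * F2 / (F3 * F4\<^sup>2 * F5\<^sup>2 * ((b + 1) * F6))))"
    if "2*a + b + 2 \<noteq> 0" "a + 1 \<noteq> 0" "b + 1 \<noteq> 0" "F3 \<noteq> 0" "F4 \<noteq> 0" "F5 \<noteq> 0" "F6 \<noteq> 0" for a b F1 F2 F3 F4 F5 F6 :: real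
  proof -
    have "4*a + 2*b + 4 = 2 * (2*a + b + 2)" by simp
    thus ?thesis using that by (simp only:) (simp add: divide_simps power2_eq_square, simp add: algebra_simps)
  qed
  show ?thesis unfolding sun_coeff_def 1 2 3 4 5 6 by (rule gen[OF nz]) auto
qed

text \<open>This factorisation serves the growth bound: each binomial coefficient is at most a power
  of 2.\<close>

lemma sun_coeff_binomial:
  "sun_coeff s m = real ((2*(2*m+s)) choose (2*m+s)) * real ((2*m+s) choose (2*m)) * real ((2*m) choose m) * real ((2*(m+s)) choose (m+s))"
proof -
  have cb: "real ((2*n) choose n) = fact (2*n) / (fact n * fact n)" for n
    using binomial_fact[of n "2*n", where 'a = real] by (simp add: mult_2)
  have "real ((2*m+s) choose (2*m)) = fact (2*m+s) / (fact (2*m) * fact s)"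
    using binomial_fact[of "2*m" "2*m+s", where 'a = real] by simp
  moreover have "4*m + 2 * s = 2*(2*m+s)" "2*m + 2 * s = 2*(m+s)" by simp_all
  ultimately show ?thesis unfolding sun_coeff_def cb by (simp only:) (simp add: power2_eq_square del: mult_2)
qed

lemma sun_coeff_nonneg: "sun_coeff s m \<ge> 0" by (simp add: sun_coeff_def)

lemma sun_coeff_le: "sun_coeff s m \<le> 32 ^ s * 1024 ^ m"
proof -
  have b: "real (n choose k) \<le> 2 ^ n" for n k 
    using binomial_le_pow2[of n k] by (metis of_nat_le_iff of_nat_numeral of_nat_power)
  have "sun_coeff s m \<le> 2 ^ (2*(2*m+s)) * 2 ^ (2*m+s) * 2 ^ (2*m) * 2 ^ (2*(m+s))"
    unfolding sun_coeff_binomial by (intro mult_mono b) auto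
  also have "\<dots> = (2::real) ^ (5 * s + 10 * m)"
    unfolding power_add[symmetric] by (rule arg_cong[where f = "\<lambda>n. 2 ^ n"]) simp
  also have "\<dots> = 32 ^ s * 1024 ^ m"
    unfolding power_add power_mult by simp
  finally show ?thesis .
qed

text \<open>The radii lie below 1/32 and 1/1024, where \<open>sun_coeff_le\<close> applies, and
  leave room for the point (-1/60, -1/230400).\<close>

lemma dconv_sun_coeff: "dconv (1/50) (1/10000) sun_coeff"
  unfolding dconv_def
proof (intro allI impI, elim conjE)
  fix x y :: real assume xy: "0 < x" "x < 1/50" "0 < y" "y < 1/10000"
  show "\<exists>B. \<forall>s m. \<bar>sun_coeff s m\<bar> * x ^ s * y ^ m \<le> B"
  proof (intro exI[of _ 1] allI)
    fix s m
    have "\<bar>sun_coeff s m\<bar> * x ^ s * y ^ m \<le> (32 ^ s * 1024 ^ m) * x ^ s * y ^ m"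
      using sun_coeff_le[of s m] sun_coeff_nonneg[of s m] xy by (intro mult_right_mono) auto
    also have "\<dots> = (32 * x) ^ s * (1024 * y) ^ m" by (simp add: power_mult_distrib)
    also have "\<dots> \<le> 1 * 1" using xy by (intro mult_mono power_le_one) auto
    finally show "\<bar>sun_coeff s m\<bar> * x ^ s * y ^ m \<le> 1" by simp
  qed
qed

lemma dps_sun_coeff_0: "dps sun_coeff 0 0 = 1"
proof -
  have "(dterm sun_coeff 0 0 has_sum 1) UNIV"
  proof (rule has_sum_finite_neutralI[of "{(0,0)}"])
    show "dterm sun_coeff 0 0 z = 0" if "z \<in> UNIV - {(0, 0)}" for z
      using that by (cases z) (auto simp: dterm_def)
  qed (auto simp: dterm_def sun_coeff_0_0)
  thus ?thesis unfolding dps_def by (rule infsumI)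
qed

lemma dshift_dshift2: "dshift (dshift2 d) = dshift2 (dshift d)"
  by (intro ext) (simp add: dshift_def dshift2_eq)

text \<open>The two recurrences summed against p^s q^m. The coefficients 14 and 8 arise on writing
  (4m + 2s + 1)(2m + 2s + 1) in terms of m (m - 1) and s (s - 1), which correspond to q^2
  \<open>Gqq\<close> and p^2 \<open>Gpp\<close>.\<close>

lemma sun_coeff_PDE:
  assumes "\<bar>p\<bar> < 1/50" "\<bar>q\<bar> < 1/10000"
  defines "G \<equiv> dps sun_coeff p q" and "Gp \<equiv> dps (dshift sun_coeff) p q" and "Gq \<equiv> dps (dshift2 sun_coeff) p q"
    and "Gpp \<equiv> dps (dshift (dshift sun_coeff)) p q" and "Gpq \<equiv> dps (dshift2 (dshift sun_coeff)) p q"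
    and "Gqq \<equiv> dps (dshift2 (dshift2 sun_coeff)) p q"
  shows "Gp + p * Gpp + q * Gpq - 4 * (8 * q\<^sup>2 * Gqq + 12 * p * q * Gpq + 4 * p\<^sup>2 * Gpp + 14 * q * Gq + 8 * p * Gp + G) = 0"
    and "Gq + q * Gqq - 2 * (4 * q * Gpq + 2 * p * Gpp + 3 * Gp) = 0"
proof -
  note c = dconv_sun_coeff dconv_dshift dconv_dshift2
  have h: "(dterm sun_coeff p q has_sum G) UNIV" "(dterm (dshift sun_coeff) p q has_sum Gp) UNIV"
     "(dterm (dshift2 sun_coeff) p q has_sum Gq) UNIV" "(dterm (dshift (dshift sun_coeff)) p q has_sum Gpp) UNIV"
     "(dterm (dshift2 (dshift sun_coeff)) p q has_sum Gpq) UNIV" "(dterm (dshift2 (dshift2 sun_coeff)) p q has_sum Gqq) UNIV"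
    unfolding G_def Gp_def Gq_def Gpp_def Gpq_def Gqq_def
    by (rule dconv_has_sum[OF _ assms(1,2)], intro c)+
  \<comment> \<open>Multiplication by p or q undoes the index shift of a derivative, so p d/dp and q
    d/dq become the weights s and m.\<close>
  have s: "(dterm (\<lambda>s m. real s * sun_coeff s m) p q has_sum p * Gp) UNIV"
    by (rule has_sum_dterm_up[OF h(2)]) (auto simp: dshift_def)
  have m: "(dterm (\<lambda>s m. real m * sun_coeff s m) p q has_sum q * Gq) UNIV"
    by (rule has_sum_dterm_up2[OF h(3)]) (auto simp: dshift2_eq)
  have s1: "(dterm (\<lambda>s m. real s * dshift sun_coeff s m) p q has_sum p * Gpp) UNIV"
    by (rule has_sum_dterm_up[OF h(4)]) (auto simp: dshift_def)
  have m1: "(dterm (\<lambda>s m. real m * dshift sun_coeff s m) p q has_sum q * Gpq) UNIV"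
    by (rule has_sum_dterm_up2[OF h(5)]) (auto simp: dshift2_eq)
  have m2: "(dterm (\<lambda>s m. real m * dshift2 sun_coeff s m) p q has_sum q * Gqq) UNIV"
    by (rule has_sum_dterm_up2[OF h(6)]) (auto simp: dshift2_eq)
  have ss: "(dterm (\<lambda>s m. real s * (real s - 1) * sun_coeff s m) p q has_sum p * (p * Gpp)) UNIV"
    by (rule has_sum_dterm_up[OF s1]) (auto simp: dshift_def)
  have sm: "(dterm (\<lambda>s m. real s * real m * sun_coeff s m) p q has_sum p * (q * Gpq)) UNIV"
    by (rule has_sum_dterm_up[OF m1]) (auto simp: dshift_def)
  have mm: "(dterm (\<lambda>s m. real m * (real m - 1) * sun_coeff s m) p q has_sum q * (q * Gqq)) UNIV"
    by (rule has_sum_dterm_up2[OF m2]) (auto simp: dshift2_eq)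
  note cm = has_sum_cmult_right
  have hf: "((\<lambda>z. dterm (dshift sun_coeff) p q z + dterm (\<lambda>s m. real s * dshift sun_coeff s m) p q z + dterm (\<lambda>s m. real m * dshift sun_coeff s m) p q z)
     has_sum (Gp + p * Gpp + q * Gpq)) UNIV" (is "(?f has_sum _) _")
    by (intro has_sum_add h s1 m1)
  have hg: "((\<lambda>z. 4 * (8 * dterm (\<lambda>s m. real m * (real m - 1) * sun_coeff s m) p q z + 12 * dterm (\<lambda>s m. real s * real m * sun_coeff s m) p q z
      + 4 * dterm (\<lambda>s m. real s * (real s - 1) * sun_coeff s m) p q z + 14 * dterm (\<lambda>s m. real m * sun_coeff s m) p q z 
      + 8 * dterm (\<lambda>s m. real s * sun_coeff s m) p q z + dterm sun_coeff p q z))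
     has_sum (4 * (8 * (q * (q * Gqq)) + 12 * (p * (q * Gpq)) + 4 * (p * (p * Gpp)) + 14 * (q * Gq) + 8 * (p * Gp) + G))) UNIV" (is "(?g has_sum _) _")
    by (intro has_sum_add cm h s m ss sm mm)
  have eq: "?f = ?g"
  proof (rule ext)
    fix z :: "nat \<times> nat" obtain s m where z: "z = (s, m)" by (cases z)
    have "?f z = ((real m + real s + 1) * (real s + 1) * sun_coeff (Suc s) m) * p ^ s * q ^ m"
      by (simp add: z dterm_def dshift_def algebra_simps)
    also have "\<dots> = ?g z" unfolding sun_coeff_rec1 by (simp add: z dterm_def algebra_simps)
    finally show "?f z = ?g z" .
  qed
  have "Gp + p * Gpp + q * Gpq = 4 * (8 * (q * (q * Gqq)) + 12 * (p * (q * Gpq)) + 4 * (p * (p * Gpp)) + 14 * (q * Gq) + 8 * (p * Gp) + G)"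
    by (rule has_sum_unique[OF hf hg[folded eq]])
  thus "Gp + p * Gpp + q * Gpq - 4 * (8 * q\<^sup>2 * Gqq + 12 * p * q * Gpq + 4 * p\<^sup>2 * Gpp + 14 * q * Gq + 8 * p * Gp + G) = 0"
    by (simp add: power2_eq_square mult_ac)
  have hf2: "((\<lambda>z. dterm (dshift2 sun_coeff) p q z + dterm (\<lambda>s m. real m * dshift2 sun_coeff s m) p q z) has_sum (Gq + q * Gqq)) UNIV" (is "(?f has_sum _) _")
    by (intro has_sum_add h m2)
  have hg2: "((\<lambda>z. 2 * (4 * dterm (\<lambda>s m. real m * dshift sun_coeff s m) p q z + 2 * dterm (\<lambda>s m. real s * dshift sun_coeff s m) p q z + 3 * dterm (dshift sun_coeff) p q z))
     has_sum (2 * (4 * (q * Gpq) + 2 * (p * Gpp) + 3 * Gp))) UNIV" (is "(?g has_sum _) _")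
    by (intro has_sum_add cm h s1 m1)
  have eq2: "?f = ?g"
  proof (rule ext)
    fix z :: "nat \<times> nat" obtain s m where z: "z = (s, m)" by (cases z)
    have "?f z = ((real m + 1)\<^sup>2 * sun_coeff s (Suc m)) * p ^ s * q ^ m"
      by (simp add: z dterm_def dshift2_eq power2_eq_square algebra_simps)
    also have "\<dots> = ?g z" unfolding sun_coeff_rec2 by (simp add: z dterm_def dshift_def algebra_simps)
    finally show "?f z = ?g z" .
  qed
  have "Gq + q * Gqq = 2 * (4 * (q * Gpq) + 2 * (p * Gpp) + 3 * Gp)"
    by (rule has_sum_unique[OF hf2 hg2[folded eq2]])
  thus "Gq + q * Gqq - 2 * (4 * q * Gpq + 2 * p * Gpp + 3 * Gp) = 0" by simp
qed

section \<open>The Legendre equation in the half-angle coordinate u = tan(\<alpha>/2)\<close>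

definition legR :: "real \<Rightarrow> real" where
  "legR u = legH ((1 - u\<^sup>2) / (1 + u\<^sup>2)) / sqrt (1 + u\<^sup>2)"

text \<open>\<open>legR\<close> is cos(\<alpha>/2) H(cos \<alpha>), and this is its flux u (1 + u^2)
  R'(u), expanded so that it makes sense at u = 0.\<close>

definition legS :: "real \<Rightarrow> real" where
  "legS u = (- (1 + u\<^sup>2) * legK ((1 - u\<^sup>2) / (1 + u\<^sup>2)) - u\<^sup>2 * legH ((1 - u\<^sup>2) / (1 + u\<^sup>2))) / sqrt (1 + u\<^sup>2)"

lemma legR_0 [simp]: "legR 0 = 1" and legS_0 [simp]: "legS 0 = 0"
  by (simp_all add: legR_def legS_def)

lemma one_plus_square_pos: "1 + u\<^sup>2 > (0::real)"
  by (simp add: add_pos_nonneg)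

lemma tan_half_bounds: 
  fixes u :: real
  shows "-1 < (1 - u\<^sup>2) / (1 + u\<^sup>2)" "(1 - u\<^sup>2) / (1 + u\<^sup>2) \<le> 1" "u \<noteq> 0 \<Longrightarrow> (1 - u\<^sup>2) / (1 + u\<^sup>2) < 1"
  using one_plus_square_pos[of u] by (simp_all add: divide_simps)

lemma legR_pos: "legR u > 0"
  unfolding legR_def using tan_half_bounds[of u] one_plus_square_pos[of u] legH_pos by simp

lemma DERIV_legR_legS:
  assumes "u \<noteq> 0"
  shows "(legR has_real_derivative legS u / (u * (1 + u\<^sup>2))) (at u)"
    and "(legS has_real_derivative - u * legR u) (at u)"
proof -
  define s where "s = (1 - u\<^sup>2) / (1 + u\<^sup>2)"
  define r where "r = sqrt (1 + u\<^sup>2)"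
  define c where "c = 1 + u\<^sup>2"
  have c: "c > 0" "c \<noteq> 0" unfolding c_def using one_plus_square_pos[of u] by simp_all
  have r: "r > 0" "r * r = c" unfolding r_def c_def by (simp_all add: add_pos_nonneg)
  have b: "-1 < s" "s < 1" using tan_half_bounds[of u] assms by (simp_all add: s_def)
  have u2: "u * u = c - 1" by (simp add: c_def power2_eq_square)
  have s_eq: "1 - s\<^sup>2 = 4 * u\<^sup>2 / c\<^sup>2"
    unfolding s_def c_def[symmetric] using c by (simp add: c_def divide_simps) (simp add: power2_eq_square algebra_simps)
  have ds: "((\<lambda>u. (1 - u\<^sup>2) / (1 + u\<^sup>2)) has_real_derivative - 4 * u / c\<^sup>2) (at u)"
  proof -
    have "((\<lambda>u. (1 - u\<^sup>2) / (1 + u\<^sup>2)) has_real_derivative (- (2 * u) * (1 + u\<^sup>2) - (1 - u\<^sup>2) * (2 * u)) / ((1 + u\<^sup>2) * (1 + u\<^sup>2))) (at u)"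
      by (rule derivative_eq_intros refl)+ (use c in \<open>auto simp: c_def\<close>)
    also have "(- (2 * u) * (1 + u\<^sup>2) - (1 - u\<^sup>2) * (2 * u)) / ((1 + u\<^sup>2) * (1 + u\<^sup>2)) = - 4 * u / c\<^sup>2"
      by (simp add: c_def power2_eq_square algebra_simps)
    finally show ?thesis .
  qed
  have dH: "((\<lambda>u. legH ((1 - u\<^sup>2) / (1 + u\<^sup>2))) has_real_derivative - legK s / u) (at u)"
  proof -
    have "((\<lambda>u. legH ((1 - u\<^sup>2) / (1 + u\<^sup>2))) has_real_derivative legK s / (1 - s\<^sup>2) * (- 4 * u / c\<^sup>2)) (at u)"
      unfolding s_def by (rule DERIV_chain2[OF DERIV_legH ds]) (use b in \<open>simp_all add: s_def\<close>)
    also have "legK s / (1 - s\<^sup>2) * (- 4 * u / c\<^sup>2) = - legK s / u"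
      unfolding s_eq using c assms by (simp add: divide_simps power2_eq_square)
    finally show ?thesis .
  qed
  have dK: "((\<lambda>u. legK ((1 - u\<^sup>2) / (1 + u\<^sup>2))) has_real_derivative - u * legH s / c\<^sup>2) (at u)"
  proof -
    have "((\<lambda>u. legK ((1 - u\<^sup>2) / (1 + u\<^sup>2))) has_real_derivative legH s / 4 * (- 4 * u / c\<^sup>2)) (at u)"
      unfolding s_def by (rule DERIV_chain2[OF DERIV_legK ds]) (use b in \<open>simp_all add: s_def\<close>)
    thus ?thesis by (simp add: mult.commute)
  qed
  have dr: "((\<lambda>u. sqrt (1 + u\<^sup>2)) has_real_derivative u / r) (at u)"
  proof -
    have "((\<lambda>u. sqrt (1 + u\<^sup>2)) has_real_derivative inverse (sqrt (1 + u\<^sup>2)) / 2 * (2 * u)) (at u)"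
      by (rule DERIV_chain2[where f = sqrt and g = "\<lambda>u. 1 + u\<^sup>2", OF DERIV_real_sqrt[OF one_plus_square_pos]])
         (auto intro!: derivative_eq_intros)
    thus ?thesis unfolding r_def[symmetric] by (simp add: field_simps)
  qed
  have "(legR has_real_derivative ((- legK s / u) * r - legH s * (u / r)) / (r * r)) (at u)"
    unfolding legR_def[abs_def] s_def r_def 
    by (rule DERIV_divide[OF dH[unfolded s_def] dr[unfolded r_def]]) (use r in \<open>simp add: r_def\<close>)
  also have "((- legK s / u) * r - legH s * (u / r)) / (r * r) = legS u / (u * (1 + u\<^sup>2))"
    unfolding legS_def s_def[symmetric] r_def[symmetric] unfolding c_def[symmetric]
    using r(1) assms c(2) unfolding r(2)[symmetric] by (simp add: divide_simps) (simp add: power2_eq_square algebra_simps)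
  finally show "(legR has_real_derivative legS u / (u * (1 + u\<^sup>2))) (at u)" .
  have dN: "((\<lambda>u. - (1 + u\<^sup>2) * legK ((1 - u\<^sup>2) / (1 + u\<^sup>2)) - u\<^sup>2 * legH ((1 - u\<^sup>2) / (1 + u\<^sup>2))) has_real_derivative
     (- (2 * u) * legK s + - u * legH s / c\<^sup>2 * (- c)) - (2 * u * legH s + - legK s / u * u\<^sup>2)) (at u)"
    unfolding s_def c_def
    by (rule derivative_eq_intros dH[unfolded s_def c_def] dK[unfolded s_def c_def] refl)+ simp
  have "(legS has_real_derivative (((- (2 * u) * legK s + - u * legH s / c\<^sup>2 * (- c)) - (2 * u * legH s + - legK s / u * u\<^sup>2)) * r
      - (- c * legK s - u\<^sup>2 * legH s) * (u / r)) / (r * r)) (at u)"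
    unfolding legS_def[abs_def]
    by (rule DERIV_cong[OF DERIV_divide[OF dN dr]]) (use r in \<open>simp_all add: r_def s_def c_def\<close>)
  also have "(((- (2 * u) * legK s + - u * legH s / c\<^sup>2 * (- c)) - (2 * u * legH s + - legK s / u * u\<^sup>2)) * r
      - (- c * legK s - u\<^sup>2 * legH s) * (u / r)) / (r * r) = - u * legR u"
  proof -
    have 1: "((- (2 * u) * legK s + - u * legH s / c\<^sup>2 * (- c)) - (2 * u * legH s + - legK s / u * u\<^sup>2)) = u * legH s / c - u * legK s - 2 * u * legH s"
      using assms c by (simp add: divide_simps) (simp add: power2_eq_square algebra_simps)
    have "(((u * legH s / c - u * legK s - 2 * u * legH s)) * r - (- c * legK s - u\<^sup>2 * legH s) * (u / r)) / (r * r)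
        = (u * legH s / c * (r * r) - u * legK s * (r * r) - 2 * u * legH s * (r * r) + c * legK s * u + u * (u * u) * legH s) / (r * (r * r))"
      using r(1) by (simp add: divide_simps) (simp add: power2_eq_square algebra_simps)
    also have "\<dots> = (- u * c * legH s) / (r * c)"
      unfolding r(2) u2 using c r(1) by (simp add: divide_simps) (simp add: power2_eq_square algebra_simps)
    also have "\<dots> = - u * legR u" using c r(1) unfolding legR_def s_def[symmetric] r_def[symmetric] by (simp add: divide_simps)
    finally show ?thesis unfolding 1 .
  qed
  finally show "(legS has_real_derivative - u * legR u) (at u)" .
qed

lemma continuous_on_legR_legS: "continuous_on A legR" "continuous_on A legS"
proof -
  have cHK: "continuous_on {-1<..1} legH" "continuous_on {-1<..1} legK"
    by (auto intro!: continuous_at_imp_continuous_on isCont_legH isCont_legK)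
  have nz: "1 + u\<^sup>2 \<noteq> 0" "sqrt (1 + u\<^sup>2) \<noteq> 0" for u :: real using one_plus_square_pos[of u] by simp_all
  have s: "continuous_on A (\<lambda>u::real. (1 - u\<^sup>2) / (1 + u\<^sup>2))" using nz by (auto intro!: continuous_intros)
  have H: "continuous_on A (\<lambda>u. legH ((1 - u\<^sup>2) / (1 + u\<^sup>2)))"
    by (rule continuous_on_compose2[OF cHK(1) s]) (use tan_half_bounds in auto)
  have K: "continuous_on A (\<lambda>u. legK ((1 - u\<^sup>2) / (1 + u\<^sup>2)))"
    by (rule continuous_on_compose2[OF cHK(2) s]) (use tan_half_bounds in auto)
  show "continuous_on A legR" "continuous_on A legS"
    unfolding legR_def[abs_def] legS_def[abs_def] using nz by (auto intro!: continuous_intros H K)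
qed

section \<open>Change of variables and separation\<close>

definition pp :: "real \<Rightarrow> real \<Rightarrow> real" where "pp u v = - ((u - v) / (1 - u * v))\<^sup>2 / 16"
text \<open>In angles, p = -(sin((\<alpha> - \<beta>)/2) / cos((\<alpha> + \<beta>)/2))^2 / 16 and q
  = -(sin \<alpha> sin \<beta>) / (64 cos((\<alpha> + \<beta>)/2)^4).\<close>

definition qq :: "real \<Rightarrow> real \<Rightarrow> real" where "qq u v = - (u * v * (1 + u\<^sup>2) * (1 + v\<^sup>2)) / (16 * (1 - u * v) ^ 4)"

text \<open>\<open>pp1\<close>, \<open>pp2\<close>, \<open>qq1\<close>, \<open>qq2\<close> are first
  and second derivatives in the first argument. As \<open>pp\<close> and \<open>qq\<close> are
  symmetric, exchanging the arguments gives the derivatives in the other variable.\<close>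

definition pp1 :: "real \<Rightarrow> real \<Rightarrow> real" where 
  "pp1 u v = - ((u - v) * (1 - v\<^sup>2) / (8 * (1 - u * v) ^ 3))"
definition pp2 :: "real \<Rightarrow> real \<Rightarrow> real" where 
  "pp2 u v = - ((1 - v\<^sup>2) * (1 + 2*u* v - 3* v\<^sup>2) / (8 * (1 - u * v) ^ 4))"
definition qq1 :: "real \<Rightarrow> real \<Rightarrow> real" where 
  "qq1 u v = - (v * (1 + v\<^sup>2) * (1 + 3*u\<^sup>2 + 3*u* v + u^3* v) / (16 * (1 - u * v) ^ 5))"
definition qq2 :: "real \<Rightarrow> real \<Rightarrow> real" where 
  "qq2 u v = - (v * (1 + v\<^sup>2) * (6*u + 8* v + 12*u\<^sup>2* v + 12*u* v\<^sup>2 + 2*u^3* v\<^sup>2) / (16 * (1 - u * v) ^ 6))"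

lemma DERIV_quot_power:
  fixes f :: "real \<Rightarrow> real"
  assumes "(f has_real_derivative f') (at u)" "1 - u * v \<noteq> 0"
  shows "((\<lambda>u. f u / (1 - u * v) ^ n) has_real_derivative (f' * (1 - u * v) + real n * v * f u) / (1 - u * v) ^ Suc n) (at u)"
proof -
  define c where "c = 1 - u * v"
  have c: "c \<noteq> 0" using assms by (simp add: c_def)
  have dc: "((\<lambda>u. (1 - u * v) ^ n) has_real_derivative real n * c ^ (n - 1) * (- v)) (at u)"
    unfolding c_def by (rule derivative_eq_intros refl)+ (simp add: mult_ac)
  have "((\<lambda>u. f u / (1 - u * v) ^ n) has_real_derivative (f' * c ^ n - f u * (real n * c ^ (n - 1) * (- v))) / (c ^ n * c ^ n)) (at u)"
    unfolding c_def by (rule DERIV_divide[OF assms(1) dc[unfolded c_def]]) (use assms in simp)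
  also have "(f' * c ^ n - f u * (real n * c ^ (n - 1) * (- v))) / (c ^ n * c ^ n) = (f' * c + real n * v * f u) / c ^ Suc n"
  proof (cases n)
    case (Suc k)
    have "(f' * c ^ n - f u * (real n * c ^ (n - 1) * (- v))) = c ^ k * (f' * c + real n * v * f u)"
      by (simp add: Suc algebra_simps)
    moreover have "c ^ n * c ^ n = c ^ k * c ^ Suc n" by (simp add: Suc)
    ultimately show ?thesis using c by (simp only: mult_divide_mult_cancel_left power_not_zero[OF c] simp_thms) 
  qed (use c in simp)
  finally show ?thesis by (simp add: c_def)
qed

lemma DERIV_pp_qq:
  assumes c: "1 - u * v \<noteq> 0"
  shows "((\<lambda>u. pp u v) has_real_derivative pp1 u v) (at u)"
    and "((\<lambda>u. pp1 u v) has_real_derivative pp2 u v) (at u)"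
    and "((\<lambda>u. qq u v) has_real_derivative qq1 u v) (at u)"
    and "((\<lambda>u. qq1 u v) has_real_derivative qq2 u v) (at u)"
proof -
  have pp: "pp = (\<lambda>u v. (- ((u - v)\<^sup>2 / 16)) / (1 - u * v) ^ 2)"
    by (intro ext) (simp add: pp_def power_divide)
  have qq: "qq = (\<lambda>u v. (- (u * v * (1 + u\<^sup>2) * (1 + v\<^sup>2) / 16)) / (1 - u * v) ^ 4)"
    by (intro ext) (simp add: qq_def)
  have pp1: "pp1 = (\<lambda>u v. (- ((u - v) * (1 - v\<^sup>2) / 8)) / (1 - u * v) ^ 3)"
    by (intro ext) (simp add: pp1_def)
  have qq1: "qq1 = (\<lambda>u v. (- (v * (1 + v\<^sup>2) * (1 + 3*u\<^sup>2 + 3*u* v + u^3* v) / 16)) / (1 - u * v) ^ 5)"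
    by (intro ext) (simp add: qq1_def)
  have "((\<lambda>u. - ((u - v)\<^sup>2 / 16)) has_real_derivative - ((u - v) / 8)) (at u)"
    by (auto intro!: derivative_eq_intros)
  from DERIV_quot_power[OF this c, of 2] show "((\<lambda>u. pp u v) has_real_derivative pp1 u v) (at u)"
    unfolding pp by (rule DERIV_cong) (use c in \<open>simp add: pp1_def divide_simps; simp add: algebra_simps eval_nat_numeral\<close>)
  have "((\<lambda>u. - (u * v * (1 + u\<^sup>2) * (1 + v\<^sup>2) / 16)) has_real_derivative - (v * (1 + 3 * u\<^sup>2) * (1 + v\<^sup>2) / 16)) (at u)"
    by (auto intro!: derivative_eq_intros simp: algebra_simps eval_nat_numeral)
  from DERIV_quot_power[OF this c, of 4] show "((\<lambda>u. qq u v) has_real_derivative qq1 u v) (at u)"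
    unfolding qq by (rule DERIV_cong) (use c in \<open>simp add: qq1_def divide_simps; simp add: algebra_simps eval_nat_numeral\<close>)
  have "((\<lambda>u. - ((u - v) * (1 - v\<^sup>2) / 8)) has_real_derivative - ((1 - v\<^sup>2) / 8)) (at u)"
    by (auto intro!: derivative_eq_intros simp: field_simps)
  from DERIV_quot_power[OF this c, of 3] show "((\<lambda>u. pp1 u v) has_real_derivative pp2 u v) (at u)"
    unfolding pp1 by (rule DERIV_cong) (use c in \<open>simp add: pp2_def divide_simps; simp add: algebra_simps eval_nat_numeral\<close>)
  have "((\<lambda>u. - (v * (1 + v\<^sup>2) * (1 + 3*u\<^sup>2 + 3*u* v + u^3* v) / 16)) has_real_derivative - (v * (1 + v\<^sup>2) * (6*u + 3* v + 3*u\<^sup>2* v) / 16)) (at u)"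
    by (auto intro!: derivative_eq_intros simp: algebra_simps eval_nat_numeral)
  from DERIV_quot_power[OF this c, of 5] show "((\<lambda>u. qq1 u v) has_real_derivative qq2 u v) (at u)"
    unfolding qq1 by (rule DERIV_cong) (use c in \<open>simp add: qq2_def divide_simps; simp add: algebra_simps eval_nat_numeral\<close>)
qed

text \<open>The rectangle contains the evaluation point, u about 0.516 and v about 0.0001, and its
  image stays in the bidisc of \<open>dconv_sun_coeff\<close>.\<close>

lemma pp_qq_bounds:
  assumes "0 \<le> u" "u < 53/100" "0 \<le> v" "v < 1/1000"
  shows "\<bar>pp u v\<bar> < 1/50" "\<bar>qq u v\<bar> < 1/10000" "1 - u * v > 999/1000"
proof -
  have uv: "0 \<le> u * v" "u * v \<le> 53/100 * (1/1000)" using assms mult_mono[of u "53/100" v "1/1000"] by simp_all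
  thus c: "1 - u * v > 999/1000" by simp
  have u2: "u\<^sup>2 \<le> (53/100)\<^sup>2" and v2: "v\<^sup>2 \<le> (1/1000)\<^sup>2" using assms by (auto intro!: power_mono)
  have "\<bar>(u - v) / (1 - u * v)\<bar> \<le> 531/1000"
  proof -
    have uv': "\<bar>u - v\<bar> \<le> 53/100" using assms by linarith
    have "\<bar>(u - v) / (1 - u * v)\<bar> = \<bar>u - v\<bar> / (1 - u * v)" using c by (simp add: abs_divide)
    also have "\<dots> \<le> (53/100) / (999/1000)" using uv' c by (intro frac_le) auto
    finally show ?thesis by simp
  qed
  hence "((u - v) / (1 - u * v))\<^sup>2 \<le> (531/1000)\<^sup>2" by (simp add: abs_le_square_iff[symmetric])
  moreover have "(531/1000)\<^sup>2 < (16/50 :: real)" by (simp add: power2_eq_square)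
  moreover have "((u - v) / (1 - u * v))\<^sup>2 \<ge> 0" by simp
  ultimately show "\<bar>pp u v\<bar> < 1/50" unfolding pp_def by linarith
  have c4: "(1 - u * v) ^ 4 \<ge> (999/1000) ^ 4" using c by (intro power_mono) auto
  have "u * v * (1 + u\<^sup>2) * (1 + v\<^sup>2) \<le> (53/100 * (1/1000)) * (1 + (53/100)\<^sup>2) * (1 + (1/1000)\<^sup>2)"
    using uv u2 v2 assms by (intro mult_mono) auto
  also have "\<dots> < 1/10000 * (16 * (999/1000) ^ 4)" by (simp add: power2_eq_square eval_nat_numeral)
  also have "\<dots> \<le> 1/10000 * (16 * (1 - u * v) ^ 4)" using c4 by simp
  finally have "u * v * (1 + u\<^sup>2) * (1 + v\<^sup>2) < 1/10000 * (16 * (1 - u * v) ^ 4)" .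
  moreover have "16 * (1 - u * v) ^ 4 > 0" using c by simp
  ultimately have "u * v * (1 + u\<^sup>2) * (1 + v\<^sup>2) / (16 * (1 - u * v) ^ 4) < 1/10000" 
    by (simp add: pos_divide_less_eq)
  moreover have "u * v * (1 + u\<^sup>2) * (1 + v\<^sup>2) / (16 * (1 - u * v) ^ 4) \<ge> 0" using uv c by simp
  ultimately show "\<bar>qq u v\<bar> < 1/10000" unfolding qq_def by simp
qed

text \<open>
  In the coordinates \<open>(u, v)\<close>, the Legendre operator in \<open>u\<close> is a combination of the two 
  partial differential equations; the multipliers \<open>A1\<close>, \<open>A2\<close> were found by comparing the 
  coefficients of the second derivatives.
\<close>

lemma Legendre_operator_coeffs:
  fixes u v :: real
  assumes c: "1 - u * v \<noteq> 0"
  defines "c \<equiv> 1 - u * v" and "p \<equiv> pp u v" and "q \<equiv> qq u v"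
  defines "A1 \<equiv> - ((u + v) * (1 + u * v) / (4 * c ^ 3))"
    and "A2 \<equiv> - (v * (1 + v\<^sup>2) * (1 - u\<^sup>2)\<^sup>2 / (16 * c ^ 5))"
    and "a0 \<equiv> u * (1 + u\<^sup>2) / c" and "a1 \<equiv> (1 + 3*u\<^sup>2) / c + 2 * u * (1 + u\<^sup>2) * v / c\<^sup>2"
  shows "(1 + 3*u\<^sup>2) * v / c\<^sup>2 + 2 * u * (1 + u\<^sup>2) * v\<^sup>2 / c ^ 3 + u / c = - 4 * A1"
    and "a1 * pp1 u v + a0 * pp2 u v = A1 * (1 - 32 * p) - 6 * A2"
    and "a1 * qq1 u v + a0 * qq2 u v = A1 * (- 56 * q) + A2"
    and "a0 * (pp1 u v)\<^sup>2 = A1 * (p - 16 * p\<^sup>2) - 4 * A2 * p"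
    and "a0 * (2 * pp1 u v * qq1 u v) = A1 * (q - 48 * p * q) - 8 * A2 * q"
    and "a0 * (qq1 u v)\<^sup>2 = A1 * (- 32 * q\<^sup>2) + A2 * q"
proof -
  have c0: "c \<noteq> 0" using c by (simp add: c_def)
  define i where "i = 1 / c"
  define U V W D E S B X Y where "U = 1 + u\<^sup>2" and "V = 1 + v\<^sup>2" and "W = 1 - v\<^sup>2" and "D = u - v"
    and "E = 1 + 3*u\<^sup>2 + 3*u* v + u^3* v" and "S = (u + v) * (1 + u * v)" and "B = (1 - u\<^sup>2)\<^sup>2"
    and "X = 1 + 2*u* v - 3* v\<^sup>2" and "Y = 6*u + 8* v + 12*u\<^sup>2* v + 12*u* v\<^sup>2 + 2*u^3* v\<^sup>2"
  note defs = U_def V_def W_def D_def E_def S_def B_def X_def Y_def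
  have i: "x / c ^ n = x * i ^ n" "x / (k * c ^ n) = x / k * i ^ n" "x / c = x * i" "(c * i) ^ n = 1" for x k :: real and n
    using c0 by (simp_all add: i_def power_divide)
  have p: "p = - (D\<^sup>2 / 16 * i\<^sup>2)" and q: "q = - (u * v * U * V / 16 * i ^ 4)"
    unfolding i(2)[symmetric] defs by (simp_all add: p_def q_def pp_def qq_def c_def power_divide)
  have p1: "pp1 u v = - (D * W / 8 * i ^ 3)" and p2: "pp2 u v = - (W * X / 8 * i ^ 4)"
   and q1: "qq1 u v = - (v * V * E / 16 * i ^ 5)" and q2: "qq2 u v = - (v * V * Y / 16 * i ^ 6)"
    unfolding i(2)[symmetric] defs by (simp_all add: pp1_def pp2_def qq1_def qq2_def c_def)
  have A1: "A1 = - (S / 4 * i ^ 3)" and A2: "A2 = - (v * V * B / 16 * i ^ 5)"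
    unfolding A1_def A2_def i defs by simp_all
  define Z where "Z = (1 + 3*u\<^sup>2) * c + 2 * u * U * v"
  have a0: "a0 = u * U * i" and a1: "a1 = Z * i\<^sup>2"
    unfolding a0_def a1_def Z_def defs using c0 by (simp_all add: i_def power2_eq_square add_divide_distrib)
  have "(1 + 3*u\<^sup>2) * v / c\<^sup>2 + 2 * u * (1 + u\<^sup>2) * v\<^sup>2 / c ^ 3 + u / c 
      = ((1 + 3*u\<^sup>2) * v * c + 2 * u * (1 + u\<^sup>2) * v\<^sup>2 + u * c\<^sup>2) * i ^ 3"
    using c0 by (simp add: i_def divide_simps) (simp add: algebra_simps eval_nat_numeral)
  also have "(1 + 3*u\<^sup>2) * v * c + 2 * u * (1 + u\<^sup>2) * v\<^sup>2 + u * c\<^sup>2 = S"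
    by (simp add: c_def S_def algebra_simps eval_nat_numeral)
  finally show "(1 + 3*u\<^sup>2) * v / c\<^sup>2 + 2 * u * (1 + u\<^sup>2) * v\<^sup>2 / c ^ 3 + u / c = - 4 * A1"
    by (simp add: A1)
  \<comment> \<open>The polynomial identity behind the claim. It is scaled by a power of
    \<open>i\<close>; the factor \<open>(c * i)\<^sup>2\<close>, equal to 1, brings all terms to the
    same power. The remaining claims follow this pattern.\<close>
  have "2 * (Z * D + u * U * X) * W = 4 * S * (c\<^sup>2 + 2 * D\<^sup>2) - 6 * v * V * B"
    by (simp add: c_def defs Z_def algebra_simps eval_nat_numeral)
  from arg_cong[OF this, of "\<lambda>x. - x / 16 * i ^ 5"]
  have "a1 * pp1 u v + a0 * pp2 u v = A1 * ((c * i)\<^sup>2 - 32 * p) - 6 * A2"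
    unfolding A1 A2 a0 a1 p p1 p2 by (simp add: field_simps eval_nat_numeral)
  thus "a1 * pp1 u v + a0 * pp2 u v = A1 * (1 - 32 * p) - 6 * A2" unfolding i .
  have "Z * E + u * U * Y = 14 * S * u * U + B * c\<^sup>2"
    by (simp add: c_def defs Z_def algebra_simps eval_nat_numeral)
  from arg_cong[OF this, of "\<lambda>x. - x * v * V / 16 * i ^ 7"]
  have "a1 * qq1 u v + a0 * qq2 u v = A1 * (- 56 * q) + A2 * (c * i)\<^sup>2"
    unfolding A1 A2 a0 a1 q q1 q2 by (simp add: field_simps eval_nat_numeral)
  thus "a1 * qq1 u v + a0 * qq2 u v = A1 * (- 56 * q) + A2" unfolding i by simp
  have "u * U * W\<^sup>2 = S * (c\<^sup>2 + D\<^sup>2) - v * V * B"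
    by (simp add: c_def defs algebra_simps eval_nat_numeral)
  from arg_cong[OF this, of "\<lambda>x. x * D\<^sup>2 / 64 * i ^ 7"]
  have "a0 * (pp1 u v)\<^sup>2 = A1 * (p * (c * i)\<^sup>2 - 16 * p\<^sup>2) - 4 * A2 * p"
    unfolding A1 A2 a0 p p1 by (simp add: field_simps eval_nat_numeral)
  thus "a0 * (pp1 u v)\<^sup>2 = A1 * (p - 16 * p\<^sup>2) - 4 * A2 * p" unfolding i by simp
  have "D * W * E = S * (c\<^sup>2 + 3 * D\<^sup>2) - 2 * v * V * B"
    by (simp add: c_def defs algebra_simps eval_nat_numeral)
  from arg_cong[OF this, of "\<lambda>x. x * u * U * v * V / 64 * i ^ 9"]
  have "a0 * (2 * pp1 u v * qq1 u v) = A1 * (q * (c * i)\<^sup>2 - 48 * p * q) - 8 * A2 * q"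
    unfolding A1 A2 a0 p p1 q q1 by (simp add: field_simps eval_nat_numeral)
  thus "a0 * (2 * pp1 u v * qq1 u v) = A1 * (q - 48 * p * q) - 8 * A2 * q" unfolding i by simp
  have "E\<^sup>2 = 8 * S * u * U + B * c\<^sup>2"
    by (simp add: c_def defs algebra_simps eval_nat_numeral)
  from arg_cong[OF this, of "\<lambda>x. x * u * U * v\<^sup>2 * V\<^sup>2 / 256 * i ^ 11"]
  have "a0 * (qq1 u v)\<^sup>2 = A1 * (- 32 * q\<^sup>2) + A2 * q * (c * i)\<^sup>2"
    unfolding A1 A2 a0 q q1 by (simp add: field_simps eval_nat_numeral)
  thus "a0 * (qq1 u v)\<^sup>2 = A1 * (- 32 * q\<^sup>2) + A2 * q" unfolding i by simp
qed

text \<open>For fixed v, the function G / (1 - u v) and its flux solve the system of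
  \<open>legR\<close> and \<open>legS\<close>. Both fluxes vanish at u = 0, so the two solutions are
  proportional there and hence everywhere.\<close>

lemma double_series_separation:
  assumes u: "0 \<le> u" "u < 53/100" and v: "0 \<le> v" "v < 1/1000"
  shows "dps sun_coeff (pp u v) (qq u v) = (1 - u * v) * (dps sun_coeff (pp 0 v) (qq 0 v) * legR u)"
proof -
  let ?S = "{0..<53/100::real}"
  define c where "c = (\<lambda>u. 1 - u * v)"
  define G Gp Gq Gpp Gpq Gqq where "G = (\<lambda>u. dps sun_coeff (pp u v) (qq u v))"
    and "Gp = (\<lambda>u. dps (dshift sun_coeff) (pp u v) (qq u v))" and "Gq = (\<lambda>u. dps (dshift2 sun_coeff) (pp u v) (qq u v))"
    and "Gpp = (\<lambda>u. dps (dshift (dshift sun_coeff)) (pp u v) (qq u v))" 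
    and "Gpq = (\<lambda>u. dps (dshift2 (dshift sun_coeff)) (pp u v) (qq u v))"
    and "Gqq = (\<lambda>u. dps (dshift2 (dshift2 sun_coeff)) (pp u v) (qq u v))"
  define G1 where "G1 = (\<lambda>u. Gp u * pp1 u v + Gq u * qq1 u v)"
  define g where "g = (\<lambda>u. G u / c u)"
  define H where "H = (\<lambda>u. u * (1 + u\<^sup>2) * (G1 u / c u + v * G u / (c u)\<^sup>2))"
  have dg: "(g has_real_derivative G1 x / c x + v * G x / (c x)\<^sup>2) (at x)"
   and dH: "(H has_real_derivative - x * g x) (at x)" if x: "x \<in> ?S" for x
  proof -
    have b: "\<bar>pp x v\<bar> < 1/50" "\<bar>qq x v\<bar> < 1/10000" and c1: "1 - x * v > 999/1000"
      using pp_qq_bounds[of x v] x v by auto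
    have c0: "c x \<noteq> 0" using c1 by (simp add: c_def)
    note D = DERIV_pp_qq[OF c0[unfolded c_def]]
    note dr = dconv_sun_coeff dconv_dshift[OF dconv_sun_coeff] dconv_dshift2[OF dconv_sun_coeff]
    have dG: "(G has_real_derivative G1 x) (at x)"
      unfolding G_def G1_def Gp_def Gq_def by (rule DERIV_dps_curve[OF dr(1) b D(1,3)])
    have dGp: "(Gp has_real_derivative (Gpp x * pp1 x v + Gpq x * qq1 x v)) (at x)"
      unfolding Gp_def Gpp_def Gpq_def by (rule DERIV_dps_curve[OF dr(2) b D(1,3)])
    have dGq: "(Gq has_real_derivative (Gpq x * pp1 x v + Gqq x * qq1 x v)) (at x)"
      unfolding Gq_def Gpq_def Gqq_def dshift_dshift2[symmetric] by (rule DERIV_dps_curve[OF dr(3) b D(1,3)])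
    have dc: "(c has_real_derivative - v) (at x)"
      unfolding c_def by (auto intro!: derivative_eq_intros)
    define G2 where "G2 = (Gpp x * pp1 x v + Gpq x * qq1 x v) * pp1 x v + Gp x * pp2 x v
      + ((Gpq x * pp1 x v + Gqq x * qq1 x v) * qq1 x v + Gq x * qq2 x v)"
    have dG1: "(G1 has_real_derivative G2) (at x)"
      unfolding G1_def by (rule derivative_eq_intros dGp dGq D refl)+ (simp add: G2_def)
    show "(g has_real_derivative G1 x / c x + v * G x / (c x)\<^sup>2) (at x)"
      unfolding g_def by (rule DERIV_cong[OF DERIV_divide[OF dG dc c0]]) (use c0 in \<open>simp add: field_simps power2_eq_square\<close>)
    have dq1: "((\<lambda>u. G1 u / c u) has_real_derivative G2 / c x + v * G1 x / (c x)\<^sup>2) (at x)"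
      by (rule DERIV_cong[OF DERIV_divide[OF dG1 dc c0]]) (use c0 in \<open>simp add: field_simps power2_eq_square\<close>)
    have dc2: "((\<lambda>u. (c u)\<^sup>2) has_real_derivative - 2 * v * c x) (at x)"
      by (rule DERIV_cong[OF DERIV_power[OF dc]]) simp
    have dvG: "((\<lambda>u. v * G u) has_real_derivative v * G1 x) (at x)"
      by (rule DERIV_cmult[OF dG])
    have c02: "(c x)\<^sup>2 \<noteq> 0" using c0 by simp
    have dq2: "((\<lambda>u. v * G u / (c u)\<^sup>2) has_real_derivative v * G1 x / (c x)\<^sup>2 + 2 * v\<^sup>2 * G x / (c x) ^ 3) (at x)"
      by (rule DERIV_cong[OF DERIV_divide[OF dvG dc2 c02]]) (use c0 in \<open>simp add: field_simps eval_nat_numeral\<close>)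
    have da: "((\<lambda>u. u * (1 + u\<^sup>2)) has_real_derivative 1 + 3 * x\<^sup>2) (at x)"
      by (auto intro!: derivative_eq_intros simp: algebra_simps power2_eq_square)
    define a0 a1 A1 A2 where "a0 = x * (1 + x\<^sup>2) / c x" and "a1 = (1 + 3*x\<^sup>2) / c x + 2 * x * (1 + x\<^sup>2) * v / (c x)\<^sup>2"
      and "A1 = - ((x + v) * (1 + x * v) / (4 * (c x) ^ 3))"
      and "A2 = - (v * (1 + v\<^sup>2) * (1 - x\<^sup>2)\<^sup>2 / (16 * (c x) ^ 5))"
    define p q where "p = pp x v" and "q = qq x v"
    have L: "(1 + 3*x\<^sup>2) * v / (c x)\<^sup>2 + 2 * x * (1 + x\<^sup>2) * v\<^sup>2 / (c x) ^ 3 + x / c x = - 4 * A1"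
      "a1 * pp1 x v + a0 * pp2 x v = A1 * (1 - 32 * p) - 6 * A2"
      "a1 * qq1 x v + a0 * qq2 x v = A1 * (- 56 * q) + A2"
      "a0 * (pp1 x v)\<^sup>2 = A1 * (p - 16 * p\<^sup>2) - 4 * A2 * p"
      "a0 * (2 * pp1 x v * qq1 x v) = A1 * (q - 48 * p * q) - 8 * A2 * q"
      "a0 * (qq1 x v)\<^sup>2 = A1 * (- 32 * q\<^sup>2) + A2 * q"
      unfolding a0_def a1_def A1_def A2_def p_def q_def c_def 
      by (rule Legendre_operator_coeffs[OF c0[unfolded c_def]])+
    have E1: "Gp x + p * Gpp x + q * Gpq x - 4 * (8 * q\<^sup>2 * Gqq x + 12 * p * q * Gpq x + 4 * p\<^sup>2 * Gpp x + 14 * q * Gq x + 8 * p * Gp x + G x) = 0"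
      and E2: "Gq x + q * Gqq x - 2 * (4 * q * Gpq x + 2 * p * Gpp x + 3 * Gp x) = 0"
      using sun_coeff_PDE[OF b] unfolding p_def q_def G_def Gp_def Gq_def Gpp_def Gpq_def Gqq_def by auto
    have "(H has_real_derivative (1 + 3 * x\<^sup>2) * (G1 x / c x + v * G x / (c x)\<^sup>2) 
        + (G2 / c x + v * G1 x / (c x)\<^sup>2 + (v * G1 x / (c x)\<^sup>2 + 2 * v\<^sup>2 * G x / (c x) ^ 3)) * (x * (1 + x\<^sup>2))) (at x)"
      unfolding H_def by (rule DERIV_mult[OF da DERIV_add[OF dq1 dq2]])
    also have "(1 + 3 * x\<^sup>2) * (G1 x / c x + v * G x / (c x)\<^sup>2) 
        + (G2 / c x + v * G1 x / (c x)\<^sup>2 + (v * G1 x / (c x)\<^sup>2 + 2 * v\<^sup>2 * G x / (c x) ^ 3)) * (x * (1 + x\<^sup>2))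
      = ((1 + 3*x\<^sup>2) * v / (c x)\<^sup>2 + 2 * x * (1 + x\<^sup>2) * v\<^sup>2 / (c x) ^ 3) * G x + a1 * G1 x + a0 * G2"
      unfolding a0_def a1_def using c0 by (simp add: divide_simps) (simp add: algebra_simps eval_nat_numeral)
    \<comment> \<open>Sorted by partial derivatives of the series, each coefficient is a left side
      of \<open>L\<close>. The term \<open>x / c x * G x\<close> is added and subtracted so that the
      order-zero part matches too.\<close>
    also have "\<dots> = ((1 + 3*x\<^sup>2) * v / (c x)\<^sup>2 + 2 * x * (1 + x\<^sup>2) * v\<^sup>2 / (c x) ^ 3 + x / c x) * G x
       + (a1 * pp1 x v + a0 * pp2 x v) * Gp x + (a1 * qq1 x v + a0 * qq2 x v) * Gq x
       + (a0 * (pp1 x v)\<^sup>2) * Gpp x + (a0 * (2 * pp1 x v * qq1 x v)) * Gpq x + (a0 * (qq1 x v)\<^sup>2) * Gqq x - x / c x * G x"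
      unfolding G1_def G2_def by (simp add: algebra_simps power2_eq_square)
    also have "\<dots> = A1 * (Gp x + p * Gpp x + q * Gpq x - 4 * (8 * q\<^sup>2 * Gqq x + 12 * p * q * Gpq x + 4 * p\<^sup>2 * Gpp x + 14 * q * Gq x + 8 * p * Gp x + G x))
       + A2 * (Gq x + q * Gqq x - 2 * (4 * q * Gpq x + 2 * p * Gpp x + 3 * Gp x)) - x / c x * G x"
      unfolding L by (simp add: algebra_simps)
    also have "\<dots> = - x * g x" unfolding E1 E2 g_def by simp
    finally show "(H has_real_derivative - x * g x) (at x)" .
  qed
  have nz: "x * (1 + x\<^sup>2) \<noteq> 0" if "x \<noteq> 0" for x :: real using that one_plus_square_pos[of x] by simp
  have "g u = g 0 / legR 0 * legR u"
  proof (rule flux_unique(1)[where S = ?S and e = 0 and f = legR and F = legS and g = g and G = H 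
        and a = "\<lambda>u. u * (1 + u\<^sup>2)" and b = "\<lambda>u. - u"])
    show "continuous_on ?S g" "continuous_on ?S H"
      by (intro continuous_at_imp_continuous_on ballI DERIV_isCont[OF dg] DERIV_isCont[OF dH]; assumption)+
    show "(g has_real_derivative H x / (x * (1 + x\<^sup>2))) (at x)" if "x \<in> ?S - {0}" for x
      using dg[of x] that nz[of x] unfolding H_def by simp
    show "(H has_real_derivative - x * g x) (at x)" if "x \<in> ?S - {0}" for x
      using dH[of x] that by simp
    show "legR x \<noteq> 0" for x using legR_pos[of x] by simp
    show "(legR has_real_derivative legS x / (x * (1 + x\<^sup>2))) (at x)" if "x \<in> ?S - {0}" for x
      using DERIV_legR_legS(1)[of x] that by simp
    show "(legS has_real_derivative - x * legR x) (at x)" if "x \<in> ?S - {0}" for x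
      using DERIV_legR_legS(2)[of x] that by simp
  qed (use u in \<open>auto simp: H_def continuous_on_legR_legS\<close>)
  moreover have "1 - u * v \<noteq> 0" using pp_qq_bounds(3)[OF u v] by linarith
  ultimately show ?thesis unfolding g_def G_def c_def by (simp add: field_simps)
qed

text \<open>By symmetry the slice u = 0 is the slice with v in first place and 0 in second, so
  separation applies to it again.\<close>

lemma double_series_product:
  assumes u: "0 \<le> u" "u < 53/100" and v: "0 \<le> v" "v < 1/1000"
  shows "dps sun_coeff (pp u v) (qq u v) = (1 - u * v) * legR u * legR v"
proof -
  have "pp 0 v = pp v 0" "qq 0 v = qq v 0" by (simp_all add: pp_def qq_def)
  hence "dps sun_coeff (pp 0 v) (qq 0 v) = dps sun_coeff (pp v 0) (qq v 0)" by simp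
  also have "\<dots> = legR v"
    using double_series_separation[of v 0] v by (simp add: pp_def qq_def dps_sun_coeff_0)
  finally show ?thesis using double_series_separation[OF u v] by simp
qed

section \<open>The derivative in z and its trigonometric coefficients\<close>

lemma qq_commute: "qq v u = qq u v" and pp_commute: "pp v u = pp u v"
  by (simp_all add: pp_def qq_def power2_commute[of u v] power_divide mult_ac)

text \<open>At fixed y, z d/dz is p d/dp + 2 q d/dq. Assumptions \<open>P\<close> and
  \<open>Q\<close> say that X u d/du + Y v d/dv takes log |p| to 1 and log |q| to 2, so it is the
  same operator, and it can be applied to the product formula.\<close>

lemma dps_directional_derivative:
  fixes u v X Y :: real
  assumes v: "0 < v" "v < 1/1000" and u: "v < u" "u < 53/100"
  defines "c \<equiv> 1 - u * v"
  assumes P: "X * (2 * u * (1 - v\<^sup>2) / ((u - v) * c)) - Y * (2 * v * (1 - u\<^sup>2) / ((u - v) * c)) = 1"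
    and Q: "X * ((1 + 3*u\<^sup>2 + 3*u* v + u^3* v) / ((1 + u\<^sup>2) * c)) + Y * ((1 + 3* v\<^sup>2 + 3* v * u + v^3*u) / ((1 + v\<^sup>2) * c)) = 2"
  shows "pp u v * dps (dshift sun_coeff) (pp u v) (qq u v) + 2 * (qq u v * dps (dshift2 sun_coeff) (pp u v) (qq u v))
       = X * (c * legS u * legR v / (1 + u\<^sup>2) - u * v * legR u * legR v)
       + Y * (c * legS v * legR u / (1 + v\<^sup>2) - u * v * legR u * legR v)"
proof -
  define p q where "p = pp u v" and "q = qq u v"
  define Gp Gq where "Gp = dps (dshift sun_coeff) p q" and "Gq = dps (dshift2 sun_coeff) p q"
  have b: "\<bar>pp u v\<bar> < 1/50" "\<bar>qq u v\<bar> < 1/10000" and c1: "1 - u * v > 999/1000"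
    using pp_qq_bounds[of u v] u v by auto
  have c0: "c \<noteq> 0" using c1 by (simp add: c_def)
  have c': "1 - v * u \<noteq> 0" using c0 by (simp add: c_def mult.commute)
  have nz: "u \<noteq> 0" "v \<noteq> 0" "u - v \<noteq> 0" "1 + u\<^sup>2 \<noteq> 0" "1 + v\<^sup>2 \<noteq> 0"
    using u v one_plus_square_pos[of u] one_plus_square_pos[of v] by auto
  have "((\<lambda>u. dps sun_coeff (pp u v) (qq u v)) has_real_derivative Gp * pp1 u v + Gq * qq1 u v) (at u)"
    unfolding Gp_def Gq_def p_def q_def 
    by (rule DERIV_dps_curve[OF dconv_sun_coeff b DERIV_pp_qq(1,3)[OF c0[unfolded c_def]]])
  moreover have "((\<lambda>u. dps sun_coeff (pp u v) (qq u v)) has_real_derivative 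
      - v * legR u * legR v + c * (legS u / (u * (1 + u\<^sup>2))) * legR v) (at u)"
  proof (rule has_field_derivative_transform_within_open[of "\<lambda>u. (1 - u * v) * legR u * legR v" _ _ "{0<..<53/100}"])
    show "((\<lambda>u. (1 - u * v) * legR u * legR v) has_real_derivative - v * legR u * legR v + c * (legS u / (u * (1 + u\<^sup>2))) * legR v) (at u)"
      by (rule derivative_eq_intros DERIV_legR_legS(1)[OF nz(1)] refl)+ (simp add: c_def algebra_simps)
  qed (use u v in \<open>auto intro!: double_series_product[symmetric]\<close>)
  ultimately have Du: "Gp * pp1 u v + Gq * qq1 u v = - v * legR u * legR v + c * (legS u / (u * (1 + u\<^sup>2))) * legR v"
    by (rule DERIV_unique)
  have "((\<lambda>v. dps sun_coeff (pp v u) (qq v u)) has_real_derivative Gp * pp1 v u + Gq * qq1 v u) (at v)"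
  proof -
    have "\<bar>pp v u\<bar> < 1/50" "\<bar>qq v u\<bar> < 1/10000" using b by (simp_all only: pp_commute[of v u] qq_commute[of v u])
    from DERIV_dps_curve[OF dconv_sun_coeff this DERIV_pp_qq(1,3)[OF c']] show ?thesis
      unfolding Gp_def Gq_def p_def q_def pp_commute[of v u] qq_commute[of v u] .
  qed
  moreover have "((\<lambda>v. dps sun_coeff (pp v u) (qq v u)) has_real_derivative 
      - u * legR u * legR v + c * legR u * (legS v / (v * (1 + v\<^sup>2)))) (at v)"
  proof (rule has_field_derivative_transform_within_open[of "\<lambda>v. (1 - u * v) * legR u * legR v" _ _ "{0<..<1/1000}"])
    show "((\<lambda>v. (1 - u * v) * legR u * legR v) has_real_derivative - u * legR u * legR v + c * legR u * (legS v / (v * (1 + v\<^sup>2)))) (at v)"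
      by (rule derivative_eq_intros DERIV_legR_legS(1)[OF nz(2)] refl)+ (simp add: c_def algebra_simps)
    fix x :: real assume "x \<in> {0<..<1/1000}"
    thus "(1 - u * x) * legR u * legR x = dps sun_coeff (pp x u) (qq x u)"
      using double_series_product[of u x] u v by (simp add: pp_commute[of x u] qq_commute[of x u])
  qed (use u v in auto)
  ultimately have Dv: "Gp * pp1 v u + Gq * qq1 v u = - u * legR u * legR v + c * legR u * (legS v / (v * (1 + v\<^sup>2)))"
    by (rule DERIV_unique)
  have p1: "u * pp1 u v = p * (2 * u * (1 - v\<^sup>2) / ((u - v) * c))" 
    and p2: "v * pp1 v u = - p * (2 * v * (1 - u\<^sup>2) / ((u - v) * c))"
    using nz(3) c0 unfolding p_def pp_def pp1_def mult.commute[of v u] c_def[symmetric]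
    by (simp add: divide_simps; simp add: power2_eq_square power3_eq_cube algebra_simps)+
  have q1: "u * qq1 u v = q * ((1 + 3*u\<^sup>2 + 3*u* v + u^3* v) / ((1 + u\<^sup>2) * c))"
    and q2: "v * qq1 v u = q * ((1 + 3* v\<^sup>2 + 3* v * u + v^3*u) / ((1 + v\<^sup>2) * c))"
    using nz c0 unfolding q_def qq_def qq1_def mult.commute[of v u] c_def[symmetric] by (simp_all add: divide_simps) (simp_all add: eval_nat_numeral)
  have "p * Gp + 2 * (q * Gq) = Gp * (X * (u * pp1 u v) + Y * (v * pp1 v u)) + Gq * (X * (u * qq1 u v) + Y * (v * qq1 v u))"
  proof -
    have "X * (u * pp1 u v) + Y * (v * pp1 v u) = p * (X * (2 * u * (1 - v\<^sup>2) / ((u - v) * c)) - Y * (2 * v * (1 - u\<^sup>2) / ((u - v) * c)))"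
      unfolding p1 p2 by (simp only: right_diff_distrib) (simp add: mult_ac)
    moreover have "X * (u * qq1 u v) + Y * (v * qq1 v u) = q * (X * ((1 + 3*u\<^sup>2 + 3*u* v + u^3* v) / ((1 + u\<^sup>2) * c)) + Y * ((1 + 3* v\<^sup>2 + 3* v * u + v^3*u) / ((1 + v\<^sup>2) * c)))"
      unfolding q1 q2 by (simp only: distrib_left) (simp add: mult_ac)
    ultimately show ?thesis unfolding P Q by simp
  qed
  also have "\<dots> = X * (u * (Gp * pp1 u v + Gq * qq1 u v)) + Y * (v * (Gp * pp1 v u + Gq * qq1 v u))"
    by (simp add: algebra_simps)
  also have "u * (Gp * pp1 u v + Gq * qq1 u v) = c * legS u * legR v / (1 + u\<^sup>2) - u * v * legR u * legR v"
    unfolding Du using nz by (simp add: divide_simps)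
  also have "v * (Gp * pp1 v u + Gq * qq1 v u) = c * legS v * legR u / (1 + v\<^sup>2) - u * v * legR u * legR v"
    unfolding Dv using nz by (simp add: divide_simps)
  finally show ?thesis by (simp add: p_def q_def Gp_def Gq_def)
qed

text \<open>Here \<open>ca\<close> = cos \<alpha>, \<open>cb\<close> = cos \<beta>, \<open>S\<close>
  = sin \<alpha> sin \<beta>, \<open>D\<close> = 1 - cos(\<alpha> - \<beta>), \<open>T\<close> = 1 +
  cos(\<alpha> + \<beta>). These are free of the further square roots that u and v contain at the
  evaluation point.\<close>

lemma half_angle_identities:
  fixes u v :: real
  assumes "u \<noteq> v" "1 - u * v \<noteq> 0"
  defines "c \<equiv> 1 - u * v"
  defines "ca \<equiv> (1 - u\<^sup>2) / (1 + u\<^sup>2)" and "cb \<equiv> (1 - v\<^sup>2) / (1 + v\<^sup>2)"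
  defines "S \<equiv> 2 * u / (1 + u\<^sup>2) * (2 * v / (1 + v\<^sup>2))"
  defines "D \<equiv> 1 - ca * cb - S" and "T \<equiv> 1 + ca * cb - S"
  shows "D = 2 * (u - v)\<^sup>2 / ((1 + u\<^sup>2) * (1 + v\<^sup>2))" "T = 2 * c\<^sup>2 / ((1 + u\<^sup>2) * (1 + v\<^sup>2))"
    and "pp u v = - (D / T / 16)" "qq u v = - (S / (16 * T\<^sup>2))"
    and "2 * u * (1 - v\<^sup>2) / ((u - v) * c) = ((1 - ca\<^sup>2) * cb - S * ca) / D + ((1 - ca\<^sup>2) * cb + S * ca) / T"
    and "2 * v * (1 - u\<^sup>2) / ((u - v) * c) = (S * cb - ca * (1 - cb\<^sup>2)) / D - (S * cb + ca * (1 - cb\<^sup>2)) / T"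
    and "(1 + 3*u\<^sup>2 + 3*u* v + u^3* v) / ((1 + u\<^sup>2) * c) = ca + 2 * (((1 - ca\<^sup>2) * cb + S * ca) / T)"
    and "(1 + 3* v\<^sup>2 + 3* v * u + v^3*u) / ((1 + v\<^sup>2) * c) = cb + 2 * ((S * cb + ca * (1 - cb\<^sup>2)) / T)"
    and "u * v / c + u\<^sup>2 / (1 + u\<^sup>2) = ((1 - ca\<^sup>2) * cb + S * ca) / T / 2"
    and "u * v / c + v\<^sup>2 / (1 + v\<^sup>2) = (S * cb + ca * (1 - cb\<^sup>2)) / T / 2"
proof -
  define U V where "U = 1 + u\<^sup>2" and "V = 1 + v\<^sup>2"
  have UV: "U > 0" "V > 0" unfolding U_def V_def by (rule one_plus_square_pos)+
  hence nz: "U \<noteq> 0" "V \<noteq> 0" "c \<noteq> 0" "u - v \<noteq> 0" using assms by (auto simp: c_def)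
  have ca: "ca = (1 - u\<^sup>2) / U" and cb: "cb = (1 - v\<^sup>2) / V" and S: "S = 4 * u * v / (U * V)"
    by (simp_all add: ca_def cb_def S_def U_def V_def)
  have sa: "1 - ca\<^sup>2 = 4 * u\<^sup>2 / U\<^sup>2" and sb: "1 - cb\<^sup>2 = 4 * v\<^sup>2 / V\<^sup>2"
    unfolding ca cb using nz by (simp_all add: divide_simps) (simp_all add: U_def V_def power2_eq_square algebra_simps)
  show D: "D = 2 * (u - v)\<^sup>2 / ((1 + u\<^sup>2) * (1 + v\<^sup>2))" and T: "T = 2 * c\<^sup>2 / ((1 + u\<^sup>2) * (1 + v\<^sup>2))"
    unfolding D_def T_def ca cb S U_def[symmetric] V_def[symmetric] using nz 
    by (simp_all add: divide_simps) (simp_all add: U_def V_def c_def power2_eq_square algebra_simps)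
  note D = D[folded U_def V_def] and T = T[folded U_def V_def]
  show "pp u v = - (D / T / 16)" unfolding D T pp_def using nz by (simp add: divide_simps c_def[symmetric])
  show "qq u v = - (S / (16 * T\<^sup>2))" unfolding T S qq_def U_def[symmetric] V_def[symmetric] c_def[symmetric] 
    using nz by (simp add: divide_simps) (simp add: eval_nat_numeral algebra_simps)
  have "(1 - ca\<^sup>2) * cb - S * ca = 4 * u * ((u - v) * (1 + u * v)) / (U\<^sup>2 * V)"
   and "S * cb - ca * (1 - cb\<^sup>2) = 4 * v * ((u - v) * (1 + u * v)) / (U * V\<^sup>2)"
   and "(1 - ca\<^sup>2) * cb + S * ca = 4 * u * ((u + v) * c) / (U\<^sup>2 * V)"
   and "S * cb + ca * (1 - cb\<^sup>2) = 4 * v * ((u + v) * c) / (U * V\<^sup>2)"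
    unfolding sa sb unfolding S ca cb using nz
    by (simp_all add: divide_simps) (simp_all add: c_def power2_eq_square algebra_simps)
  note * = this
  have e: "((1 - ca\<^sup>2) * cb - S * ca) / D = 2 * u * (1 + u * v) / (U * (u - v))"
   "(S * cb - ca * (1 - cb\<^sup>2)) / D = 2 * v * (1 + u * v) / (V * (u - v))"
   "((1 - ca\<^sup>2) * cb + S * ca) / T = 2 * u * (u + v) / (U * c)"
   "(S * cb + ca * (1 - cb\<^sup>2)) / T = 2 * v * (u + v) / (V * c)"
    unfolding * D T using nz by (simp_all add: divide_simps power2_eq_square)
  show "2 * u * (1 - v\<^sup>2) / ((u - v) * c) = ((1 - ca\<^sup>2) * cb - S * ca) / D + ((1 - ca\<^sup>2) * cb + S * ca) / T"
   and "2 * v * (1 - u\<^sup>2) / ((u - v) * c) = (S * cb - ca * (1 - cb\<^sup>2)) / D - (S * cb + ca * (1 - cb\<^sup>2)) / T"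
    unfolding e using nz by (simp_all add: divide_simps) (simp_all add: U_def V_def c_def power2_eq_square algebra_simps)
  show "(1 + 3*u\<^sup>2 + 3*u* v + u^3* v) / ((1 + u\<^sup>2) * c) = ca + 2 * (((1 - ca\<^sup>2) * cb + S * ca) / T)"
    and "(1 + 3* v\<^sup>2 + 3* v * u + v^3*u) / ((1 + v\<^sup>2) * c) = cb + 2 * ((S * cb + ca * (1 - cb\<^sup>2)) / T)"
    unfolding e unfolding ca cb U_def[symmetric] V_def[symmetric] using nz 
    by (simp_all add: divide_simps) (simp_all add: U_def V_def c_def power2_eq_square power3_eq_cube algebra_simps)
  show "u * v / c + u\<^sup>2 / (1 + u\<^sup>2) = ((1 - ca\<^sup>2) * cb + S * ca) / T / 2"
    and "u * v / c + v\<^sup>2 / (1 + v\<^sup>2) = (S * cb + ca * (1 - cb\<^sup>2)) / T / 2"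
    unfolding e unfolding U_def[symmetric] V_def[symmetric] using nz 
    by (simp_all add: divide_simps) (simp_all add: U_def V_def c_def power2_eq_square algebra_simps)
qed

section \<open>Evaluation at the singular moduli\<close>

text \<open>With the radicals as opaque parameters, \<open>sq\<close> and \<open>sq'\<close> reduce
  polynomials in them to combinations of 1, w, f, w f and their multiples by r, so that equalities
  become comparisons of rational coefficients.\<close>

locale singular_moduli =
  fixes w f r :: real
  assumes w_def: "w = sqrt 3" and f_def: "f = sqrt 5" and r_def: "r = sqrt ((f - 1) / 2)"
begin

lemma sq: "w * w = 3" "f * f = 5" "r * r = (f - 1) / 2"
  and sq': "w * (w * x) = 3 * x" "f * (f * x) = 5 * x" "r * (r * x) = (f - 1) / 2 * x"
  and pos: "w > 0" "f > 1" "r > 0"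
proof -
  show f1: "f > 1" by (simp add: f_def)
  show s: "w * w = 3" "f * f = 5" "r * r = (f - 1) / 2"
    using f1 by (simp_all add: w_def r_def) (simp_all add: f_def)
  show "w * (w * x) = 3 * x" "f * (f * x) = 5 * x" "r * (r * x) = (f - 1) / 2 * x"
    unfolding mult.assoc[symmetric] s by simp_all
  show "w > 0" "r > 0" using f1 by (simp_all add: w_def r_def)
qed

text \<open>The many digits compensate for the cancellation in \<open>ca\<close> and
  \<open>cb\<close>; the latter lies within 10^-7 of 1.\<close>

lemma bounds:
  "(22360679774997/10000000000000) < f" "f < (22360679774998/10000000000000)" 
  "(17320508075688/10000000000000) < w" "w < (17320508075689/10000000000000)"
  "(38729833462074/10000000000000) < w * f" "w * f < (38729833462075/10000000000000)"
  "(786151377757/1000000000000) < r" "r < (786151377758/1000000000000)"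
proof -
  show f: "(22360679774997/10000000000000) < f" "f < (22360679774998/10000000000000)" 
    unfolding f_def by (rule real_less_rsqrt real_less_lsqrt; simp add: power2_eq_square)+
  show "(17320508075688/10000000000000) < w" "w < (17320508075689/10000000000000)" 
    unfolding w_def by (rule real_less_rsqrt real_less_lsqrt; simp add: power2_eq_square)+
  have wf: "w * f = sqrt 15" by (simp add: w_def f_def real_sqrt_mult[symmetric])
  show "(38729833462074/10000000000000) < w * f" "w * f < (38729833462075/10000000000000)" 
    unfolding wf by (rule real_less_rsqrt real_less_lsqrt; simp add: power2_eq_square)+
  show "(786151377757/1000000000000) < r" 
    unfolding r_def by (rule real_less_rsqrt) (use f in \<open>simp add: power2_eq_square\<close>)
  show "r < (786151377758/1000000000000)" 
    unfolding r_def by (rule real_less_lsqrt) (use f in \<open>simp_all add: power2_eq_square\<close>)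
qed

text \<open>
  The quintic transformation has its fixed point at \<open>2 r\<^sup>3\<close>; \<open>k1\<close> and \<open>k2\<close> are the roots of the quartic
  equations by which the cubic transformation takes \<open>- 2 r\<^sup>3\<close> to \<open>ca\<close> and \<open>2 r\<^sup>3\<close> to \<open>cb\<close>.
\<close>

definition "k1 = r * ((1 + f) * w / 2 - 1)"
definition "k2 = r * ((1 + f) * w / 2 + 1)"
definition "ca = r * (- 926 + 414 * f + 535 * w - 239 * (w * f))"
definition "cb = r * (926 - 414 * f + 535 * w - 239 * (w * f))"

lemma k_bounds: "1 < k1" "k1 \<le> 3" "1 < k2" "k2 \<le> 3"
proof -
  have *: "(1 + f) * w / 2 = (w + w * f) / 2" by (simp add: algebra_simps)
  have "w + w * f > 56/10" "w + w * f < 562/100" using bounds by simp_all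
  hence a: "(w + w * f) / 2 > (28/10)" "(w + w * f) / 2 < (281/100)" by simp_all
  have r: "(78/100) < r" "r < (787/1000)" using bounds by linarith+
  have "(78/100) * (18/10) < r * ((w + w * f) / 2 - 1)" using a r by (intro mult_strict_mono) auto
  thus "1 < k1" unfolding k1_def * by simp
  have "r * ((w + w * f) / 2 - 1) \<le> (787/1000) * (181/100)" using a r by (intro mult_mono) auto
  thus "k1 \<le> 3" unfolding k1_def * by simp
  have "(78/100) * (38/10) < r * ((w + w * f) / 2 + 1)" using a r by (intro mult_strict_mono) auto
  thus "1 < k2" unfolding k2_def * by simp
  have "r * ((w + w * f) / 2 + 1) \<le> (787/1000) * (381/100)" using a r by (intro mult_mono) auto
  thus "k2 \<le> 3" unfolding k2_def * by simp
qed

lemma c_bounds: "(5788/10000) < ca" "ca < (5789/10000)" "(9999999/10000000) < cb" "cb < 1"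
proof -
  have a: "(7363/10000) < - 926 + 414 * f + 535 * w - 239 * (w * f)" "- 926 + 414 * f + 535 * w - 239 * (w * f) < (73631/100000)"
    and b: "(127201962/100000000) < 926 - 414 * f + 535 * w - 239 * (w * f)" "926 - 414 * f + 535 * w - 239 * (w * f) < (1272019621/1000000000)"
    using bounds by linarith+
  have r: "(786151377/1000000000) < r" "r < (786151378/1000000000)" using bounds by linarith+
  have "(786151377/1000000000) * (7363/10000) < ca" "ca < (786151378/1000000000) * (73631/100000)"
    unfolding ca_def using a r by (intro mult_strict_mono; simp)+
  thus "(5788/10000) < ca" "ca < (5789/10000)" by simp_all
  have "(786151377/1000000000) * (127201962/100000000) < cb" "cb < (786151378/1000000000) * (1272019621/1000000000)"
    unfolding cb_def using b r by (intro mult_strict_mono; simp)+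
  thus "(9999999/10000000) < cb" "cb < 1" by simp_all
qed

lemma k_sq: "k1\<^sup>2 = 1 + 2 * f - 2 * w" "k2\<^sup>2 = 1 + 2 * f + 2 * w"
  unfolding k1_def k2_def power2_eq_square by (simp_all add: field_simps sq sq')

text \<open>Supplies the reciprocals of \<open>k1\<close> and \<open>k2\<close> in normal form, so
  that the later evaluations need no division.\<close>

lemma k_inv: "k1 * (r * (- 2 + f + 3 / 2 * w - 1 / 2 * (w * f))) = 1" "k2 * (r * (2 - f + 3 / 2 * w - 1 / 2 * (w * f))) = 1"
  unfolding k1_def k2_def by (simp_all add: field_simps sq sq')

end

section \<open>The transformations at the singular moduli\<close>

context singular_moduli
begin

lemma k_pos: "k1 > 0" "k2 > 0" "k1 \<noteq> 0" "k2 \<noteq> 0"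
  using k_bounds by linarith+

text \<open>\<open>n1\<close> and \<open>n2\<close> are minus the coefficient of
  \<open>legH t\<close> in the second part of \<open>cubic_transformation\<close>, at
  \<open>k1\<close> and \<open>k2\<close>.\<close>

definition "n1 = 36 - 16 * f - 20 * w + 9 * (w * f)"
definition "n2 = 36 - 16 * f + 20 * w - 9 * (w * f)"

lemma n_eq: "(9 - k1\<^sup>2) * (k1\<^sup>2 - 1) / (8 * k1\<^sup>2) = n1" "(9 - k2\<^sup>2) * (k2\<^sup>2 - 1) / (8 * k2\<^sup>2) = n2"
proof -
  have "(9 - k1\<^sup>2) * (k1\<^sup>2 - 1) = n1 * (8 * k1\<^sup>2)" "(9 - k2\<^sup>2) * (k2\<^sup>2 - 1) = n2 * (8 * k2\<^sup>2)"
    unfolding k_sq n1_def n2_def by (simp_all add: algebra_simps sq sq')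
  thus "(9 - k1\<^sup>2) * (k1\<^sup>2 - 1) / (8 * k1\<^sup>2) = n1" "(9 - k2\<^sup>2) * (k2\<^sup>2 - 1) / (8 * k2\<^sup>2) = n2"
    using k_pos by simp_all
qed

lemma cubic_values:
  "(k1^4 - 6*k1\<^sup>2 - 3) / (8*k1) = - (2 * r^3)" "(k2^4 - 6*k2\<^sup>2 - 3) / (8*k2) = 2 * r^3"
  "(k1^4 + 18*k1\<^sup>2 - 27) / (8*k1^3) = ca" "(k2^4 + 18*k2\<^sup>2 - 27) / (8*k2^3) = cb"
proof -
  have k4: "k1^4 = (1 + 2 * f - 2 * w) * (1 + 2 * f - 2 * w)" "k2^4 = (1 + 2 * f + 2 * w) * (1 + 2 * f + 2 * w)"
    unfolding k_sq[symmetric] by (simp_all add: eval_nat_numeral)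
  have "k1^4 - 6*k1\<^sup>2 - 3 = - (2 * r^3) * (8*k1)" "k2^4 - 6*k2\<^sup>2 - 3 = 2 * r^3 * (8*k2)"
    unfolding k4 k_sq unfolding k1_def k2_def power3_eq_cube by (simp_all add: field_simps sq sq')
  thus "(k1^4 - 6*k1\<^sup>2 - 3) / (8*k1) = - (2 * r^3)" "(k2^4 - 6*k2\<^sup>2 - 3) / (8*k2) = 2 * r^3"
    using k_pos by simp_all
  have "k1^4 + 18*k1\<^sup>2 - 27 = ca * k1 * (8 * k1\<^sup>2)" "k2^4 + 18*k2\<^sup>2 - 27 = cb * k2 * (8 * k2\<^sup>2)"
    unfolding k4 k_sq unfolding k1_def k2_def ca_def cb_def by (simp_all add: field_simps sq sq')
  moreover have "ca * k1 * (8 * k1\<^sup>2) = ca * (8*k1^3)" "cb * k2 * (8 * k2\<^sup>2) = cb * (8*k2^3)"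
    by (simp_all add: eval_nat_numeral)
  ultimately show "(k1^4 + 18*k1\<^sup>2 - 27) / (8*k1^3) = ca" "(k2^4 + 18*k2\<^sup>2 - 27) / (8*k2^3) = cb"
    using k_pos by simp_all
qed

text \<open>The quintic transformation at k = sqrt 5, the fixed point of k -> 5/k, where s = -2 r^3
  and t = 2 r^3.\<close>

lemma quintic_values:
  "legH (- (2 * r^3)) = f * legH (2 * r^3)"
  "legK (- (2 * r^3)) = (f - 3) * r * legH (2 * r^3) + f * legK (2 * r^3)"
proof -
  have q: "sqrt (f\<^sup>2 - 2 * f + 5) = 2 * r * sqrt f"
  proof -
    have "f\<^sup>2 - 2 * f + 5 = 2\<^sup>2 * (r * r) * f" unfolding sq by (simp add: power2_eq_square sq algebra_simps)
    also have "\<dots> = (2 * r * sqrt f)\<^sup>2" using pos by (simp add: power_mult_distrib power2_eq_square)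
    finally show ?thesis using pos by (simp add: real_sqrt_unique)
  qed
  have sf: "sqrt f > 0" "sqrt f * sqrt f = f" using pos by simp_all
  have s: "(f\<^sup>2 - 4*f - 1) * sqrt (f\<^sup>2 - 2*f + 5) / (8 * sqrt f) = - (2 * r^3)"
    unfolding q using sf(1) by (simp add: power2_eq_square power3_eq_cube field_simps sq sq')
  have t: "(f\<^sup>2 + 20*f - 25) * sqrt (f\<^sup>2 - 2*f + 5) / (8 * f\<^sup>2 * sqrt f) = 2 * r^3"
    unfolding q using sf(1) by (simp add: power2_eq_square power3_eq_cube field_simps sq sq')
  have n: "- ((5 - f) * (f - 1) * sqrt f * sqrt (f\<^sup>2 - 2*f + 5) / (4 * f\<^sup>2)) = (f - 3) * r"
  proof -
    have "(5 - f) * (f - 1) * sqrt f * (2 * r * sqrt f) = (5 - f) * (f - 1) * (2 * r) * (sqrt f * sqrt f)" by simp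
    thus ?thesis unfolding q sf by (simp add: power2_eq_square field_simps sq sq')
  qed
  have "f \<le> 5" "1 < f" using bounds by linarith+
  moreover have "5 / f = f" using pos sq(2) by (simp add: field_simps)
  ultimately show "legH (- (2 * r^3)) = f * legH (2 * r^3)"
    "legK (- (2 * r^3)) = (f - 3) * r * legH (2 * r^3) + f * legK (2 * r^3)"
    using quintic_transformation[of f] unfolding s t n by simp_all
qed

text \<open>The cubic transformation is solved for its values at t. For the last equation,
  \<open>quintic_values\<close> removes H(-s) and K(-s) from Legendre's relation at s = 2
  r^3.\<close>

lemma leg_values:
  defines "H0 \<equiv> legH (2 * r^3)" and "K0 \<equiv> legK (2 * r^3)"
  shows "legH ca = k1 * f / 3 * H0" "legK ca = r * (- 2 + f + 3 / 2 * w - 1 / 2 * (w * f)) * ((f - 3) * r * H0 + f * K0 + n1 * (k1 * f / 3 * H0))"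
    and "legH cb = k2 / 3 * H0" "legK cb = r * (2 - f + 3 / 2 * w - 1 / 2 * (w * f)) * (K0 + n2 * (k2 / 3 * H0))"
    and "(f - 3) * r * H0\<^sup>2 + 2 * f * H0 * K0 = - 2 / pi"
proof -
  have 1: "legH (- (2 * r^3)) = 3 / k1 * legH ca" "legK (- (2 * r^3)) = - n1 * legH ca + k1 * legK ca"
    using cubic_transformation[OF k_bounds(1,2)] unfolding cubic_values n_eq by simp_all
  have 2: "H0 = 3 / k2 * legH cb" "K0 = - n2 * legH cb + k2 * legK cb"
    using cubic_transformation[OF k_bounds(3,4)] unfolding cubic_values n_eq H0_def K0_def by simp_all
  show Ha: "legH ca = k1 * f / 3 * H0" using 1(1) k_pos unfolding quintic_values H0_def[symmetric] by (simp add: field_simps)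
  show Hb: "legH cb = k2 / 3 * H0" using 2(1) k_pos by (simp add: field_simps)
  have i: "r * (- 2 + f + 3 / 2 * w - 1 / 2 * (w * f)) = 1 / k1" "r * (2 - f + 3 / 2 * w - 1 / 2 * (w * f)) = 1 / k2"
    using k_inv k_pos by (simp_all add: field_simps)
  show "legK ca = r * (- 2 + f + 3 / 2 * w - 1 / 2 * (w * f)) * ((f - 3) * r * H0 + f * K0 + n1 * (k1 * f / 3 * H0))"
    using 1(2) k_pos unfolding i Ha[symmetric] quintic_values H0_def[symmetric] K0_def[symmetric] by (simp add: field_simps)
  show "legK cb = r * (2 - f + 3 / 2 * w - 1 / 2 * (w * f)) * (K0 + n2 * (k2 / 3 * H0))"
    using 2(2) k_pos unfolding i Hb[symmetric] by (simp add: field_simps)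
  have "2 * r^3 < 1"
  proof -
    have "r < 79/100" using bounds by linarith
    hence "r^3 < (79/100)^3" using pos by (intro power_strict_mono) auto
    thus ?thesis by (simp add: eval_nat_numeral)
  qed
  hence "H0 * legK (- (2 * r^3)) + K0 * legH (- (2 * r^3)) = - 2 / pi"
    unfolding H0_def K0_def using pos by (intro Legendre_relation) (auto intro: less_trans[of _ 0])
  thus "(f - 3) * r * H0\<^sup>2 + 2 * f * H0 * K0 = - 2 / pi"
    unfolding quintic_values H0_def[symmetric] K0_def[symmetric] by (simp add: power2_eq_square algebra_simps)
qed

end

section \<open>The linear system for z d/dz and the final evaluation\<close>

context singular_moduli
begin

text \<open>
  \<open>g\<^sup>2 = sin \<alpha> sin \<beta>\<close>, and \<open>X\<close>, \<open>Y\<close> solve the linear equations expressing \<open>z d/dz\<close> (at fixed \<open>y\<close>) 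
  as \<open>X u \<partial>\<^sub>u + Y v \<partial>\<^sub>v\<close>.
\<close>

definition "g = 17 * f - 38"
text \<open>Closed forms of the four quotients in \<open>half_angle_identities\<close>:
  \<open>asa\<close> and \<open>asb\<close> have denominator D = 32 g, \<open>bsa\<close> and
  \<open>bsb\<close> have T = 120 g; the last letter refers to \<alpha> or \<beta>.\<close>

definition "asa = r * (3317 / 8 * f - 7409 / 8 + 535 * w - 239 * (w * f))"
definition "asb = r * (3317 / 8 * f - 7409 / 8 - 535 * w + 239 * (w * f))"
definition "bsa = r * (926 - 414 * f - 2139 / 4 * w + 14353 / 60 * (w * f))"
definition "bsb = r * (414 * f - 926 - 2139 / 4 * w + 14353 / 60 * (w * f))"
definition "X = r * (395 / 1054 * w + 133 / 1054 * (w * f) - 90 / 527 - 78 / 527 * f)"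
definition "Y = r * (395 / 1054 * w + 133 / 1054 * (w * f) + 90 / 527 + 78 / 527 * f)"
text \<open>The value of cos((\<alpha> + \<beta>)/2), the positive square root of T/2 = 60
  g.\<close>

definition "cs = r * (7 * (w * f) - 15 * w)"

text \<open>g equals (sqrt 5 - 2)^3. The quadratic relation, together with
  \<open>ca * cb = 44 * g\<close>, makes D and T rational multiples of g, which is why p and q come
  out rational.\<close>

lemma g_pos: "g > 0" and g_sq: "g\<^sup>2 = 1 - 76 * g" and cs_pos: "cs > 0"
proof -
  show "g > 0" using bounds unfolding g_def by linarith
  show "g\<^sup>2 = 1 - 76 * g" unfolding g_def power2_eq_square by (simp add: algebra_simps sq sq')
  have "7 * f > 15" using bounds by linarith
  hence "r * (w * (7 * f - 15)) > 0" using pos by simp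
  thus "cs > 0" unfolding cs_def by (simp add: algebra_simps)
qed

lemma trig_values:
  "ca * cb = 44 * g" "(1 - ca\<^sup>2) * (1 - cb\<^sup>2) = g^4" "cs\<^sup>2 = 60 * g"
  "(1 - ca\<^sup>2) * cb - g\<^sup>2 * ca = asa * (32 * g)" "g\<^sup>2 * cb - ca * (1 - cb\<^sup>2) = asb * (32 * g)"
  "(1 - ca\<^sup>2) * cb + g\<^sup>2 * ca = bsa * (120 * g)" "g\<^sup>2 * cb + ca * (1 - cb\<^sup>2) = bsb * (120 * g)"
proof -
  have ca2: "ca\<^sup>2 = 152 * g / 2 - 1920 * g\<^sup>2 - 496 * g\<^sup>2 * (w * f)"
    and cb2: "cb\<^sup>2 = 152 * g / 2 - 1920 * g\<^sup>2 + 496 * g\<^sup>2 * (w * f)"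
    unfolding ca_def cb_def g_def power2_eq_square by (simp_all add: field_simps sq sq')
  show "ca * cb = 44 * g" unfolding ca_def cb_def g_def by (simp add: field_simps sq sq')
  have g4: "g^4 = (1 - 76 * g) * (1 - 76 * g)" unfolding g_sq[symmetric] by (simp add: eval_nat_numeral)
  show "(1 - ca\<^sup>2) * (1 - cb\<^sup>2) = g^4" unfolding ca2 cb2 g4 g_sq unfolding g_def by (simp add: field_simps sq sq')
  show "cs\<^sup>2 = 60 * g" unfolding cs_def g_def power2_eq_square by (simp add: field_simps sq sq')
  show "(1 - ca\<^sup>2) * cb - g\<^sup>2 * ca = asa * (32 * g)" "g\<^sup>2 * cb - ca * (1 - cb\<^sup>2) = asb * (32 * g)"
    "(1 - ca\<^sup>2) * cb + g\<^sup>2 * ca = bsa * (120 * g)" "g\<^sup>2 * cb + ca * (1 - cb\<^sup>2) = bsb * (120 * g)"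
    unfolding ca2 cb2 g_sq unfolding g_def ca_def cb_def asa_def asb_def bsa_def bsb_def by (simp_all add: field_simps sq sq')
qed

lemma XY_eqs:
  "X * (asa + bsa) - Y * (asb - bsb) = 1" "X * (ca + 2 * bsa) + Y * (cb + 2 * bsb) = 2"
  "X * bsa + Y * bsb = 1 - 6 / 17 * f"
  unfolding X_def Y_def asa_def asb_def bsa_def bsb_def ca_def cb_def by (simp_all add: field_simps sq sq')

text \<open>In terms of H0 and K0, \<open>PQ\<close> makes the H0 K0 coefficient -520 f and
  \<open>E1\<close> makes the H0^2 coefficient -260 (f - 3) r. Together they are -260 times the left
  side of the last equation in \<open>leg_values\<close>, whose value is -2/pi.\<close>

lemma final_value:
  "cs * (legH ca * legH cb * (233 - 527 * (X * bsa + Y * bsb)) - 1054 * (X * legK ca * legH cb + Y * legK cb * legH ca)) = 520 / pi"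
proof -
  define H0 K0 where "H0 = legH (2 * r^3)" and "K0 = legK (2 * r^3)"
  define i1 i2 where "i1 = r * (- 2 + f + 3 / 2 * w - 1 / 2 * (w * f))" and "i2 = r * (2 - f + 3 / 2 * w - 1 / 2 * (w * f))"
  define P Q where "P = X * i1 * k2" and "Q = Y * i2 * k1"
  have P: "P = r * (75 / 527 + 33 / 527 * f + 325 / 1054 * w + 143 / 1054 * (w * f))"
   and Q: "Q = r * (- 75 / 527 - 33 / 527 * f + 325 / 1054 * w + 143 / 1054 * (w * f))"
    unfolding P_def Q_def X_def Y_def i1_def i2_def k1_def k2_def by (simp_all add: field_simps sq sq')
  have kk: "k1 * k2 = 2 + f" unfolding k1_def k2_def by (simp add: field_simps sq sq')
  have Z: "P * k1 * n1 + Q * k2 * n2 = 225 / 527 + 57 / 527 * f"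
    unfolding P Q k1_def k2_def n1_def n2_def by (simp add: field_simps sq sq')
  have PQ: "cs * (P + Q) = 520 * 3 / 1054" unfolding P Q cs_def by (simp add: field_simps sq sq')
  have E1: "cs * (f * (2 + f) / 9 * (233 - 527 * (1 - 6 / 17 * f)) - 1054 * (P * ((f - 3) * r) / 3 + f / 9 * (225 / 527 + 57 / 527 * f)))
      = - 260 * ((f - 3) * r)"
    unfolding P cs_def by (simp add: field_simps sq sq')
  have "cs * (legH ca * legH cb * (233 - 527 * (X * bsa + Y * bsb)) - 1054 * (X * legK ca * legH cb + Y * legK cb * legH ca))
     = H0\<^sup>2 * (cs * (f * (k1 * k2) / 9 * (233 - 527 * (X * bsa + Y * bsb)) - 1054 * (P * ((f - 3) * r) / 3 + f / 9 * (P * k1 * n1 + Q * k2 * n2))))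
      + H0 * K0 * (- 1054 * f / 3 * (cs * (P + Q)))"
    unfolding leg_values(1-4) H0_def[symmetric] K0_def[symmetric] i1_def[symmetric] i2_def[symmetric] P_def Q_def
    by (simp add: field_simps power2_eq_square)
  also have "\<dots> = - 260 * ((f - 3) * r * H0\<^sup>2 + 2 * f * H0 * K0)"
    unfolding kk Z PQ XY_eqs(3) E1 by (simp add: algebra_simps)
  also have "\<dots> = 520 / pi" unfolding leg_values(5)[folded H0_def K0_def] by simp
  finally show ?thesis .
qed

lemma dps_value:
  "1054 * (-1/60 * dps (dshift sun_coeff) (-1/60) (-1/230400) + 2 * (-1/230400 * dps (dshift2 sun_coeff) (-1/60) (-1/230400))) 
     + 233 * dps sun_coeff (-1/60) (-1/230400) = 520 / pi"
proof -
  define u v where "u = sqrt ((1 - ca) / (1 + ca))" and "v = sqrt ((1 - cb) / (1 + cb))"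
  note cB = c_bounds
  have u2: "u\<^sup>2 = (1 - ca) / (1 + ca)" and v2: "v\<^sup>2 = (1 - cb) / (1 + cb)"
    unfolding u_def v_def using cB by simp_all
  have uv0: "u > 0" "v > 0" unfolding u_def v_def using cB by simp_all
  have ca: "(1 - u\<^sup>2) / (1 + u\<^sup>2) = ca" and cb: "(1 - v\<^sup>2) / (1 + v\<^sup>2) = cb"
    unfolding u2 v2 using cB by (simp_all add: field_simps)
  have ub: "u < 53/100" unfolding u_def 
    by (rule real_less_lsqrt) (use cB in \<open>simp_all add: field_simps power2_eq_square\<close>)
  have vb: "v < 1/1000" unfolding v_def 
    by (rule real_less_lsqrt) (use cB in \<open>simp_all add: field_simps power2_eq_square\<close>)
  have ul: "1/1000 < u" unfolding u_def 
    by (rule real_less_rsqrt) (use cB in \<open>simp_all add: field_simps power2_eq_square\<close>)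
  define c where "c = 1 - u * v"
  have c: "c > 0" using pp_qq_bounds(3)[of u v] uv0 ub vb unfolding c_def by simp
  have c0: "1 - u * v \<noteq> 0" using c by (simp add: c_def)
  have uv: "u \<noteq> v" using ul vb by simp
  have UV: "1 + u\<^sup>2 > 0" "1 + v\<^sup>2 > 0" by (rule one_plus_square_pos)+
  \<comment> \<open>The cosines determine only the square of sin \<alpha> sin \<beta>; positivity of
    u and v selects the root g^2.\<close>
  have S: "2 * u / (1 + u\<^sup>2) * (2 * v / (1 + v\<^sup>2)) = g\<^sup>2"
  proof -
    have s: "(2 * t / (1 + t\<^sup>2))\<^sup>2 = 1 - ((1 - t\<^sup>2) / (1 + t\<^sup>2))\<^sup>2" for t :: real
      using one_plus_square_pos[of t] by (simp add: power_divide divide_simps) (simp add: power2_eq_square algebra_simps)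
    have "(2 * u / (1 + u\<^sup>2) * (2 * v / (1 + v\<^sup>2)))\<^sup>2 = (g\<^sup>2)\<^sup>2"
      unfolding power_mult_distrib s ca cb trig_values by (simp add: eval_nat_numeral)
    thus ?thesis by (rule power2_eq_imp_eq) (use uv0 UV in auto)
  qed
  have DT: "1 - ca * cb - g\<^sup>2 = 32 * g" "1 + ca * cb - g\<^sup>2 = 120 * g"
    unfolding trig_values g_sq by simp_all
  note h = half_angle_identities[OF uv c0, unfolded ca cb S DT trig_values(4-7)]
  have gg: "x * (32 * g) / (32 * g) = x" "x * (120 * g) / (120 * g) = x" for x using g_pos by simp_all
  note h = h[unfolded gg]
  have p: "pp u v = - 1 / 60" unfolding h(3) using g_pos by simp
  have q: "qq u v = - 1 / 230400" unfolding h(4) using g_pos by (simp add: field_simps)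
  \<comment> \<open>N is cos(\<alpha>/2) cos(\<beta>/2), so c N is cos((\<alpha> +
    \<beta>)/2).\<close>
  define N where "N = 1 / (sqrt (1 + u\<^sup>2) * sqrt (1 + v\<^sup>2))"
  have sq_pos: "sqrt (1 + u\<^sup>2) > 0" "sqrt (1 + v\<^sup>2) > 0" using UV by simp_all
  have cN: "c * N = cs"
  proof (rule power2_eq_imp_eq)
    have "(c * N)\<^sup>2 = 2 * c\<^sup>2 / ((1 + u\<^sup>2) * (1 + v\<^sup>2)) / 2"
      unfolding N_def using UV by (simp add: power_mult_distrib power_divide)
    also have "\<dots> = cs\<^sup>2" unfolding c_def h(2)[symmetric] trig_values by simp
    finally show "(c * N)\<^sup>2 = cs\<^sup>2" .
  qed (use c cs_pos sq_pos in \<open>auto simp: N_def\<close>)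
  have RR: "legR u * legR v = N * (legH ca * legH cb)"
    unfolding legR_def ca cb N_def by simp
  have SR: "c * legS u * legR v / (1 + u\<^sup>2) - u * v * legR u * legR v = - cs * (legK ca * legH cb + bsa / 2 * (legH ca * legH cb))"
   and RS: "c * legS v * legR u / (1 + v\<^sup>2) - u * v * legR u * legR v = - cs * (legK cb * legH ca + bsb / 2 * (legH ca * legH cb))"
    unfolding h(9,10)[symmetric] cN[symmetric] legR_def legS_def ca cb N_def c_def[symmetric] using UV sq_pos c
    by (simp add: divide_simps; simp add: algebra_simps)+
  have "pp u v * dps (dshift sun_coeff) (pp u v) (qq u v) + 2 * (qq u v * dps (dshift2 sun_coeff) (pp u v) (qq u v))
       = X * (c * legS u * legR v / (1 + u\<^sup>2) - u * v * legR u * legR v)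
       + Y * (c * legS v * legR u / (1 + v\<^sup>2) - u * v * legR u * legR v)"
    unfolding c_def
  proof (rule dps_directional_derivative)
    show "X * (2 * u * (1 - v\<^sup>2) / ((u - v) * (1 - u * v))) - Y * (2 * v * (1 - u\<^sup>2) / ((u - v) * (1 - u * v))) = 1"
      unfolding h(5,6) by (rule XY_eqs)
    show "X * ((1 + 3*u\<^sup>2 + 3*u* v + u^3* v) / ((1 + u\<^sup>2) * (1 - u * v))) + Y * ((1 + 3* v\<^sup>2 + 3* v * u + v^3*u) / ((1 + v\<^sup>2) * (1 - u * v))) = 2"
      unfolding h(7,8) by (rule XY_eqs)
  qed (use uv0 ul ub vb in auto)
  hence th: "-1/60 * dps (dshift sun_coeff) (-1/60) (-1/230400) + 2 * (-1/230400 * dps (dshift2 sun_coeff) (-1/60) (-1/230400))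
     = X * (- cs * (legK ca * legH cb + bsa / 2 * (legH ca * legH cb))) + Y * (- cs * (legK cb * legH ca + bsb / 2 * (legH ca * legH cb)))"
    unfolding SR RS p q .
  have "dps sun_coeff (-1/60) (-1/230400) = c * (legR u * legR v)"
    using double_series_product[of u v] uv0 ub vb unfolding p q c_def by (simp add: mult.assoc)
  also have "\<dots> = cs * (legH ca * legH cb)" unfolding RR cN[symmetric] by simp
  finally have G: "dps sun_coeff (-1/60) (-1/230400) = cs * (legH ca * legH cb)" .
  show ?thesis unfolding th G final_value[symmetric] by (simp add: algebra_simps)
qed

end

section \<open>The series\<close>

lemma sun_coeff_binomial_square:
  assumes "2 * m \<le> n"
  shows "sun_coeff (n - 2 * m) m = real ((2 * n) choose n) * (real (n choose (n - m)))\<^sup>2 * real ((2 * (n - m)) choose n)"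
proof -
  obtain s where n: "n = 2 * m + s" using assms le_Suc_ex by blast
  have cb: "real ((2 * n) choose n) = fact (2 * n) / (fact n * fact n)" for n
    using binomial_fact[of n "2 * n", where 'a = real] by (simp add: mult_2)
  have 1: "real ((2 * m + s) choose (m + s)) = fact (2 * m + s) / (fact (m + s) * fact m)"
    using binomial_fact[of "m + s" "2 * m + s", where 'a = real] by simp
  have 2: "real ((2 * (m + s)) choose (2 * m + s)) = fact (2 * (m + s)) / (fact (2 * m + s) * fact s)"
    using binomial_fact[of "2 * m + s" "2 * (m + s)", where 'a = real] by simp
  have 3: "4 * m + 2 * s = 2 * (2 * m + s)" "2 * m + 2 * s = 2 * (m + s)" by simp_all
  have "sun_coeff s m = real ((2 * (2 * m + s)) choose (2 * m + s)) * (real ((2 * m + s) choose (m + s)))\<^sup>2 * real ((2 * (m + s)) choose (2 * m + s))"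
    unfolding sun_coeff_def cb 1 2 unfolding 3 power2_eq_square by (simp del: fact_Suc)
  moreover have "n - 2 * m = s" "n - m = m + s" using n by simp_all
  ultimately show ?thesis by (simp only: n)
qed

text \<open>Unconditional summability permits regrouping the pairs (s, m) by n = s + 2m, with m
  running up to n div 2.\<close>

lemma has_sum_imp_sums_diagonal:
  fixes F :: "nat \<times> nat \<Rightarrow> real"
  assumes "(F has_sum S) UNIV"
  shows "(\<lambda>n. \<Sum>m\<in>{..n div 2}. F (n - 2 * m, m)) sums S"
proof -
  have bij: "bij_betw (\<lambda>(n, m). (n - 2 * m, m)) (SIGMA n:UNIV. {..n div 2}) (UNIV :: (nat \<times> nat) set)"
    by (rule bij_betwI[where g = "\<lambda>(s, m). (s + 2 * m, m)"]) auto
  have "((\<lambda>z. F (case z of (n, m) \<Rightarrow> (n - 2 * m, m))) has_sum S) (SIGMA n:UNIV. {..n div 2})"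
    using assms has_sum_reindex_bij_betw[OF bij, of F S] by simp
  hence "((\<lambda>n. \<Sum>m\<in>{..n div 2}. F (n - 2 * m, m)) has_sum S) UNIV"
    by (rule has_sum_SigmaD) (simp add: has_sum_finite)
  thus ?thesis by (rule has_sum_imp_sums)
qed

theorem theorem5p7:
  shows "(\<lambda>n::nat. (1054 * real n + 233) / 480 ^ n * real (2*n choose n) *
            (\<Sum>k=0..n. real (n choose k) ^ 2 * real (2*k choose n) * (-1) ^ k
                         * (8::real) powi (2 * int k - int n)))
         sums (520 / pi)"
proof -
  define p q :: real where "p = - 1 / 60" and "q = - 1 / 230400"
  have pq: "\<bar>p\<bar> < 1/50" "\<bar>q\<bar> < 1/10000" by (simp_all add: p_def q_def)
  note dr = dconv_sun_coeff dconv_dshift[OF dconv_sun_coeff] dconv_dshift2[OF dconv_sun_coeff]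
  have h: "(dterm sun_coeff p q has_sum dps sun_coeff p q) UNIV"
    "(dterm (\<lambda>s m. real s * sun_coeff s m) p q has_sum p * dps (dshift sun_coeff) p q) UNIV"
    "(dterm (\<lambda>s m. real m * sun_coeff s m) p q has_sum q * dps (dshift2 sun_coeff) p q) UNIV"
    by (rule dconv_has_sum[OF dr(1) pq])
       (rule has_sum_dterm_up[OF dconv_has_sum[OF dr(2) pq]] has_sum_dterm_up2[OF dconv_has_sum[OF dr(3) pq]]; 
        simp add: dshift_def dshift2_eq)+
  \<comment> \<open>The weight is 1054 (s + 2m) + 233, which is 1054 n + 233 on the diagonal n = s +
    2m.\<close>
  have "((\<lambda>z. 1054 * (dterm (\<lambda>s m. real s * sun_coeff s m) p q z + 2 * dterm (\<lambda>s m. real m * sun_coeff s m) p q z) + 233 * dterm sun_coeff p q z)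
      has_sum (1054 * (p * dps (dshift sun_coeff) p q + 2 * (q * dps (dshift2 sun_coeff) p q)) + 233 * dps sun_coeff p q)) UNIV" (is "(?F has_sum _) _")
    by (intro has_sum_add has_sum_cmult_right h)
  hence "(?F has_sum (520 / pi)) UNIV"
    using singular_moduli.dps_value[of "sqrt 3" "sqrt 5" "sqrt ((sqrt 5 - 1) / 2)"] 
    by (simp add: p_def q_def singular_moduli_def)
  hence "(\<lambda>n. \<Sum>m\<in>{..n div 2}. ?F (n - 2 * m, m)) sums (520 / pi)"
    by (rule has_sum_imp_sums_diagonal)
  moreover have "(\<Sum>m\<in>{..n div 2}. ?F (n - 2 * m, m)) = (1054 * real n + 233) / 480 ^ n * real (2*n choose n) *
            (\<Sum>k=0..n. real (n choose k) ^ 2 * real (2*k choose n) * (-1) ^ k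
                         * (8::real) powi (2 * int k - int n))" for n
  proof -
    let ?t = "\<lambda>k. real (n choose k) ^ 2 * real (2*k choose n) * (-1) ^ k * (8::real) powi (2 * int k - int n)"
    let ?w = "(1054 * real n + 233) / 480 ^ n * real (2*n choose n)"
    have summand: "?F (n - 2 * m, m) = ?w * ?t (n - m)" if "m \<le> n div 2" for m
    proof -
      have mn: "2 * m \<le> n" using that by linarith
      then obtain s where n: "n = 2 * m + s" using le_Suc_ex by blast
      have "?F (n - 2 * m, m) = (1054 * real n + 233) * sun_coeff (n - 2 * m) m * (p ^ s * q ^ m)"
        by (simp add: dterm_def n algebra_simps)
      also have "p ^ s * q ^ m = (-1) ^ (n - m) * 8 powi (2 * int (n - m) - int n) / 480 ^ n"
      proof -
        have "2 * int (n - m) - int n = int s" using n by simp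
        moreover have "n - m = m + s" using n by simp
        moreover have "p ^ s = (-1) ^ s * (8 ^ s / 480 ^ s)" 
          unfolding p_def power_divide[symmetric] power_mult_distrib[symmetric] by simp
        moreover have "q ^ m = (-1) ^ m / 480 ^ (2 * m)"
          unfolding q_def power_mult power_divide[symmetric] by simp
        ultimately show ?thesis by (simp add: n power_add mult_ac)
      qed
      finally show ?thesis using sun_coeff_binomial_square[OF mn] by (simp add: mult_ac)
    qed
    have "(\<Sum>m\<in>{..n div 2}. ?F (n - 2 * m, m)) = (\<Sum>m\<in>{..n div 2}. ?w * ?t (n - m))"
      by (rule sum.cong) (use summand in auto)
    also have "\<dots> = (\<Sum>k\<in>{n - n div 2..n}. ?w * ?t k)"
      by (rule sum.reindex_bij_witness[of _ "\<lambda>k. n - k" "\<lambda>m. n - m"]) auto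
    \<comment> \<open>The added terms have 2k < n, so the binomial coefficient of 2k over n is
      0.\<close>
    also have "\<dots> = (\<Sum>k=0..n. ?w * ?t k)"
      by (rule sum.mono_neutral_left) (auto simp: not_le)
    finally show ?thesis by (simp only: sum_distrib_left)
  qed
  ultimately show ?thesis by (simp only:)
qed


end
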